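(* Let $X$ be a finite set, let $L$ be the generator of an irreducible Markov process on $X$ with finite lifetime $\zeta$, let $V=(-L)^{-1}$, let $\mu$ be a probability on $X$ and let $m=\mu V$. For any $x,y\in X$ and any continuous function $F$ on $\mathbb{R}_+^X$ for which both sides below are absolutely convergent, $$\int_{\mathbb{C}^X} \tfrac12 z_x\overline{z}_y\,F\big(\tfrac12 z_u\overline z_u,\ u\in X\big)\,e^{\frac12\langle Lz,\overline z\rangle_m}\prod_{u\in X}da_u\,db_u=\int_{\mathbb{C}^X}\mathbb{E}_{x,y}\Big(F\big(l^u+\tfrac12 z_u\overline z_u,\ u\in X\big)\Big)\,e^{\frac12\langle Lz,\overline z\rangle_m}\prod_{u\in X}da_u\,db_u ,$$ where $z_u=a_u+ib_u$ with $a_u,b_u\in\mathbb{R}$.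
   Context: $X$ is finite. $L=(L_{x,y})$ is the generator of an irreducible continuous-time Markov process $(x_t)_{0\le t<\zeta}$ on $X$ killed at an almost surely finite lifetime $\zeta$: $L=-q(I-\Pi)$ with $q$ a positive function on $X$ (acting by multiplication) and $\Pi$ an irreducible submarkovian matrix, and $-L$ is invertible with potential matrix $V=(-L)^{-1}$, which has nonnegative entries. $m=\mu V$ is the (everywhere positive) measure $m_y=\sum_x\mu_xV_{x,y}$. $\mathbb{E}_x$ is the expectation for the process started at $x$. For $z\in\mathbb{C}^X$, $\langle Lz,\overline z\rangle_m=\sum_{x\in X}(Lz)_x\,\overline z_x\,m_x$ (a complex number in general, since $L$ is not assumed symmetric with respect to $m$). Local times: $l_t^x=\int_0^{t\wedge\zeta}1_{\{x_s=x\}}\frac{1}{m_{x_s}}\,ds$, and $l^x=l_\zeta^x$. The finite measure $\mathbb{E}_{x,y}$ on paths of finite duration is defined by $\mathbb{E}_{x,y}(G)=\mathbb{E}_x\big(\int_0^\zeta G(x_s,s\le t)\,dl_t^y\big)$; under $\mathbb{E}_{x,y}$, $l^u$ denotes the local time at $u$ accumulated over the whole duration of the path, so that $\mathbb{E}_{x,y}(F(l^u,u\in X))=\mathbb{E}_x\big(\int_0^\zeta F(l_t^u,u\in X)\,dl_t^y\big)$. Its total mass is $V_{x,y}/m_y$. *)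

theory Defs
  imports "HOL-Probability.Probability"
begin

definition submarkovian :: "real^'x^'x::finite \<Rightarrow> bool" where
  "submarkovian Q \<longleftrightarrow> (\<forall>x y. 0 \<le> Q $ x $ y) \<and> (\<forall>x. (\<Sum>y\<in>UNIV. Q $ x $ y) \<le> 1)"

text \<open>The power 0 is allowed, so a one-point state space is irreducible.\<close>

definition irreducible_matrix :: "real^'x^'x::finite \<Rightarrow> bool" where
  "irreducible_matrix Q \<longleftrightarrow> (\<forall>x y. \<exists>n. 0 < (((**) Q) ^^ n) (mat 1) $ x $ y)"

definition irreducible_killed_generator :: "real^'x^'x::finite \<Rightarrow> bool" where
  "irreducible_killed_generator L \<longleftrightarrow>
     (\<exists>q Q. (\<forall>x. 0 < q x) \<and> submarkovian Q \<and> irreducible_matrix Q \<and>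
       L = (\<chi> x y. - (q x * (mat 1 - Q) $ x $ y))) \<and>
     invertible (- L)"

definition potential_matrix :: "real^'x^'x::finite \<Rightarrow> real^'x^'x" where
  "potential_matrix L = matrix_inv (- L)"

definition potential_measure :: "real^'x^'x::finite \<Rightarrow> 'x pmf \<Rightarrow> real^'x" where
  "potential_measure L \<mu> = (\<chi> x. pmf \<mu> x) v* potential_matrix L"

definition energy_form :: "real^'x^'x::finite \<Rightarrow> real^'x \<Rightarrow> complex^'x \<Rightarrow> complex" where
  "energy_form L m z =
     (\<Sum>x\<in>UNIV. (\<Sum>y\<in>UNIV. of_real (L $ x $ y) * z $ y) * cnj (z $ x) * of_real (m $ x))"

text \<open>
  A process killed at its lifetime is a process with values in \<open>'x option\<close>, where
  \<open>None\<close> is the cemetery state. Only times \<open>t \<ge> 0\<close> are meaningful.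
\<close>

definition lifetime :: "(real \<Rightarrow> 'w \<Rightarrow> 'x option) \<Rightarrow> 'w \<Rightarrow> ereal" where
  "lifetime Z \<omega> = Inf {ereal t | t. 0 \<le> t \<and> Z t \<omega> = None}"

definition past :: "'w measure \<Rightarrow> (real \<Rightarrow> 'w \<Rightarrow> 'x option) \<Rightarrow> real \<Rightarrow> 'w measure" where
  "past M Z s = sigma (space M) {Z r -` A \<inter> space M | r A. 0 \<le> r \<and> r \<le> s}"

definition transition_matrix ::
  "('x \<Rightarrow> 'w measure) \<Rightarrow> (real \<Rightarrow> 'w \<Rightarrow> 'x option) \<Rightarrow> real \<Rightarrow> real^'x^'x::finite" where
  "transition_matrix P Z t = (\<chi> x y. measure (P x) {\<omega> \<in> space (P x). Z t \<omega> = Some y})"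

locale killed_markov_process =
  fixes L :: "real^'x^'x::finite"
    and P :: "'x \<Rightarrow> 'w measure"
    and Z :: "real \<Rightarrow> 'w \<Rightarrow> 'x option"
  assumes prob_space: "\<And>x. prob_space (P x)"
    and measurable_state: "\<And>x t. 0 \<le> t \<Longrightarrow> Z t \<in> measurable (P x) (count_space UNIV)"
    and start: "\<And>x. AE \<omega> in P x. Z 0 \<omega> = Some x"
    and cemetery: "\<And>x \<omega> s t. \<omega> \<in> space (P x) \<Longrightarrow> 0 \<le> s \<Longrightarrow> s \<le> t \<Longrightarrow>
      Z s \<omega> = None \<Longrightarrow> Z t \<omega> = None"
    and right_continuous: "\<And>x \<omega> t. \<omega> \<in> space (P x) \<Longrightarrow> 0 \<le> t \<Longrightarrow>
      eventually (\<lambda>s. Z s \<omega> = Z t \<omega>) (at_right t)"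
    and finite_lifetime: "\<And>x. AE \<omega> in P x. lifetime Z \<omega> < \<infinity>"
    and markov: "\<And>x y s t. 0 \<le> s \<Longrightarrow> 0 \<le> t \<Longrightarrow>
      AE \<omega> in P x.
        real_cond_exp (P x) (past (P x) Z s)
          (indicat_real {\<omega> \<in> space (P x). Z (s + t) \<omega> = Some y}) \<omega> =
        (case Z s \<omega> of None \<Rightarrow> 0 | Some u \<Rightarrow> transition_matrix P Z t $ u $ y)"
    and generator: "(transition_matrix P Z has_vector_derivative L) (at 0 within {0..})"

definition local_time ::
  "(real \<Rightarrow> 'w \<Rightarrow> 'x option) \<Rightarrow> real^'x::finite \<Rightarrow> real \<Rightarrow> 'x \<Rightarrow> 'w \<Rightarrow> real" where
  "local_time Z m t x \<omega> =
     (LINT s:{s. 0 \<le> s \<and> ereal s \<le> min (ereal t) (lifetime Z \<omega>)}|lborel.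
        if Z s \<omega> = Some x then 1 / m $ x else 0)"

text \<open>
  \<open>interval_measure\<close> of the local time at \<open>y\<close> is the Stieltjes measure \<open>d l\<^sub>t\<^sup>y\<close>.
  In the expectations under \<open>E\<^sub>x\<^sub>,\<^sub>y\<close> below, \<open>G \<omega> t\<close> is the value of the functional on the
  path \<open>\<omega>\<close> stopped at time \<open>t\<close>, i.e. on a path of duration \<open>t\<close>.
\<close>

definition local_time_measure ::
  "(real \<Rightarrow> 'w \<Rightarrow> 'x option) \<Rightarrow> real^'x::finite \<Rightarrow> 'x \<Rightarrow> 'w \<Rightarrow> real measure" where
  "local_time_measure Z m y \<omega> = interval_measure (\<lambda>t. local_time Z m t y \<omega>)"

definition bridge_expectation ::
  "('x \<Rightarrow> 'w measure) \<Rightarrow> (real \<Rightarrow> 'w \<Rightarrow> 'x option) \<Rightarrow> real^'x::finite \<Rightarrow> 'x \<Rightarrow> 'x \<Rightarrow>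
     ('w \<Rightarrow> real \<Rightarrow> complex) \<Rightarrow> complex" where
  "bridge_expectation P Z m x y G =
     (\<integral>\<omega>. (LINT t:{t. 0 \<le> t \<and> ereal t < lifetime Z \<omega>}|local_time_measure Z m y \<omega>. G \<omega> t) \<partial>P x)"

definition bridge_nn_expectation ::
  "('x \<Rightarrow> 'w measure) \<Rightarrow> (real \<Rightarrow> 'w \<Rightarrow> 'x option) \<Rightarrow> real^'x::finite \<Rightarrow> 'x \<Rightarrow> 'x \<Rightarrow>
     ('w \<Rightarrow> real \<Rightarrow> ennreal) \<Rightarrow> ennreal" where
  "bridge_nn_expectation P Z m x y G =
     (\<integral>\<^sup>+\<omega>. (\<integral>\<^sup>+t\<in>{t. 0 \<le> t \<and> ereal t < lifetime Z \<omega>}. G \<omega> t \<partial>local_time_measure Z m y \<omega>) \<partial>P x)"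

definition local_time_field ::
  "(real \<Rightarrow> 'w \<Rightarrow> 'x option) \<Rightarrow> real^'x::finite \<Rightarrow> 'w \<Rightarrow> real \<Rightarrow> real^'x" where
  "local_time_field Z m \<omega> t = (\<chi> u. local_time Z m t u \<omega>)"

definition half_square :: "complex^'x::finite \<Rightarrow> real^'x" where
  "half_square z = (\<chi> u. Re (z $ u * cnj (z $ u)) / 2)"

end

theory Submission
  imports Defs
begin

text \<open>
  For \<open>F v = exp (- c \<bullet> v)\<close> with \<open>c \<ge> 0\<close>, let \<open>B = diag m (- L) + diag c\<close>. Integration by parts
  shows that the matrix \<open>G\<close> of normalised second moments of the Gaussian weight
  \<open>exp (- z\<^sup>* B z / 2)\<close> satisfies \<open>B G = I\<close>, so no determinant has to be computed; the weight is
  integrable because \<open>m (- L) = \<mu> \<ge> 0\<close> makes the real part of the energy coercive. On the process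
  side, let \<open>A\<close> be the additive functional with rate \<open>a = c / m\<close>. The identity
  \<open>1 - exp (- A t) = \<integral>\<^sub>0\<^sup>t a s * exp (- A s) ds\<close> and the Markov property at time \<open>s\<close>, where
  \<open>exp (- A s)\<close> depends on the past only, give \<open>V = U + U diag (c / m) V\<close> for the killed
  potential \<open>U\<close>, that is \<open>U (- L + diag (c / m)) = I\<close>. Hence both sides agree for exponentials.
  Polynomials in the variables \<open>exp (- v\<^sub>u)\<close> are linear combinations of exponentials, so
  Stone-Weierstrass on the unit cube, cutoffs and dominated convergence extend the identity to every
  continuous \<open>F\<close> for which both sides converge absolutely.
\<close>

section \<open>Laplace transforms on the orthant\<close>

text \<open>As \<open>L\<close> need not be symmetric with respect to \<open>m\<close>, the weight
  exp(energy / 2) is complex. Both sides are therefore written as integrals of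
  \<open>F (T a) * w a\<close> with an orthant-valued map \<open>T\<close> and an integrable complex
  weight \<open>w\<close>, and uniqueness of Laplace transforms is proved for such pairs. On the
  left \<open>T\<close> is \<open>half_square\<close> on complex vectors; on the right it is the sum
  of the occupation field and \<open>half_square\<close>, on the product of the complex vectors with
  a bridge measure on pairs (path, duration). The matrices to be compared solve opposite one-sided
  equations: the Gaussian second moments form a right inverse of \<open>B\<close> up to the total
  Gaussian mass, the bridge transforms a left inverse. Hence they agree up to that mass, which stays
  a common factor and is never divided by. The normalisation of local times by \<open>1 / m\<close>
  is what makes the same \<open>B\<close> appear twice: diag(1 / m) \<open>B\<close> =
  \<open>- L\<close> + diag(c / m).\<close>

inductive exponential_sum :: "(real^'x::finite \<Rightarrow> real) \<Rightarrow> bool" where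
  exp: "(\<And>u. 0 \<le> c $ u) \<Longrightarrow> exponential_sum (\<lambda>v. exp (- (c \<bullet> v)))"
| scale: "exponential_sum f \<Longrightarrow> exponential_sum (\<lambda>v. c * f v)"
| add: "exponential_sum f \<Longrightarrow> exponential_sum g \<Longrightarrow> exponential_sum (\<lambda>v. f v + g v)"

text \<open>Exponents add under multiplication, so the span of the exponentials is an algebra. This
  is what admits polynomials in the variables exp(-v_u).\<close>

lemma exponential_sum_mult:
  assumes f: "exponential_sum f" and g: "exponential_sum g"
  shows "exponential_sum (\<lambda>v. f v * g v)"
  using f
proof induction
  case (exp c)
  from g show ?case
  proof induction
    case (exp d)
    have "exponential_sum (\<lambda>v. exp (- ((c + d) \<bullet> v)))"
      by (intro exponential_sum.exp) (simp add: \<open>\<And>u. 0 \<le> c $ u\<close> exp)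
    then show ?case by (simp add: inner_add_left exp_add exp_diff exp_minus field_simps)
  next
    case (scale g k)
    from exponential_sum.scale[OF scale.IH, of k] show ?case by (simp add: mult_ac)
  next
    case (add g h)
    from exponential_sum.add[OF add.IH] show ?case by (simp add: algebra_simps)
  qed
next
  case (scale f k)
  from exponential_sum.scale[OF scale.IH, of k] show ?case by (simp add: mult_ac)
next
  case (add f h)
  from exponential_sum.add[OF add.IH] show ?case by (simp add: algebra_simps)
qed

lemma exponential_sum_const: "exponential_sum (\<lambda>v. c)"
  using exponential_sum.scale[OF exponential_sum.exp[of 0], of c] by simp

lemma exponential_sum_sum:
  assumes "finite I" "\<And>i. i \<in> I \<Longrightarrow> exponential_sum (f i)"
  shows "exponential_sum (\<lambda>v. \<Sum>i\<in>I. f i v)"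
  using assms by (induction I) (auto intro: exponential_sum_const exponential_sum.add)

lemma exponential_sum_polynomial:
  fixes p :: "real^'x::finite \<Rightarrow> real"
  assumes "real_polynomial_function p"
  shows "exponential_sum (\<lambda>v. p (\<chi> u. exp (- v $ u)))"
  using assms
proof induction
  case (linear h)
  interpret bounded_linear h by fact
  \<comment> \<open>The exponent \<open>axis u 1\<close> gives the single variable exp(-v_u), and a
    linear form is a combination of these.\<close>
  have "exponential_sum (\<lambda>v. \<Sum>u\<in>UNIV. h (axis u 1) * exp (- (axis u 1 \<bullet> v)))"
    by (intro exponential_sum_sum exponential_sum.scale exponential_sum.exp) (auto simp: axis_def)
  moreover have "h (\<chi> u. exp (- v $ u)) = (\<Sum>u\<in>UNIV. h (axis u 1) * exp (- (axis u 1 \<bullet> v)))" for v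
  proof -
    have "h (\<chi> u. exp (- v $ u)) = h (\<Sum>u\<in>UNIV. exp (- v $ u) *\<^sub>R axis u 1)"
      by (intro arg_cong[where f = h]) (simp add: vec_eq_iff axis_def if_distrib cong: if_cong)
    then show ?thesis by (simp add: sum scale inner_axis' mult.commute)
  qed
  ultimately show ?case by simp
qed (auto intro: exponential_sum_const exponential_sum.add exponential_sum_mult)

lemma exponential_sum_integrable:
  fixes w :: "'a \<Rightarrow> complex" and T :: "'a \<Rightarrow> real^'x::finite"
  assumes f: "exponential_sum f"
    and [measurable]: "T \<in> borel_measurable M"
    and nonneg: "\<And>a u. a \<in> space M \<Longrightarrow> 0 \<le> T a $ u"
    and w: "integrable M w"
  shows "integrable M (\<lambda>a. of_real (f (T a)) * w a)"
  using f
proof induction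
  case (exp c)
  have [measurable]: "w \<in> borel_measurable M" using w by simp
  show ?case
  proof (rule Bochner_Integration.integrable_bound[OF w])
    show "AE a in M. norm (of_real (exp (- (c \<bullet> T a))) * w a) \<le> norm (w a)"
    proof (rule AE_I2)
      fix a assume "a \<in> space M"
      then have "0 \<le> c \<bullet> T a"
        using exp nonneg by (auto simp: inner_vec_def intro!: sum_nonneg)
      then show "norm (of_real (exp (- (c \<bullet> T a))) * w a) \<le> norm (w a)"
        by (simp add: norm_mult mult_left_le_one_le)
    qed
  qed measurable
next
  case (scale f c)
  from integrable_mult_right[OF scale.IH, of "of_real c"] show ?case by (simp add: mult_ac)
next
  case (add f g)
  from Bochner_Integration.integrable_add[OF add.IH] show ?case by (simp add: algebra_simps)
qed

text \<open>The substitution p_u = exp(-v_u) maps the orthant into the unit cube, a compact set. The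
  faces p_u = 0 correspond to infinity; \<open>G\<close> extends continuously by 0 across them
  because it vanishes once a coordinate reaches \<open>K\<close>.\<close>

lemma exponential_sum_approx:
  fixes G :: "real^'x::finite \<Rightarrow> real"
  assumes G: "continuous_on {v. \<forall>u. 0 \<le> v $ u} G"
    and supp: "\<And>v u. K \<le> v $ u \<Longrightarrow> G v = 0" and "0 \<le> K" and "0 < e"
  obtains f where "exponential_sum f" "\<And>v. (\<forall>u. 0 \<le> v $ u) \<Longrightarrow> \<bar>G v - f v\<bar> < e"
proof -
  define S :: "(real^'x) set" where "S = cbox 0 (\<chi> u. 1)"
  \<comment> \<open>\<open>c\<close> inverts p_u = exp(-v_u) after raising p_u to at least exp(-K).
    Thus \<open>ln\<close> stays away from 0, and the point with coordinates exp(-v_u) is sent to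
    \<open>v\<close> clipped at \<open>K\<close>.\<close>
  define c :: "real^'x \<Rightarrow> real^'x" where "c p = (\<chi> u. - ln (max (p $ u) (exp (- K))))" for p
  have pos: "0 < max a (exp (- K))" for a by (simp add: less_max_iff_disj)
  have c: "continuous_on S c"
    unfolding c_def
    by (intro continuous_intros ballI) (use pos in \<open>metis less_irrefl\<close>)
  have cS: "c ` S \<subseteq> {v. \<forall>u. 0 \<le> v $ u}"
  proof clarsimp
    fix p u assume "p \<in> S"
    then have "p $ u \<le> 1" by (auto simp: S_def mem_box_cart)
    then have "max (p $ u) (exp (- K)) \<le> 1" using \<open>0 \<le> K\<close> by simp
    then show "0 \<le> c p $ u" by (simp add: c_def pos)
  qed
  have "continuous_on S (\<lambda>p. G (c p))"
    by (rule continuous_on_compose2[OF G c cS])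
  then obtain p where p: "real_polynomial_function p" "\<And>v. v \<in> S \<Longrightarrow> \<bar>G (c v) - p v\<bar> < e"
    using Stone_Weierstrass_real_polynomial_function[of S "\<lambda>p. G (c p)" e] \<open>0 < e\<close>
    by (auto simp: S_def)
  show thesis
  proof
    show "exponential_sum (\<lambda>v. p (\<chi> u. exp (- v $ u)))" by (rule exponential_sum_polynomial) fact
    fix v :: "real^'x" assume v: "\<forall>u. 0 \<le> v $ u"
    have cv: "c (\<chi> u. exp (- v $ u)) = (\<chi> u. min (v $ u) K)"
      by (auto simp: c_def vec_eq_iff max_def min_def)
    \<comment> \<open>Clipping at \<open>K\<close> alters \<open>v\<close> only if some coordinate
      exceeds \<open>K\<close>, and then \<open>G\<close> vanishes at both points.\<close>
    have "G (\<chi> u. min (v $ u) K) = G v"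
    proof (cases "\<exists>u. K \<le> v $ u")
      case True
      then obtain u where "K \<le> v $ u" by blast
      then show ?thesis using supp[of v u] supp[of "\<chi> u. min (v $ u) K" u] by simp
    next
      case False
      then have "(\<chi> u. min (v $ u) K) = v" by (auto simp: vec_eq_iff min_def not_le less_imp_le)
      then show ?thesis by simp
    qed
    moreover have "(\<chi> u. exp (- v $ u)) \<in> S" using v by (simp add: S_def mem_box_cart)
    ultimately show "\<bar>G v - p (\<chi> u. exp (- v $ u))\<bar> < e"
      using p(2)[of "\<chi> u. exp (- v $ u)"] cv by simp
  qed
qed

section \<open>Uniqueness of Laplace transforms for complex weights\<close>

lemma integrable_bounded_mult:
  fixes w :: "'a \<Rightarrow> complex"
  assumes w: "integrable M w" and [measurable]: "f \<in> borel_measurable M"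
    and "\<And>a. a \<in> space M \<Longrightarrow> norm (f a) \<le> B"
  shows "integrable M (\<lambda>a. f a * w a)"
proof (rule Bochner_Integration.integrable_bound)
  show "integrable M (\<lambda>a. of_real B * w a)" using w by simp
  show "AE a in M. norm (f a * w a) \<le> norm (of_real B * w a)"
    using assms(3) by (intro AE_I2) (fastforce simp: norm_mult intro!: mult_right_mono)
qed (use w in measurable)

text \<open>Outside the closed orthant \<open>F\<close> is arbitrary. It is replaced there by 0,
  which leaves \<open>F (T a)\<close> unchanged since \<open>T\<close> takes its values in the
  orthant.\<close>

lemma borel_measurable_orthant:
  fixes F :: "real^'x::finite \<Rightarrow> 'b::{second_countable_topology,real_normed_vector}"
  assumes F: "continuous_on {v. \<forall>u. 0 \<le> v $ u} F"
    and T: "T \<in> borel_measurable M" "\<And>a u. a \<in> space M \<Longrightarrow> 0 \<le> T a $ u"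
  shows "(\<lambda>a. F (T a)) \<in> borel_measurable M"
proof -
  have "closed {v :: real^'x. \<forall>u. 0 \<le> v $ u}"
    by (intro closed_Collect_all closed_Collect_le continuous_intros)
  then have "(\<lambda>v. indicator {v. \<forall>u. 0 \<le> v $ u} v *\<^sub>R F v) \<in> borel_measurable borel"
    by (intro borel_measurable_continuous_on_indicator F) auto
  from measurable_compose[OF T(1) this] show ?thesis
    by (rule measurable_cong[THEN iffD1, rotated]) (use T(2) in \<open>auto simp: indicator_def\<close>)
qed

text \<open>Approximating \<open>G\<close> uniformly within e by an exponential sum costs at most e
  times the L1 norm of the weight, so equality on exponentials passes to \<open>G\<close>. An L1
  bound of this kind covers complex weights.\<close>

lemma laplace_unique_aux:
  fixes G :: "real^'x::finite \<Rightarrow> real"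
    and w1 :: "'a \<Rightarrow> complex" and w2 :: "'b \<Rightarrow> complex"
  assumes T1: "T1 \<in> borel_measurable M1" "\<And>a u. a \<in> space M1 \<Longrightarrow> 0 \<le> T1 a $ u"
    and T2: "T2 \<in> borel_measurable M2" "\<And>a u. a \<in> space M2 \<Longrightarrow> 0 \<le> T2 a $ u"
    and w1: "integrable M1 w1" and w2: "integrable M2 w2"
    and laplace: "\<And>c. (\<And>u. 0 \<le> c $ u) \<Longrightarrow>
      (\<integral>a. of_real (exp (- (c \<bullet> T1 a))) * w1 a \<partial>M1) = (\<integral>a. of_real (exp (- (c \<bullet> T2 a))) * w2 a \<partial>M2)"
    and G: "continuous_on {v. \<forall>u. 0 \<le> v $ u} G"
    and supp: "\<And>v u. K \<le> v $ u \<Longrightarrow> G v = 0" and "0 \<le> K"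
  shows "integrable M1 (\<lambda>a. of_real (G (T1 a)) * w1 a)"
    and "integrable M2 (\<lambda>a. of_real (G (T2 a)) * w2 a)"
    and "(\<integral>a. of_real (G (T1 a)) * w1 a \<partial>M1) = (\<integral>a. of_real (G (T2 a)) * w2 a \<partial>M2)"
proof -
  have eq: "(\<integral>a. of_real (f (T1 a)) * w1 a \<partial>M1) = (\<integral>a. of_real (f (T2 a)) * w2 a \<partial>M2)"
    if "exponential_sum f" for f
    using that
  proof induction
    case (exp c)
    then show ?case by (rule laplace)
  next
    case (scale f c)
    then show ?case by (simp add: mult.assoc)
  next
    case (add f g)
    note * = exponential_sum_integrable[OF _ T1 w1] exponential_sum_integrable[OF _ T2 w2]
    show ?case using add by (simp add: ring_distribs *)
  qed
  \<comment> \<open>Stated for an arbitrary measure, map and weight, because it is applied to both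
    sides.\<close>
  have close: "integrable M (\<lambda>a. of_real (G (T a)) * w a) \<and>
      norm ((\<integral>a. of_real (G (T a)) * w a \<partial>M) - (\<integral>a. of_real (f (T a)) * w a \<partial>M))
        \<le> e * (\<integral>a. norm (w a) \<partial>M)"
    if T: "T \<in> borel_measurable M" "\<And>a u. a \<in> space M \<Longrightarrow> 0 \<le> T a $ u"
      and w: "integrable M w" and f: "exponential_sum f"
      and d: "\<And>v. (\<forall>u. 0 \<le> v $ u) \<Longrightarrow> \<bar>G v - f v\<bar> < e"
    for M :: "'c measure" and T and w :: "'c \<Rightarrow> complex" and f e
  proof -
    note f_int = exponential_sum_integrable[OF f T w]
    have f_meas: "(\<lambda>a. f (T a)) \<in> borel_measurable M"
      using f
    proof induction
      case (exp c)
      show ?case using T(1) by measurable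
    qed (auto intro!: borel_measurable_add borel_measurable_times)
    have [measurable]: "(\<lambda>a. G (T a) - f (T a)) \<in> borel_measurable M"
      using borel_measurable_orthant[OF G T] f_meas by measurable
    have "integrable M (\<lambda>a. of_real (G (T a) - f (T a)) * w a)"
    proof (rule integrable_bounded_mult[OF w])
      show "norm (complex_of_real (G (T a) - f (T a))) \<le> e" if "a \<in> space M" for a
        unfolding norm_of_real using d[of "T a"] T(2)[OF that] by auto
    qed measurable
    then have diff: "integrable M (\<lambda>a. of_real (G (T a)) * w a - of_real (f (T a)) * w a)"
      by (simp add: algebra_simps)
    from Bochner_Integration.integrable_add[OF this f_int]
    have G_int: "integrable M (\<lambda>a. of_real (G (T a)) * w a)" by simp
    have "norm (\<integral>a. of_real (G (T a)) * w a - of_real (f (T a)) * w a \<partial>M)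
        \<le> (\<integral>a. norm (of_real (G (T a)) * w a - of_real (f (T a)) * w a) \<partial>M)"
      by (rule integral_norm_bound)
    also have "\<dots> \<le> (\<integral>a. e * norm (w a) \<partial>M)"
    proof (intro integral_mono)
      fix a assume "a \<in> space M"
      then have "\<bar>G (T a) - f (T a)\<bar> \<le> e" using d[of "T a"] T(2) by auto
      then show "norm (of_real (G (T a)) * w a - of_real (f (T a)) * w a) \<le> e * norm (w a)"
        by (simp flip: left_diff_distrib of_real_diff add: norm_mult mult_right_mono)
    qed (use diff w in auto)
    finally show ?thesis using G_int f_int by simp
  qed
  have approx: "\<exists>f. exponential_sum f \<and> (\<forall>v. (\<forall>u. 0 \<le> v $ u) \<longrightarrow> \<bar>G v - f v\<bar> < e)" if "0 < e" for e
    using exponential_sum_approx[OF G, of K e] supp \<open>0 \<le> K\<close> that by metis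
  obtain f where f: "exponential_sum f" "\<And>v. (\<forall>u. 0 \<le> v $ u) \<Longrightarrow> \<bar>G v - f v\<bar> < 1"
    using approx[OF zero_less_one] by blast
  show "integrable M1 (\<lambda>a. of_real (G (T1 a)) * w1 a)"
    and "integrable M2 (\<lambda>a. of_real (G (T2 a)) * w2 a)"
    using close[OF T1 w1 f] close[OF T2 w2 f] by auto
  define W where "W = (\<integral>a. norm (w1 a) \<partial>M1) + (\<integral>a. norm (w2 a) \<partial>M2)"
  have W: "0 \<le> W" by (simp add: W_def)
  let ?D = "norm ((\<integral>a. of_real (G (T1 a)) * w1 a \<partial>M1) - (\<integral>a. of_real (G (T2 a)) * w2 a \<partial>M2))"
  have "?D \<le> d" if "0 < d" for d
  proof -
    \<comment> \<open>The summand 1 keeps the denominator positive when both weights vanish almost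
      everywhere, and \<open>e * W \<le> d\<close> still holds.\<close>
    define e where "e = d / (W + 1)"
    have e: "0 < e" "e * W \<le> d" using that W by (auto simp: e_def field_simps)
    obtain f where f: "exponential_sum f" "\<And>v. (\<forall>u. 0 \<le> v $ u) \<Longrightarrow> \<bar>G v - f v\<bar> < e"
      using approx[OF e(1)] by blast
    have "?D \<le> e * (\<integral>a. norm (w1 a) \<partial>M1) + e * (\<integral>a. norm (w2 a) \<partial>M2)"
      using close[OF T1 w1 f] close[OF T2 w2 f] eq[OF f(1)]
      by (smt (verit) norm_minus_commute norm_triangle_ineq4 diff_diff_eq2 diff_add_cancel norm_triangle_sub)
    also have "\<dots> \<le> d" using e(2) by (simp add: W_def ring_distribs)
    finally show ?thesis .
  qed
  \<comment> \<open>With \<open>d\<close> equal to half of \<open>?D\<close>, the bound says that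
    \<open>?D\<close> is at most its own half, which forces it to be 0.\<close>
  from this[of "?D / 2"] show "(\<integral>a. of_real (G (T1 a)) * w1 a \<partial>M1) = (\<integral>a. of_real (G (T2 a)) * w2 a \<partial>M2)"
    by (cases "?D = 0") auto
qed

text \<open>Cutoffs reduce \<open>F\<close> to functions vanishing outside a box. The given
  integrable products dominate the cut-off ones, so \<open>F\<close> may be unbounded.\<close>

lemma laplace_unique:
  fixes F :: "real^'x::finite \<Rightarrow> complex"
    and w1 :: "'a \<Rightarrow> complex" and w2 :: "'b \<Rightarrow> complex"
  assumes T1: "T1 \<in> borel_measurable M1" "\<And>a u. a \<in> space M1 \<Longrightarrow> 0 \<le> T1 a $ u"
    and T2: "T2 \<in> borel_measurable M2" "\<And>a u. a \<in> space M2 \<Longrightarrow> 0 \<le> T2 a $ u"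
    and w1: "integrable M1 w1" and w2: "integrable M2 w2"
    and laplace: "\<And>c. (\<And>u. 0 \<le> c $ u) \<Longrightarrow>
      (\<integral>a. of_real (exp (- (c \<bullet> T1 a))) * w1 a \<partial>M1) = (\<integral>a. of_real (exp (- (c \<bullet> T2 a))) * w2 a \<partial>M2)"
    and F: "continuous_on {v. \<forall>u. 0 \<le> v $ u} F"
    and int1: "integrable M1 (\<lambda>a. F (T1 a) * w1 a)"
    and int2: "integrable M2 (\<lambda>a. F (T2 a) * w2 a)"
  shows "(\<integral>a. F (T1 a) * w1 a \<partial>M1) = (\<integral>a. F (T2 a) * w2 a \<partial>M2)"
proof -
  \<comment> \<open>Each factor is 1 for v_u at most n - 1 and 0 for v_u at least n. One large
    coordinate therefore annihilates the product, and at a fixed point the product is eventually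
    1.\<close>
  define \<phi> :: "nat \<Rightarrow> real^'x \<Rightarrow> real" where "\<phi> n v = (\<Prod>u\<in>UNIV. max 0 (min 1 (n - v $ u)))" for n v
  have \<phi>: "continuous_on A (\<phi> n)" for A n
    unfolding \<phi>_def by (intro continuous_intros)
  have \<phi>_bound: "0 \<le> \<phi> n v \<and> \<phi> n v \<le> 1" for n v
    unfolding \<phi>_def by (auto intro!: prod_nonneg prod_le_1)
  have \<phi>_supp: "\<phi> n v = 0" if "real n \<le> v $ u" for n v u
    unfolding \<phi>_def using that by (auto intro!: exI[of _ u])
  have \<phi>_lim: "(\<lambda>n. \<phi> n v) \<longlonglongrightarrow> 1" for v
  proof (rule tendsto_eventually)
    have "\<forall>\<^sub>F n in sequentially. \<forall>u\<in>UNIV. v $ u + 1 \<le> real n"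
    proof (intro eventually_ball_finite ballI)
      show "\<forall>\<^sub>F n in sequentially. v $ u + 1 \<le> real n" for u
        using filterlim_real_sequentially by (auto simp: filterlim_at_top)
    qed simp
    then show "\<forall>\<^sub>F n in sequentially. \<phi> n v = 1"
    proof eventually_elim
      case (elim n)
      have "max 0 (min 1 (n - v $ u)) = 1" for u using bspec[OF elim, of u] by simp
      then show ?case by (simp add: \<phi>_def)
    qed
  qed
  have lim: "(\<lambda>n. \<integral>a. of_real (\<phi> n (T a)) * (F (T a) * w a) \<partial>M) \<longlonglongrightarrow> (\<integral>a. F (T a) * w a \<partial>M)"
    if "integrable M (\<lambda>a. F (T a) * w a)" and T: "T \<in> borel_measurable M"
    for M :: "'c measure" and T w
  proof (rule integral_dominated_convergence[where w = "\<lambda>a. norm (F (T a) * w a)"])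
    have [measurable]: "(\<lambda>a. \<phi> n (T a)) \<in> borel_measurable M" for n
      by (rule borel_measurable_continuous_on[OF \<phi> T])
    show "(\<lambda>a. F (T a) * w a) \<in> borel_measurable M" using that(1) by simp
    then show "(\<lambda>a. of_real (\<phi> n (T a)) * (F (T a) * w a)) \<in> borel_measurable M" for n
      by measurable
    show "AE a in M. norm (of_real (\<phi> n (T a)) * (F (T a) * w a)) \<le> norm (F (T a) * w a)" for n
      by (intro AE_I2) (use \<phi>_bound in \<open>auto simp: norm_mult intro!: mult_left_le_one_le\<close>)
    show "AE a in M. (\<lambda>n. of_real (\<phi> n (T a)) * (F (T a) * w a)) \<longlonglongrightarrow> F (T a) * w a"
      by (intro AE_I2) (use tendsto_mult[OF tendsto_of_real[OF \<phi>_lim] tendsto_const] in force)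
  qed (use that in auto)
  have eq: "(\<integral>a. of_real (\<phi> n (T1 a)) * (F (T1 a) * w1 a) \<partial>M1)
      = (\<integral>a. of_real (\<phi> n (T2 a)) * (F (T2 a) * w2 a) \<partial>M2)" for n
  proof -
    have supp: "\<phi> n v * Re (F v) = 0" "\<phi> n v * Im (F v) = 0" if "real n \<le> v $ u" for v u
      using \<phi>_supp[OF that] by auto
    note re = laplace_unique_aux[OF T1 T2 w1 w2 laplace continuous_on_mult[OF \<phi> continuous_on_Re[OF F]] supp(1) of_nat_0_le_iff]
    note im = laplace_unique_aux[OF T1 T2 w1 w2 laplace continuous_on_mult[OF \<phi> continuous_on_Im[OF F]] supp(2) of_nat_0_le_iff]
    \<comment> \<open>The approximation result is for real functions, hence the separation of the
      real and imaginary parts of \<open>F\<close>.\<close>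
    have split: "of_real (\<phi> n v) * (F v * w) =
        of_real (\<phi> n v * Re (F v)) * w + \<i> * (of_real (\<phi> n v * Im (F v)) * w)" for v w
      by (subst complex_eq[of "F v"]) (simp add: algebra_simps)
    show ?thesis unfolding split
      using re im by simp
  qed
  show ?thesis
    using lim[OF int1 T1(1)] lim[OF int2 T2(1)] unfolding eq by (rule LIMSEQ_unique)
qed

section \<open>Gaussian integrals\<close>

lemma integral_shift:
  fixes f :: "'a::euclidean_space \<Rightarrow> 'b::{banach,second_countable_topology}"
  assumes "integrable lborel f"
  shows "integrable lborel (\<lambda>z. f (z + h))" "(\<integral>z. f (z + h) \<partial>lborel) = (\<integral>z. f z \<partial>lborel)"
proof -
  have [measurable]: "f \<in> borel_measurable borel" using assms by simp
  have eq: "lborel = distr lborel borel (\<lambda>z. z + h)"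
    using lborel_distr_plus[of h] by (simp add: add.commute[of _ h])
  show "(\<integral>z. f (z + h) \<partial>lborel) = (\<integral>z. f z \<partial>lborel)"
    by (subst (2) eq) (simp add: integral_distr)
  have "integrable (distr lborel borel (\<lambda>z. z + h)) f"
    using assms eq by simp
  then show "integrable lborel (\<lambda>z. f (z + h))"
    by (simp add: integrable_distr_eq)
qed

text \<open>Integrate f(z + h) - f(z), which is the integral of f'(z + s h) over s in [0, 1], with
  respect to z and exchange the integrals. Translation invariance makes one side 0 and every s-slice
  of the other equal to the integral of f'. No boundary terms arise.\<close>

lemma integral_directional_derivative:
  fixes f f' :: "'a::euclidean_space \<Rightarrow> complex"
  assumes f: "integrable lborel f" and f': "integrable lborel f'" and cont: "continuous_on UNIV f'"
    and deriv: "\<And>z. ((\<lambda>s. f (z + s *\<^sub>R h)) has_vector_derivative f' z) (at 0)"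
  shows "(\<integral>z. f' z \<partial>lborel) = 0"
proof -
  have [measurable]: "f' \<in> borel_measurable borel" using f' by simp
  have line: "(LBINT s:{0..1}. f' (z + s *\<^sub>R h)) = f (z + h) - f z" for z
  proof -
    have "((\<lambda>s. f (z + s *\<^sub>R h)) has_vector_derivative f' (z + s *\<^sub>R h)) (at s)" for s
    proof -
      have "((\<lambda>t. f ((z + s *\<^sub>R h) + (t - s) *\<^sub>R h)) has_vector_derivative f' (z + s *\<^sub>R h)) (at s)"
      proof -
        have "((\<lambda>t. t - s) has_vector_derivative 1) (at s)"
          by (auto intro!: derivative_eq_intros)
        from vector_diff_chain_at[OF this, of "\<lambda>t. f ((z + s *\<^sub>R h) + t *\<^sub>R h)"] deriv[of "z + s *\<^sub>R h"]
        show ?thesis by (simp add: o_def)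
      qed
      then show ?thesis by (simp add: algebra_simps)
    qed
    then have "((\<lambda>s. f' (z + s *\<^sub>R h)) has_integral (f (z + 1 *\<^sub>R h) - f (z + 0 *\<^sub>R h))) {0..1}"
      by (intro fundamental_theorem_of_calculus) (auto intro: has_vector_derivative_at_within)
    moreover have "set_integrable lborel {0..1} (\<lambda>s. f' (z + s *\<^sub>R h))"
      by (intro borel_integrable_atLeastAtMost' continuous_intros continuous_on_compose2[OF cont]) auto
    ultimately show ?thesis
      by (simp add: set_borel_integral_eq_integral(2) integral_unique)
  qed
  let ?g = "\<lambda>s z. indicator {0..1} s *\<^sub>R f' (z + s *\<^sub>R h)"
  have inner: "(\<integral>z. norm (?g s z) \<partial>lborel) = indicator {0..1} s * (\<integral>z. norm (f' z) \<partial>lborel)" for s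
    using integral_shift(2)[OF integrable_norm[OF f'], of "s *\<^sub>R h"] by simp
  have "integrable (lborel \<Otimes>\<^sub>M lborel) (\<lambda>(s, z). ?g s z)"
  proof (rule lborel_pair.Fubini_integrable)
    show "integrable lborel (\<lambda>s. \<integral>z. norm (case (s, z) of (s, z) \<Rightarrow> ?g s z) \<partial>lborel)"
      unfolding prod.case inner by (intro integrable_mult_left integrable_real_indicator) auto
    show "AE s in lborel. integrable lborel (\<lambda>z. case (s, z) of (s, z) \<Rightarrow> ?g s z)"
      unfolding prod.case by (intro AE_I2 integrable_scaleR_right integral_shift(1) f')
  qed measurable
  then have "(\<integral>z. (\<integral>s. ?g s z \<partial>lborel) \<partial>lborel) = (\<integral>s. (\<integral>z. ?g s z \<partial>lborel) \<partial>lborel)"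
    by (rule lborel_pair.Fubini_integral)
  also have "\<dots> = (\<integral>s. indicator {0..1 :: real} s *\<^sub>R (\<integral>z. f' z \<partial>lborel) \<partial>lborel)"
    by (simp only: integral_scaleR_right integral_shift(2)[OF f'])
  also have "\<dots> = (\<integral>z. f' z \<partial>lborel)"
    by (subst integral_scaleR_left) auto
  finally have "(\<integral>z. f' z \<partial>lborel) = (\<integral>z. f (z + h) - f z \<partial>lborel)"
    using line by (simp add: set_lebesgue_integral_def)
  also have "\<dots> = 0" using integral_shift[OF f, of h] f by simp
  finally show ?thesis .
qed

lemma integrable_exp_norm_square:
  assumes "0 < c"
  shows "integrable lborel (\<lambda>z :: 'a::euclidean_space. exp (- c * (norm z)\<^sup>2))"
proof (rule integrableI_bounded)
  have 1: "integrable lborel (\<lambda>x. exp (- c * x\<^sup>2))"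
  proof -
    \<comment> \<open>Chosen so that 2 \<sigma>^2 = 1 / c, which makes the normal density a multiple
      of exp(-c x^2).\<close>
    define \<sigma> where "\<sigma> = 1 / sqrt (2 * c)"
    have "0 < \<sigma>" "2 * \<sigma>\<^sup>2 = 1 / c" using assms by (auto simp: \<sigma>_def power_divide)
    then have "normal_density 0 \<sigma> = (\<lambda>x. 1 / sqrt (2 * pi * \<sigma>\<^sup>2) * exp (- c * x\<^sup>2))"
      by (auto simp: normal_density_def fun_eq_iff field_simps)
    then have "integrable lborel (\<lambda>x. 1 / sqrt (2 * pi * \<sigma>\<^sup>2) * exp (- c * x\<^sup>2))"
      using integrable_normal_density[OF \<open>0 < \<sigma>\<close>, of 0] by simp
    from integrable_mult_right[OF this, of "sqrt (2 * pi * \<sigma>\<^sup>2)"] \<open>0 < \<sigma>\<close> show ?thesis by simp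
  qed
  have "(\<integral>\<^sup>+z. ennreal (norm (exp (- c * (norm z)\<^sup>2))) \<partial>(lborel :: 'a measure))
      = (\<integral>\<^sup>+z. (\<Prod>b\<in>Basis. ennreal (exp (- c * (z \<bullet> b)\<^sup>2))) \<partial>(lborel :: 'a measure))"
  proof (intro nn_integral_cong)
    fix z :: 'a
    have "(norm z)\<^sup>2 = (\<Sum>b\<in>Basis. (z \<bullet> b)\<^sup>2)"
      unfolding power2_norm_eq_inner by (subst euclidean_inner) (simp add: power2_eq_square)
    then have "exp (- c * (norm z)\<^sup>2) = (\<Prod>b\<in>Basis. exp (- c * (z \<bullet> b)\<^sup>2))"
      by (simp add: exp_sum[symmetric] sum_distrib_left sum_negf)
    then show "ennreal (norm (exp (- c * (norm z)\<^sup>2))) = (\<Prod>b\<in>Basis. ennreal (exp (- c * (z \<bullet> b)\<^sup>2)))"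
      by (simp add: prod_ennreal abs_prod)
  qed
  also have "\<dots> = (\<Prod>b\<in>(Basis :: 'a set). \<integral>\<^sup>+x. ennreal (exp (- c * x\<^sup>2)) \<partial>lborel)"
    by (rule nn_integral_lborel_prod) auto
  also have "\<dots> < \<infinity>"
    using 1 by (auto simp: integrable_iff_bounded power_less_top_ennreal)
  finally show "(\<integral>\<^sup>+z. ennreal (norm (exp (- c * (norm z)\<^sup>2))) \<partial>(lborel :: 'a measure)) < \<infinity>" .
qed simp

text \<open>Half of the decay absorbs the quadratic factor: r exp(-c r / 2) is at most 2 / c, by t
  \<le> exp t at t = c r / 2. The other half remains as an integrable majorant.\<close>

lemma integrable_gaussian_bound:
  fixes f :: "'a::euclidean_space \<Rightarrow> complex"
  assumes "0 < c" and f: "f \<in> borel_measurable borel"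
    and le: "\<And>z. norm (f z) \<le> (a + b * (norm z)\<^sup>2) * exp (- c * (norm z)\<^sup>2)"
  shows "integrable lborel f"
proof (rule Bochner_Integration.integrable_bound)
  let ?g = "\<lambda>z :: 'a. (\<bar>a\<bar> + \<bar>b\<bar> * (2 / c)) * exp (- (c / 2) * (norm z)\<^sup>2)"
  show "integrable lborel ?g"
    using \<open>0 < c\<close> by (intro integrable_mult_right integrable_exp_norm_square) simp
  show "f \<in> borel_measurable lborel" using f by simp
  show "AE z in lborel. norm (f z) \<le> norm (?g z)"
  proof (rule AE_I2)
    fix z :: 'a
    define r where "r = (norm z)\<^sup>2"
    have "0 \<le> r" by (simp add: r_def)
    have split: "exp (- c * r) = exp (- (c / 2) * r) * exp (- (c / 2) * r)"
      by (simp flip: exp_add)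
    have "(c / 2) * r \<le> exp ((c / 2) * r)" using exp_ge_add_one_self[of "(c / 2) * r"] by linarith
    then have "(c / 2) * r * exp (- (c / 2) * r) \<le> exp ((c / 2) * r) * exp (- (c / 2) * r)"
      by (intro mult_right_mono) auto
    also have "\<dots> = 1" by (simp flip: exp_add)
    finally have "r * exp (- (c / 2) * r) \<le> 2 / c" using \<open>0 < c\<close> by (simp add: field_simps)
    moreover have "exp (- (c / 2) * r) \<le> 1" using \<open>0 < c\<close> \<open>0 \<le> r\<close> by simp
    ultimately have "\<bar>a\<bar> * exp (- (c / 2) * r) + \<bar>b\<bar> * (r * exp (- (c / 2) * r)) \<le> \<bar>a\<bar> + \<bar>b\<bar> * (2 / c)"
      by (intro add_mono mult_left_mono mult_left_le) auto
    then have "(\<bar>a\<bar> + \<bar>b\<bar> * r) * exp (- (c / 2) * r) * exp (- (c / 2) * r)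
        \<le> (\<bar>a\<bar> + \<bar>b\<bar> * (2 / c)) * exp (- (c / 2) * r)"
      by (intro mult_right_mono) (auto simp: algebra_simps)
    moreover have "norm (f z) \<le> (\<bar>a\<bar> + \<bar>b\<bar> * r) * exp (- c * r)"
      using le[of z] \<open>0 \<le> r\<close> unfolding r_def
      by (elim order_trans, intro mult_right_mono add_mono) auto
    ultimately have "norm (f z) \<le> (\<bar>a\<bar> + \<bar>b\<bar> * (2 / c)) * exp (- (c / 2) * r)"
      unfolding split mult.assoc by linarith
    also have "\<dots> = norm (?g z)" using \<open>0 < c\<close> by (simp add: r_def abs_mult)
    finally show "norm (f z) \<le> norm (?g z)" .
  qed
qed

text \<open>The function cnj(z_y) exp(-Q / 2) is differentiated by the Wirtinger derivative in the
  conjugate of z_x. Since \<open>Q\<close> is linear in the conjugate variables, this brings down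
  row \<open>x\<close> of \<open>B\<close> alone, whether or not \<open>B\<close> is
  symmetric.\<close>

lemma gaussian_covariance:
  fixes B :: "real^'x^'x::finite" and Q :: "complex^'x \<Rightarrow> complex"
  assumes Q: "\<And>z. Q z = (\<Sum>v\<in>UNIV. \<Sum>w\<in>UNIV. of_real (B $ v $ w) * (z $ w * cnj (z $ v)))"
    and "0 < c" and pos: "\<And>z. c * (norm z)\<^sup>2 \<le> Re (Q z)"
  shows "integrable lborel (\<lambda>z. exp (- Q z / 2))"
    and "integrable lborel (\<lambda>z. z $ w * cnj (z $ y) / 2 * exp (- Q z / 2))"
    and "(\<Sum>w\<in>UNIV. of_real (B $ x $ w) * (\<integral>z. z $ w * cnj (z $ y) / 2 * exp (- Q z / 2) \<partial>lborel))
      = (if x = y then (\<integral>z. exp (- Q z / 2) \<partial>lborel) else 0)"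
proof -
  let ?E = "\<lambda>z. exp (- Q z / 2)"
  have c2: "0 < c / 2" using \<open>0 < c\<close> by simp
  have contQ: "continuous_on A Q" for A
    unfolding Q by (intro continuous_intros)
  have contE: "continuous_on A ?E" for A
    by (intro continuous_intros contQ) auto
  have E_meas [measurable]: "?E \<in> borel_measurable borel"
    by (rule borel_measurable_continuous_onI[OF contE])
  have [measurable]: "(\<lambda>z :: complex^'x. z $ v) \<in> borel_measurable borel"
      "(\<lambda>z :: complex^'x. cnj (z $ v)) \<in> borel_measurable borel" for v
    by (intro borel_measurable_continuous_onI continuous_intros)+
  have normE: "norm (?E z) \<le> exp (- (c / 2) * (norm z)\<^sup>2)" for z
    using pos[of z] by (simp add: field_simps)
  have nth: "norm (z $ v) \<le> norm z" for z :: "complex^'x" and v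
    by (rule Finite_Cartesian_Product.norm_nth_le)
  show intE: "integrable lborel ?E"
    by (rule integrable_gaussian_bound[where c = "c / 2" and a = 1 and b = 0, OF _ E_meas])
      (use normE \<open>0 < c\<close> in auto)
  have int2: "integrable lborel (\<lambda>z. z $ w * cnj (z $ y) * ?E z)" for w y
  proof (rule integrable_gaussian_bound[where c = "c / 2" and a = 0 and b = 1, OF c2])
    fix z :: "complex^'x"
    have "norm (z $ w) * norm (z $ y) \<le> (norm z)\<^sup>2"
      unfolding power2_eq_square by (intro mult_mono nth) auto
    then show "norm (z $ w * cnj (z $ y) * ?E z) \<le> (0 + 1 * (norm z)\<^sup>2) * exp (- (c / 2) * (norm z)\<^sup>2)"
      unfolding norm_mult using normE[of z] by (intro mult_mono) auto
  qed measurable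
  \<comment> \<open>A real directional derivative also produces products of two conjugates. They
    cancel in the combination taken below, but the derivative must be integrable before
    that.\<close>
  have int2': "integrable lborel (\<lambda>z. cnj (z $ w) * cnj (z $ y) * ?E z)" for w y
  proof (rule integrable_gaussian_bound[where c = "c / 2" and a = 0 and b = 1, OF c2])
    fix z :: "complex^'x"
    have "norm (z $ w) * norm (z $ y) \<le> (norm z)\<^sup>2"
      unfolding power2_eq_square by (intro mult_mono nth) auto
    then show "norm (cnj (z $ w) * cnj (z $ y) * ?E z) \<le> (0 + 1 * (norm z)\<^sup>2) * exp (- (c / 2) * (norm z)\<^sup>2)"
      unfolding norm_mult using normE[of z] by (intro mult_mono) auto
  qed measurable
  show "integrable lborel (\<lambda>z. z $ w * cnj (z $ y) / 2 * ?E z)"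
    using integrable_divide[OF int2[of w y], of 2] by simp
  have int1: "integrable lborel (\<lambda>z. cnj (z $ y) * ?E z)"
  proof (rule integrable_gaussian_bound[where c = "c / 2" and a = 1 and b = 1, OF c2])
    fix z :: "complex^'x"
    have "norm z \<le> 1 + 1 * (norm z)\<^sup>2"
      using zero_le_power2[of "norm z - 1"] by (simp add: power2_diff) (smt (verit) norm_ge_zero)
    then have "norm (z $ y) \<le> 1 + 1 * (norm z)\<^sup>2" using nth[of z y] by linarith
    then show "norm (cnj (z $ y) * ?E z) \<le> (1 + 1 * (norm z)\<^sup>2) * exp (- (c / 2) * (norm z)\<^sup>2)"
      unfolding norm_mult using normE[of z] by (intro mult_mono) auto
  qed measurable
  define D where "D h z = (\<Sum>v\<in>UNIV. \<Sum>w\<in>UNIV. of_real (B $ v $ w) *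
    (h $ w * cnj (z $ v) + z $ w * cnj (h $ v)))" for h z :: "complex^'x"
  define f' where "f' h z = cnj (h $ y) * ?E z - cnj (z $ y) * ?E z * D h z / 2" for h z :: "complex^'x"
  have f'_eq: "f' h z = cnj (h $ y) * ?E z - (\<Sum>v\<in>UNIV. \<Sum>w\<in>UNIV. of_real (B $ v $ w) *
      (h $ w * (cnj (z $ v) * cnj (z $ y) * ?E z) + cnj (h $ v) * (z $ w * cnj (z $ y) * ?E z))) / 2" for h z
    unfolding f'_def D_def by (simp add: sum_distrib_left algebra_simps)
  have int_f': "integrable lborel (f' h)" for h
    unfolding f'_eq
    by (intro Bochner_Integration.integrable_diff integrable_divide Bochner_Integration.integrable_sum
        integrable_mult_right Bochner_Integration.integrable_add intE int2 int2')
  have zero: "(\<integral>z. f' h z \<partial>lborel) = 0" for h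
  proof (rule integral_directional_derivative[where f = "\<lambda>z. cnj (z $ y) * ?E z" and h = h])
    show "continuous_on UNIV (f' h)"
      unfolding f'_def D_def by (intro continuous_intros contE) auto
    fix z
    have "((\<lambda>s. Q (z + s *\<^sub>R h)) has_vector_derivative D h z) (at 0)"
      unfolding Q D_def
      by (auto intro!: derivative_eq_intros simp: algebra_simps)
    then have "((\<lambda>s. - Q (z + s *\<^sub>R h) / 2) has_vector_derivative - D h z / 2) (at 0)"
      by (intro has_vector_derivative_divide has_vector_derivative_minus)
    from field_vector_diff_chain_at[OF this DERIV_exp]
    have "((\<lambda>s. ?E (z + s *\<^sub>R h)) has_vector_derivative (- D h z / 2 * ?E z)) (at 0)"
      by (simp add: o_def)
    moreover have "((\<lambda>s. cnj ((z + s *\<^sub>R h) $ y)) has_vector_derivative cnj (h $ y)) (at 0)"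
      by (auto intro!: derivative_eq_intros)
    ultimately show "((\<lambda>s. cnj ((z + s *\<^sub>R h) $ y) * ?E (z + s *\<^sub>R h)) has_vector_derivative f' h z) (at 0)"
      unfolding f'_def by (auto intro!: derivative_eq_intros simp: algebra_simps)
  qed (use int1 int_f' in auto)
  \<comment> \<open>The derivative along \<open>axis x 1\<close> plus \<i> times the derivative
    along \<open>axis x \<i>\<close> is twice the Wirtinger derivative in the conjugate of z_x: the
    terms from column \<open>x\<close> of \<open>B\<close> cancel and those from row
    \<open>x\<close> double.\<close>
  let ?h = "\<lambda>\<alpha>. axis x \<alpha> :: complex^'x"
  have "f' (?h 1) z + \<i> * f' (?h \<i>) z =
      2 * ((if x = y then ?E z else 0) - (\<Sum>w\<in>UNIV. of_real (B $ x $ w) * (z $ w * cnj (z $ y) / 2 * ?E z)))" for z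
  proof -
    have "D (?h 1) z + \<i> * D (?h \<i>) z = (\<Sum>v\<in>UNIV. \<Sum>w\<in>UNIV. of_real (B $ v $ w) *
        (2 * z $ w * (if v = x then 1 else 0)))"
      unfolding D_def sum_distrib_left sum.distrib[symmetric]
      by (intro sum.cong refl) (auto simp: axis_def algebra_simps)
    also have "\<dots> = 2 * (\<Sum>w\<in>UNIV. of_real (B $ x $ w) * z $ w)"
      by (subst sum.swap) (simp add: if_distrib sum_distrib_left mult_ac cong: if_cong)
    finally have "cnj (z $ y) * ?E z * (D (?h 1) z + \<i> * D (?h \<i>) z) / 2 =
        2 * (\<Sum>w\<in>UNIV. of_real (B $ x $ w) * (z $ w * cnj (z $ y) / 2 * ?E z))"
      by (simp add: sum_distrib_left sum_distrib_right mult_ac)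
    moreover have "f' (?h 1) z + \<i> * f' (?h \<i>) z = (cnj (?h 1 $ y) + \<i> * cnj (?h \<i> $ y)) * ?E z -
        cnj (z $ y) * ?E z * (D (?h 1) z + \<i> * D (?h \<i>) z) / 2"
      by (simp add: f'_def algebra_simps add_divide_distrib)
    moreover have "cnj (?h 1 $ y) + \<i> * cnj (?h \<i> $ y) = (if x = y then 2 else 0)"
      by (simp add: axis_def)
    ultimately show ?thesis by (simp add: algebra_simps)
  qed
  moreover have "(\<integral>z. f' (?h 1) z + \<i> * f' (?h \<i>) z \<partial>lborel) = 0"
    using int_f' by (simp add: zero)
  ultimately have zero': "(\<integral>z. 2 * ((if x = y then ?E z else 0) -
      (\<Sum>w\<in>UNIV. of_real (B $ x $ w) * (z $ w * cnj (z $ y) / 2 * ?E z))) \<partial>lborel) = 0"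
    by simp
  have linear: "(\<integral>z. 2 * (a z - (\<Sum>w\<in>UNIV. of_real (B $ x $ w) * G w z)) \<partial>lborel) =
      2 * ((\<integral>z. a z \<partial>lborel) - (\<Sum>w\<in>UNIV. of_real (B $ x $ w) * (\<integral>z. G w z \<partial>lborel)))"
    if "integrable lborel a" "\<And>w. integrable lborel (G w)" for a :: "complex^'x \<Rightarrow> complex" and G
    using that by simp
  have "integrable lborel (\<lambda>z. if x = y then ?E z else 0)"
    using intE by (cases "x = y") auto
  moreover have "integrable lborel (\<lambda>z. z $ w * cnj (z $ y) / 2 * ?E z)" for w
    using integrable_divide[OF int2[of w y], of 2] by simp
  ultimately have "(\<integral>z. (if x = y then ?E z else 0) \<partial>lborel) =
      (\<Sum>w\<in>UNIV. of_real (B $ x $ w) * (\<integral>z. z $ w * cnj (z $ y) / 2 * ?E z \<partial>lborel))"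
    using zero' by (subst (asm) linear) auto
  then show "(\<Sum>w\<in>UNIV. of_real (B $ x $ w) * (\<integral>z. z $ w * cnj (z $ y) / 2 * ?E z \<partial>lborel))
      = (if x = y then (\<integral>z. ?E z \<partial>lborel) else 0)"
    by (cases "x = y") auto
qed

section \<open>Coercivity of the energy form\<close>

text \<open>A positive entry of the n-th power comes from a chain of n positive entries of
  \<open>Q\<close>, and \<open>A\<close> is carried along this chain.\<close>

lemma irreducible_matrix_induct:
  fixes Q :: "real^'x^'x::finite"
  assumes "irreducible_matrix Q" and nonneg: "\<And>x y. 0 \<le> Q $ x $ y"
    and "A u" and step: "\<And>x y. A x \<Longrightarrow> 0 < Q $ x $ y \<Longrightarrow> A y"
  shows "A v"
proof -
  \<comment> \<open>Nonnegativity of the powers is proved in the same induction, because it turns a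
    positive summand into two positive factors.\<close>
  have "0 \<le> (((**) Q) ^^ n) (mat 1) $ x $ y \<and> (0 < (((**) Q) ^^ n) (mat 1) $ x $ y \<longrightarrow> A x \<longrightarrow> A y)" for n x y
  proof (induction n arbitrary: x)
    case 0
    then show ?case by (simp add: mat_def)
  next
    case (Suc n)
    let ?R = "(((**) Q) ^^ n) (mat 1)"
    have eq: "(((**) Q) ^^ Suc n) (mat 1) $ x $ y = (\<Sum>w\<in>UNIV. Q $ x $ w * ?R $ w $ y)"
      by (simp add: matrix_matrix_mult_def)
    have "0 \<le> Q $ x $ w * ?R $ w $ y" for w
      using Suc.IH nonneg by (intro mult_nonneg_nonneg) auto
    moreover have "A y" if "A x" and pos: "0 < (\<Sum>w\<in>UNIV. Q $ x $ w * ?R $ w $ y)"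
    proof -
      obtain w where "0 < Q $ x $ w * ?R $ w $ y"
        using pos by (meson not_le sum_nonpos)
      then have "0 < Q $ x $ w" "0 < ?R $ w $ y"
        using nonneg[of x w] Suc.IH[of w] by (auto simp: zero_less_mult_iff)
      then show "A y" using Suc.IH[of w] step[OF \<open>A x\<close>] by blast
    qed
    ultimately show ?case unfolding eq by (auto intro: sum_nonneg)
  qed
  then show ?thesis using assms(1) \<open>A u\<close> unfolding irreducible_matrix_def by blast
qed

section \<open>The balance equation, positivity of \<open>m\<close>, and the sign of the
  energy\<close>

lemma potential_matrix_inverse:
  assumes "irreducible_killed_generator L"
  shows "- L ** potential_matrix L = mat 1" "potential_matrix L ** - L = mat 1"
proof -
  have "\<exists>A. - L ** A = mat 1 \<and> A ** - L = mat 1"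
    using assms by (auto simp: irreducible_killed_generator_def invertible_def)
  from someI_ex[OF this] show "- L ** potential_matrix L = mat 1" "potential_matrix L ** - L = mat 1"
    by (auto simp: potential_matrix_def matrix_inv_def)
qed

lemma potential_measure_balance:
  assumes "irreducible_killed_generator L"
  shows "(\<Sum>x\<in>UNIV. potential_measure L \<mu> $ x * (- L $ x $ y)) = pmf \<mu> y"
proof -
  have "potential_measure L \<mu> v* - L = (\<chi> x. pmf \<mu> x)"
    unfolding potential_measure_def vector_matrix_mul_assoc potential_matrix_inverse[OF assms] by simp
  then show ?thesis
    by (auto simp: vec_eq_iff vector_matrix_mult_def mult.commute)
qed

text \<open>Separates the matrix argument from the probabilistic one. Nonnegativity of the potential
  is an assumption here and is supplied later by the process, where the entries are time integrals
  of transition probabilities.\<close>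

locale positive_potential =
  fixes L :: "real^'x^'x::finite" and \<mu> :: "'x pmf" and m :: "real^'x"
  assumes irreducible: "irreducible_killed_generator L"
    and potential_nonneg: "\<And>x y. 0 \<le> potential_matrix L $ x $ y"
    and m: "m = potential_measure L \<mu>"
begin

lemma generator_decomp:
  obtains q Q where "\<And>x. 0 < q x" "\<And>x y. 0 \<le> Q $ x $ y" "\<And>x. (\<Sum>y\<in>UNIV. Q $ x $ y) \<le> 1"
    "irreducible_matrix Q" "\<And>x y. L $ x $ y = q x * (Q $ x $ y - (if x = y then 1 else 0))"
proof -
  obtain q Q where *: "\<forall>x. 0 < q x" "submarkovian Q" "irreducible_matrix Q"
      "L = (\<chi> x y. - (q x * (mat 1 - Q) $ x $ y))"
    using irreducible unfolding irreducible_killed_generator_def by blast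
  show thesis
    by (rule that[of q Q]) (use * in \<open>auto simp: submarkovian_def mat_def algebra_simps\<close>)
qed

lemma balance: "(\<Sum>x\<in>UNIV. m $ x * L $ x $ y) = - pmf \<mu> y"
  using potential_measure_balance[OF irreducible, of \<mu> y] by (simp add: m sum_negf)

lemma ex_pmf_pos: "\<exists>y. 0 < pmf \<mu> y"
  using set_pmf_not_empty[of \<mu>] by (metis all_not_in_conv less_le pmf_nonneg set_pmf_iff)

lemma m_nonneg: "0 \<le> m $ x"
  by (auto simp: m potential_measure_def vector_matrix_mult_def potential_nonneg intro!: sum_nonneg)

text \<open>By balance, m_y q_y equals \<mu>_y plus the sum of m_w q_w Q_wy over w, so positivity of
  \<open>m\<close> spreads along positive entries of \<open>Q\<close>. It starts somewhere because
  \<mu> has positive total mass.\<close>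

lemma m_pos: "0 < m $ x"
proof -
  from generator_decomp obtain q Q where q: "\<And>x. 0 < q x" and Q: "\<And>x y. 0 \<le> Q $ x $ y"
    and irr: "irreducible_matrix Q" and L: "\<And>x y. L $ x $ y = q x * (Q $ x $ y - (if x = y then 1 else 0))"
    by metis
  have "\<exists>u. m $ u \<noteq> 0"
  proof (rule ccontr)
    assume "\<not> ?thesis"
    then have "pmf \<mu> y = 0" for y using balance[of y] by simp
    then show False using ex_pmf_pos by simp
  qed
  then obtain u where "0 < m $ u" using m_nonneg by (metis less_le)
  from irr Q this show ?thesis
  proof (rule irreducible_matrix_induct)
    fix x y assume x: "0 < m $ x" "0 < Q $ x $ y"
    have "(\<Sum>w\<in>UNIV. m $ w * q w * Q $ w $ y) = (\<Sum>w\<in>UNIV. m $ w * L $ w $ y) + m $ y * q y"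
    proof -
      have "m $ w * L $ w $ y = m $ w * q w * Q $ w $ y - (if w = y then m $ y * q y else 0)" for w
        by (simp add: L algebra_simps)
      then show ?thesis by (simp add: sum_subtractf)
    qed
    moreover have "m $ x * q x * Q $ x $ y \<le> (\<Sum>w\<in>UNIV. m $ w * q w * Q $ w $ y)"
      by (rule member_le_sum) (auto intro!: mult_nonneg_nonneg m_nonneg Q less_imp_le[OF q])
    moreover have "0 < m $ x * q x * Q $ x $ y" using x q by simp
    ultimately have "0 < m $ y * q y" using balance[of y] pmf_nonneg[of \<mu> y] by linarith
    then show "0 < m $ y" using q[of y] by (simp add: zero_less_mult_iff)
  qed
qed

text \<open>Polarisation of Re(z_y cnj z_x). The row sums of \<open>L\<close> collect into a killing
  term, the \<open>m\<close>-weighted column sums into -\<mu> by balance, and the remainder is a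
  jump term.\<close>

lemma energy_form_Re:
  "- Re (energy_form L m z) = (\<Sum>x\<in>UNIV. m $ x * (- (\<Sum>y\<in>UNIV. L $ x $ y)) * (norm (z $ x))\<^sup>2) / 2
    + (\<Sum>y\<in>UNIV. pmf \<mu> y * (norm (z $ y))\<^sup>2) / 2
    + (\<Sum>x\<in>UNIV. \<Sum>y\<in>UNIV. m $ x * L $ x $ y * (norm (z $ x - z $ y))\<^sup>2) / 2"
proof -
  have polar: "Re (z $ y * cnj (z $ x)) = ((norm (z $ x))\<^sup>2 + (norm (z $ y))\<^sup>2 - (norm (z $ x - z $ y))\<^sup>2) / 2" for x y
    by (simp add: cmod_power2 power2_diff)
  have "Re (energy_form L m z) = (\<Sum>x\<in>UNIV. \<Sum>y\<in>UNIV. m $ x * L $ x $ y * Re (z $ y * cnj (z $ x)))"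
  proof -
    have "energy_form L m z = (\<Sum>x\<in>UNIV. \<Sum>y\<in>UNIV. of_real (m $ x * L $ x $ y) * (z $ y * cnj (z $ x)))"
      unfolding energy_form_def by (simp add: sum_distrib_left sum_distrib_right mult_ac)
    moreover have "Re (of_real a * w) = a * Re w" for a w by simp
    ultimately show ?thesis by (simp only: Re_sum)
  qed
  also have "\<dots> = (\<Sum>x\<in>UNIV. \<Sum>y\<in>UNIV. m $ x * L $ x $ y * (norm (z $ x))\<^sup>2 / 2)
      + (\<Sum>y\<in>UNIV. \<Sum>x\<in>UNIV. m $ x * L $ x $ y * (norm (z $ y))\<^sup>2 / 2)
      - (\<Sum>x\<in>UNIV. \<Sum>y\<in>UNIV. m $ x * L $ x $ y * (norm (z $ x - z $ y))\<^sup>2 / 2)"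
    unfolding polar by (subst sum.swap[of _ UNIV UNIV], simp add: algebra_simps sum.distrib sum_subtractf
      add_divide_distrib diff_divide_distrib)
  also have "(\<Sum>y\<in>UNIV. \<Sum>x\<in>UNIV. m $ x * L $ x $ y * (norm (z $ y))\<^sup>2 / 2)
      = - (\<Sum>y\<in>UNIV. pmf \<mu> y * (norm (z $ y))\<^sup>2) / 2"
    by (simp add: sum_distrib_right[symmetric] sum_divide_distrib[symmetric] balance sum_negf)
  also have "(\<Sum>x\<in>UNIV. \<Sum>y\<in>UNIV. m $ x * L $ x $ y * (norm (z $ x))\<^sup>2 / 2)
      = - (\<Sum>x\<in>UNIV. m $ x * (- (\<Sum>y\<in>UNIV. L $ x $ y)) * (norm (z $ x))\<^sup>2) / 2"
    by (simp add: sum_distrib_right[symmetric] sum_divide_distrib[symmetric] sum_distrib_left[symmetric] sum_negf)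
  finally show ?thesis by (simp add: sum_divide_distrib)
qed

text \<open>If the form vanished, the \<mu>-term would give z_u = 0 at a point charged by \<mu>, and
  the jump term would make z constant along positive entries of \<open>Q\<close>. Irreducibility
  then gives z = 0.\<close>

lemma energy_form_pos:
  assumes "z \<noteq> 0"
  shows "Re (energy_form L m z) < 0"
proof -
  from generator_decomp obtain q Q where q: "\<And>x. 0 < q x" and Q: "\<And>x y. 0 \<le> Q $ x $ y"
    and row: "\<And>x. (\<Sum>y\<in>UNIV. Q $ x $ y) \<le> 1"
    and irr: "irreducible_matrix Q" and L: "\<And>x y. L $ x $ y = q x * (Q $ x $ y - (if x = y then 1 else 0))"
    by metis
  define S1 where "S1 = (\<Sum>x\<in>UNIV. m $ x * (- (\<Sum>y\<in>UNIV. L $ x $ y)) * (norm (z $ x))\<^sup>2)"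
  define S2 where "S2 = (\<Sum>y\<in>UNIV. pmf \<mu> y * (norm (z $ y))\<^sup>2)"
  define S3 where "S3 = (\<Sum>x\<in>UNIV. \<Sum>y\<in>UNIV. m $ x * L $ x $ y * (norm (z $ x - z $ y))\<^sup>2)"
  \<comment> \<open>The diagonal of \<open>L\<close> may be negative but is multiplied by 0, so the
    nonnegative rates q_x Q_xy can stand in for the entries of \<open>L\<close>.\<close>
  have S3_eq: "S3 = (\<Sum>x\<in>UNIV. \<Sum>y\<in>UNIV. m $ x * (q x * Q $ x $ y) * (norm (z $ x - z $ y))\<^sup>2)"
    unfolding S3_def by (intro sum.cong refl) (auto simp: L)
  have term3: "0 \<le> m $ x * (q x * Q $ x $ y) * (norm (z $ x - z $ y))\<^sup>2" for x y
    using m_nonneg q Q by (simp add: less_imp_le)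
  have "0 \<le> S1"
  proof -
    have "(\<Sum>y\<in>UNIV. L $ x $ y) \<le> 0" for x
    proof -
      have "(\<Sum>y\<in>UNIV. L $ x $ y) = q x * ((\<Sum>y\<in>UNIV. Q $ x $ y) - 1)"
        by (simp add: L sum_distrib_left[symmetric] sum_subtractf)
      then show ?thesis using row[of x] q[of x] by (simp add: mult_nonneg_nonpos)
    qed
    then show ?thesis unfolding S1_def by (intro sum_nonneg mult_nonneg_nonneg m_nonneg) auto
  qed
  moreover have "0 \<le> S2" unfolding S2_def by (intro sum_nonneg) auto
  moreover have "0 \<le> S3" unfolding S3_eq by (intro sum_nonneg term3)
  moreover have "S2 \<noteq> 0 \<or> S3 \<noteq> 0"
  proof (rule ccontr)
    assume "\<not> ?thesis"
    then have zero: "S2 = 0" "S3 = 0" by auto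
    from zero(1) have "pmf \<mu> y * (norm (z $ y))\<^sup>2 = 0" for y
      unfolding S2_def by (subst (asm) sum_nonneg_eq_0_iff) auto
    then obtain u where "z $ u = 0" using ex_pmf_pos by fastforce
    have "m $ x * (q x * Q $ x $ y) * (norm (z $ x - z $ y))\<^sup>2 = 0" for x y
    proof -
      from zero(2) have "(\<Sum>y\<in>UNIV. m $ x * (q x * Q $ x $ y) * (norm (z $ x - z $ y))\<^sup>2) = 0"
        unfolding S3_eq by (subst (asm) sum_nonneg_eq_0_iff) (auto intro: sum_nonneg term3)
      then show ?thesis by (subst (asm) sum_nonneg_eq_0_iff) (auto intro: term3)
    qed
    then have edge: "z $ x = z $ y" if "0 < Q $ x $ y" for x y
      using that m_pos[of x] q[of x] by (metis less_irrefl mult_eq_0_iff norm_eq_zero power_eq_0_iff right_minus_eq)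
    have "z $ v = 0" for v
      by (rule irreducible_matrix_induct[OF irr Q, of "\<lambda>v. z $ v = 0", OF \<open>z $ u = 0\<close>]) (use edge in auto)
    then show False using \<open>z \<noteq> 0\<close> by (simp add: vec_eq_iff)
  qed
  ultimately show ?thesis
    using energy_form_Re[of z] unfolding S1_def[symmetric] S2_def[symmetric] S3_def[symmetric] by linarith
qed

text \<open>The constant is the minimum over the compact unit sphere; homogeneity of degree 2 does
  the rest.\<close>

lemma energy_form_coercive:
  obtains c where "0 < c" "\<And>z. c * (norm z)\<^sup>2 \<le> - Re (energy_form L m z)"
proof -
  have "continuous_on (sphere 0 1) (\<lambda>z. - Re (energy_form L m z))"
    unfolding energy_form_def by (intro continuous_intros)
  moreover have "sphere (0 :: complex^'x) 1 \<noteq> {}"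
    using norm_Basis[OF SOME_Basis] by (metis empty_iff mem_sphere_0)
  ultimately obtain w :: "complex^'x" where w: "w \<in> sphere 0 1"
      "\<And>z. z \<in> sphere 0 1 \<Longrightarrow> - Re (energy_form L m w) \<le> - Re (energy_form L m z)"
    using continuous_attains_inf[of "sphere 0 1" "\<lambda>z. - Re (energy_form L m z)"] by auto
  show thesis
  proof
    show "0 < - Re (energy_form L m w)" using energy_form_pos[of w] w(1) by (cases "w = 0") auto
    fix z :: "complex^'x"
    show "- Re (energy_form L m w) * (norm z)\<^sup>2 \<le> - Re (energy_form L m z)"
    proof (cases "z = 0")
      case True
      then show ?thesis by (simp add: energy_form_def)
    next
      case False
      define y where "y = (1 / norm z) *\<^sub>R z"
      have "energy_form L m z = (norm z)\<^sup>2 * energy_form L m y"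
      proof -
        have z: "z $ v = norm z * y $ v" for v
          using False by (simp add: y_def) (simp add: scaleR_conv_of_real)
        show ?thesis
          unfolding energy_form_def z sum_distrib_left sum_distrib_right
          by (simp add: mult_ac power2_eq_square)
      qed
      then have "Re (energy_form L m z) = (norm z)\<^sup>2 * Re (energy_form L m y)"
        by (simp flip: of_real_power)
      moreover have "y \<in> sphere 0 1" using False by (simp add: y_def)
      ultimately show ?thesis using mult_right_mono[OF w(2)[of y], of "(norm z)\<^sup>2"] by (simp add: mult.commute)
    qed
  qed
qed

end

section \<open>Right-continuous paths and additive functionals\<close>

text \<open>Right continuity makes the state at t the limit of states at grid times decreasing to t.
  Only times up to \<open>s\<close> are read, so \<open>N\<close> may be the past at
  \<open>s\<close> (progressive measurability) as well as the full space.\<close>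

lemma borel_measurable_right_continuous_state:
  fixes Z :: "real \<Rightarrow> 'w \<Rightarrow> 'b"
  assumes "0 \<le> s"
    and Z: "\<And>r. 0 \<le> r \<Longrightarrow> r \<le> s \<Longrightarrow> Z r \<in> measurable N (count_space UNIV)"
    and right_cont: "\<And>\<omega> t. \<omega> \<in> space N \<Longrightarrow> 0 \<le> t \<Longrightarrow> eventually (\<lambda>r. Z r \<omega> = Z t \<omega>) (at_right t)"
  shows "(\<lambda>(\<omega>, t). if 0 \<le> t \<and> t \<le> s \<and> Z t \<omega> = b then 1 else (0::real)) \<in> borel_measurable (N \<Otimes>\<^sub>M borel)"
proof -
  \<comment> \<open>The right end of the grid cell containing t lies strictly beyond t, as a limit
    from the right requires. Clipping keeps the time that is read inside [0, s].\<close>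
  define c where "c n i = max 0 (min s ((real_of_int i + 1) / (real n + 1)))" for n and i :: int
  have c: "0 \<le> c n i" "c n i \<le> s" for n i using \<open>0 \<le> s\<close> by (auto simp: c_def)
  define f :: "nat \<Rightarrow> int \<Rightarrow> 'w \<times> real \<Rightarrow> real" where "f n i z = (case z of (\<omega>, t) \<Rightarrow> if 0 \<le> t \<and> t \<le> s \<and> Z (c n i) \<omega> = b then 1 else (0::real))" for n i z
  define g where "g n z = f n \<lfloor>(real n + 1) * snd z\<rfloor> z" for n z
  have g: "g n \<in> borel_measurable (N \<Otimes>\<^sub>M borel)" for n
    unfolding g_def
  proof (rule measurable_compose_countable)
    show "f n i \<in> borel_measurable (N \<Otimes>\<^sub>M borel)" for i
    proof -
      note [measurable] = Z[OF c, of n i]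
      show ?thesis unfolding f_def by measurable
    qed
  qed measurable
  show ?thesis
  proof (rule borel_measurable_LIMSEQ_real[OF _ g])
    fix z :: "'w \<times> real" assume "z \<in> space (N \<Otimes>\<^sub>M borel)"
    then obtain \<omega> t where z: "z = (\<omega>, t)" "\<omega> \<in> space N" by (auto simp: space_pair_measure)
    have "\<forall>\<^sub>F n in sequentially. Z (c n \<lfloor>(real n + 1) * t\<rfloor>) \<omega> = Z t \<omega>" if t: "0 \<le> t" "t \<le> s"
    proof -
      define r where "r n = (real_of_int \<lfloor>(real n + 1) * t\<rfloor> + 1) / (real n + 1)" for n
      have r: "t < r n" "r n \<le> t + 1 / (real n + 1)" for n
      proof -
        have "(real n + 1) * t < real_of_int \<lfloor>(real n + 1) * t\<rfloor> + 1" by linarith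
        then show "t < r n" by (simp add: r_def field_simps)
        have "real_of_int \<lfloor>(real n + 1) * t\<rfloor> + 1 \<le> (real n + 1) * t + 1" by linarith
        then have "r n \<le> ((real n + 1) * t + 1) / (real n + 1)"
          unfolding r_def by (intro divide_right_mono) auto
        then show "r n \<le> t + 1 / (real n + 1)" by (simp add: add_divide_distrib)
      qed
      have c_r: "c n \<lfloor>(real n + 1) * t\<rfloor> = min s (r n)" for n
        using \<open>0 \<le> s\<close> t(1) r(1)[of n] unfolding c_def r_def[symmetric] by auto
      \<comment> \<open>At t = s no later time is available, but the clipping then reads the path at
        \<open>s\<close> itself.\<close>
      show ?thesis
      proof (cases "t = s")
        case True
        then have "c n \<lfloor>(real n + 1) * t\<rfloor> = t" for n using r(1)[of n] True unfolding c_r by simp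
        then show ?thesis by (simp only: simp_thms eventually_True)
      next
        case False
        have "(\<lambda>n. t + 1 / (real n + 1)) \<longlonglongrightarrow> t + 0"
          by (intro tendsto_add tendsto_const) (use LIMSEQ_inverse_real_of_nat in \<open>simp add: inverse_eq_divide add.commute\<close>)
        then have "r \<longlonglongrightarrow> t"
          using r by (intro tendsto_sandwich[of "\<lambda>_. t" r sequentially "\<lambda>n. t + 1 / (real n + 1)"]) (simp_all add: less_imp_le)
        then have lim: "filterlim r (at_right t) sequentially"
          using r(1) by (auto simp: filterlim_at intro!: always_eventually)
        have "\<forall>\<^sub>F r in at_right t. Z r \<omega> = Z t \<omega> \<and> r < s"
        proof (rule eventually_conj[OF right_cont[OF z(2) t(1)]])
          show "\<forall>\<^sub>F r in at_right t. r < s"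
            using False t(2) unfolding eventually_at_right_field by (intro exI[of _ s]) auto
        qed
        from eventually_compose_filterlim[OF this lim] show ?thesis
          by eventually_elim (simp add: c_r min_def)
      qed
    qed
    then have "\<forall>\<^sub>F n in sequentially. g n z = (case z of (\<omega>, t) \<Rightarrow> if 0 \<le> t \<and> t \<le> s \<and> Z t \<omega> = b then 1 else (0::real))"
      by (cases "0 \<le> t \<and> t \<le> s") (auto simp: g_def f_def z elim: eventually_mono)
    then show "(\<lambda>n. g n z) \<longlonglongrightarrow> (case z of (\<omega>, t) \<Rightarrow> if 0 \<le> t \<and> t \<le> s \<and> Z t \<omega> = b then 1 else (0::real))"
      by (rule tendsto_eventually)
  qed
qed

section \<open>Exponentials of integrals of a discontinuous rate\<close>

lemma quadratic_increments_imp_constant: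
  fixes D :: "real \<Rightarrow> real"
  assumes "\<And>s t. s \<le> t \<Longrightarrow> \<bar>D t - D s\<bar> \<le> C * (t - s)\<^sup>2"
  shows "D t = D s"
proof -
  have bound: "\<bar>D t - D s\<bar> \<le> C * (t - s)\<^sup>2" for s t
    using assms[of s t] assms[of t s] by (cases "s \<le> t") (auto simp: abs_minus_commute power2_commute)
  have "DERIV D x :> 0" for x
    unfolding has_field_derivative_iff
  proof (rule Lim_null_comparison)
    show "\<forall>\<^sub>F y in at x. norm ((D y - D x) / (y - x)) \<le> C * \<bar>y - x\<bar>"
      unfolding eventually_at_filter
    proof (intro always_eventually allI impI)
      fix y assume "y \<noteq> x"
      then show "norm ((D y - D x) / (y - x)) \<le> C * \<bar>y - x\<bar>"
        using bound[of y x] by (simp add: field_simps power2_eq_square flip: abs_mult)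
    qed
    have "((\<lambda>y. C * \<bar>y - x\<bar>) \<longlongrightarrow> C * \<bar>x - x\<bar>) (at x)"
      by (intro tendsto_intros)
    then show "((\<lambda>y. C * \<bar>y - x\<bar>) \<longlongrightarrow> 0) (at x)" by simp
  qed
  then show ?thesis by (intro DERIV_isconst_all) auto
qed

text \<open>No continuity of \<open>a\<close> is available, so the fundamental theorem of calculus is replaced by
  the observation that the difference of both sides has quadratically small increments.\<close>

lemma exp_minus_integral:
  fixes a :: "real \<Rightarrow> real"
  defines "A t \<equiv> \<integral>s. indicator {..t} s * a s \<partial>lborel"
  assumes [measurable]: "a \<in> borel_measurable borel"
    and a: "\<And>s. 0 \<le> a s" "\<And>s. a s \<le> K" "\<And>s. s < 0 \<Longrightarrow> a s = 0"
  shows "integrable lborel (\<lambda>s. indicator {..t} s * (a s * exp (- A s)))"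
    and "1 - exp (- A t) = (\<integral>s. indicator {..t} s * (a s * exp (- A s)) \<partial>lborel)"
proof -
  have int: "integrable lborel (\<lambda>s. indicator S s * (a s * f s))"
    if [measurable]: "S \<in> sets borel" and f [measurable]: "f \<in> borel_measurable borel" and "S \<subseteq> {..t}"
      and "\<And>s. 0 \<le> f s \<and> f s \<le> 1" for S t f
  proof (rule Bochner_Integration.integrable_bound)
    show "integrable lborel (\<lambda>s. indicator {0..t} s * K)"
      by (intro integrable_mult_left integrable_real_indicator) (auto simp: emeasure_lborel_Icc_eq)
    have "0 \<le> K" using a[of 0] by linarith
    have "a s * f s \<le> K" for s
      using mult_mono[OF a(2)[of s], of "f s" 1] that(4)[of s] \<open>0 \<le> K\<close> by simp
    then show "AE s in lborel. norm (indicator S s * (a s * f s)) \<le> norm (indicator {0..t} s * K)"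
      using a \<open>S \<subseteq> {..t}\<close> that(4) \<open>0 \<le> K\<close>
      by (intro AE_I2) (auto simp: indicator_def abs_mult not_le)
  qed measurable
  note int1 = int[where f = "\<lambda>_. 1", simplified]
  have A_meas [measurable]: "A \<in> borel_measurable borel"
  proof -
    have "A = (\<lambda>t. \<integral>s. (if s \<le> t then a s else 0) \<partial>lborel)"
      unfolding A_def by (intro ext Bochner_Integration.integral_cong) auto
    then show ?thesis by simp
  qed
  have A_split: "A t = A s + (\<integral>r. indicator {s<..t} r * a r \<partial>lborel)" if "s \<le> t" for s t
  proof -
    have "A s + (\<integral>r. indicator {s<..t} r * a r \<partial>lborel) = (\<integral>r. indicator {..s} r * a r + indicator {s<..t} r * a r \<partial>lborel)"
      unfolding A_def
      by (intro Bochner_Integration.integral_add[symmetric] int1[where t = s] int1[where t = t]) auto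
    also have "\<dots> = A t"
      unfolding A_def using that by (intro Bochner_Integration.integral_cong) (auto simp: indicator_def)
    finally show ?thesis by simp
  qed
  have A_nonneg: "0 \<le> A t" for t unfolding A_def by (intro Bochner_Integration.integral_nonneg) (simp add: a)
  have exp_A: "0 \<le> exp (- A s) \<and> exp (- A s) \<le> 1" for s using A_nonneg by simp
  show "integrable lborel (\<lambda>s. indicator {..t} s * (a s * exp (- A s)))"
    by (rule int[OF _ _ _ exp_A]) auto
  define E where "E t = (\<integral>s. indicator {..t} s * (a s * exp (- A s)) \<partial>lborel)" for t
  define D where "D t = exp (- A t) + E t" for t
  \<comment> \<open>Let d be the increment of \<open>A\<close> and e that of \<open>E\<close>.
    Monotonicity of \<open>A\<close> puts e between exp(-A t) d and exp(-A s) d, and d is at most K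
    (t - s). The bounds on exp(-d) then leave an error of at most d^2.\<close>
  have "\<bar>D t - D s\<bar> \<le> K\<^sup>2 * (t - s)\<^sup>2" if "s \<le> t" for s t
  proof -
    define d where "d = (\<integral>r. indicator {s<..t} r * a r \<partial>lborel)"
    define e where "e = (\<integral>r. indicator {s<..t} r * (a r * exp (- A r)) \<partial>lborel)"
    have "0 \<le> d" unfolding d_def by (intro Bochner_Integration.integral_nonneg) (simp add: a)
    have "d \<le> (\<integral>r. indicator {s<..t} r * K \<partial>lborel)"
      unfolding d_def
      by (intro integral_mono int1 integrable_mult_left integrable_real_indicator) (auto simp: a indicator_def that)
    then have "d \<le> K * (t - s)" using that by (simp add: mult.commute)
    have At: "A t = A s + d" using A_split[OF that] by (simp add: d_def)
    have mono: "A r \<le> A r'" if "r \<le> r'" for r r'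
      unfolding A_split[OF that] by (simp, intro Bochner_Integration.integral_nonneg) (simp add: a)
    have int_e: "integrable lborel (\<lambda>r. indicator {s<..t} r * (a r * exp (- A r)))"
      by (rule int[where t = t, OF _ _ _ exp_A]) auto
    have "E s + e = (\<integral>r. indicator {..s} r * (a r * exp (- A r)) + indicator {s<..t} r * (a r * exp (- A r)) \<partial>lborel)"
      unfolding E_def e_def
      by (intro Bochner_Integration.integral_add[symmetric] int_e int[where t = s, OF _ _ _ exp_A]) auto
    also have "\<dots> = E t"
      unfolding E_def using that by (intro Bochner_Integration.integral_cong) (auto simp: indicator_def)
    finally have Et: "E t = E s + e" by simp
    have int_d: "integrable lborel (\<lambda>r. indicator {s<..t} r * a r)"
      by (rule int1[where t = t]) auto
    have "e \<le> (\<integral>r. exp (- A s) * (indicator {s<..t} r * a r) \<partial>lborel)"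
      unfolding e_def
    proof (intro integral_mono int_e integrable_mult_right int_d)
      fix r show "indicator {s<..t} r * (a r * exp (- A r)) \<le> exp (- A s) * (indicator {s<..t} r * a r)"
        using mult_left_mono[of "exp (- A r)" "exp (- A s)" "a r"] mono[of s r] a(1)[of r]
        by (auto simp: indicator_def mult.commute)
    qed
    then have e_le: "e \<le> exp (- A s) * d" by (simp add: d_def)
    have "(\<integral>r. exp (- A t) * (indicator {s<..t} r * a r) \<partial>lborel) \<le> e"
      unfolding e_def
    proof (intro integral_mono int_e integrable_mult_right int_d)
      fix r show "exp (- A t) * (indicator {s<..t} r * a r) \<le> indicator {s<..t} r * (a r * exp (- A r))"
        using mult_left_mono[of "exp (- A t)" "exp (- A r)" "a r"] mono[of r t] a(1)[of r]
        by (auto simp: indicator_def mult.commute)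
    qed
    then have "exp (- A t) * d \<le> e" by (simp add: d_def)
    moreover have "exp (- A t) = exp (- A s) * exp (- d)" by (simp add: At flip: exp_add)
    ultimately have e_ge: "exp (- A s) * (exp (- d) * d) \<le> e" by (metis mult.assoc)
    have "exp (- d) * (1 + d) \<ge> (1 - d) * (1 + d)"
      using exp_ge_add_one_self[of "- d"] \<open>0 \<le> d\<close> by (intro mult_right_mono) auto
    then have lower: "- (d\<^sup>2) \<le> exp (- d) - 1 + exp (- d) * d"
      by (simp add: algebra_simps power2_eq_square)
    have "exp (- d) \<le> 1 / (1 + d)"
      using exp_ge_add_one_self[of d] \<open>0 \<le> d\<close> by (simp add: exp_minus field_simps)
    also have "\<dots> \<le> 1 - d + d\<^sup>2"
    proof -
      have "0 \<le> d * d * d" using \<open>0 \<le> d\<close> by simp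
      then have "1 \<le> (1 - d + d\<^sup>2) * (1 + d)" by (simp add: algebra_simps power2_eq_square)
      then show ?thesis using \<open>0 \<le> d\<close> by (simp add: divide_le_eq)
    qed
    finally have upper: "exp (- d) - 1 + d \<le> d\<^sup>2" by simp
    have diff: "D t - D s = exp (- A s) * (exp (- d) - 1) + e"
      unfolding D_def Et by (simp add: At exp_diff exp_minus field_simps)
    have "D t - D s \<le> exp (- A s) * (exp (- d) - 1 + d)"
      using e_le unfolding diff by (simp add: algebra_simps)
    also have "\<dots> \<le> exp (- A s) * d\<^sup>2" using upper by (intro mult_left_mono) auto
    also have "\<dots> \<le> d\<^sup>2" using exp_A[of s] by (intro mult_left_le_one_le) auto
    finally have 1: "D t - D s \<le> d\<^sup>2" .
    have "- (d\<^sup>2) \<le> exp (- A s) * (- (d\<^sup>2))" using exp_A[of s] mult_left_le_one_le[of "d\<^sup>2" "exp (- A s)"] by simp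
    also have "\<dots> \<le> exp (- A s) * (exp (- d) - 1 + exp (- d) * d)"
      using lower by (intro mult_left_mono) auto
    also have "\<dots> \<le> D t - D s"
      using e_ge unfolding diff by (simp add: algebra_simps)
    finally have "\<bar>D t - D s\<bar> \<le> d\<^sup>2" using 1 by linarith
    also have "\<dots> \<le> (K * (t - s))\<^sup>2" using \<open>0 \<le> d\<close> \<open>d \<le> K * (t - s)\<close> by (intro power_mono)
    finally show ?thesis by (simp add: power_mult_distrib)
  qed
  \<comment> \<open>The rate vanishes at negative times, so both integrals are 0 at time -1 and
    \<open>D\<close> is 1 there.\<close>
  then have "D t = D (- 1)" by (rule quadratic_increments_imp_constant)
  moreover have "A (- 1) = 0"
    unfolding A_def by (subst Bochner_Integration.integral_cong[where g = "\<lambda>_. 0"]) (auto simp: a indicator_def)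
  moreover have "E (- 1) = 0"
    unfolding E_def by (subst Bochner_Integration.integral_cong[where g = "\<lambda>_. 0"]) (auto simp: a indicator_def)
  ultimately show "1 - exp (- A t) = (\<integral>s. indicator {..t} s * (a s * exp (- A s)) \<partial>lborel)"
    by (simp add: D_def E_def)
qed

section \<open>The transition semigroup\<close>

context killed_markov_process
begin

abbreviation p :: "real \<Rightarrow> 'x \<Rightarrow> 'x \<Rightarrow> real" where
  "p t x y \<equiv> transition_matrix P Z t $ x $ y"

lemma p_eq: "p t x y = measure (P x) {\<omega> \<in> space (P x). Z t \<omega> = Some y}"
  by (simp add: transition_matrix_def)

lemma p_bounds: "0 \<le> p t x y" "p t x y \<le> 1"
  unfolding p_eq by (auto intro: prob_space.prob_le_1[OF prob_space])

lemma subalgebra_past: "subalgebra (P x) (past (P x) Z s)"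
proof -
  let ?G = "{Z r -` A \<inter> space (P x) | r A. 0 \<le> r \<and> r \<le> s}"
  have G: "?G \<subseteq> sets (P x)"
    by (auto intro!: measurable_sets[OF measurable_state])
  have "?G \<subseteq> Pow (space (P x))" by blast
  then have "sets (past (P x) Z s) = sigma_sets (space (P x)) ?G"
    unfolding past_def by (rule sets_measure_of)
  then show ?thesis
    unfolding subalgebra_def using sets.sigma_sets_subset[OF G]
    by (simp add: past_def space_measure_of_conv)
qed

lemma measurable_past:
  assumes "0 \<le> r" "r \<le> s"
  shows "Z r \<in> measurable (past (P x) Z s) (count_space UNIV)"
proof (rule measurableI)
  fix A
  show "Z r -` A \<inter> space (past (P x) Z s) \<in> sets (past (P x) Z s)"
    unfolding past_def space_measure_of_conv
    by (rule in_measure_of) (use assms in auto)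
qed simp

lemma space_past: "space (past (P x) Z s) = space (P x)"
  by (simp add: past_def space_measure_of_conv)

text \<open>The conditional probability is tested against the bounded past-measurable
  \<open>H\<close> and then split by the state at time \<open>s\<close>; the cemetery contributes
  0.\<close>

lemma markov_integral:
  fixes H :: "'w \<Rightarrow> real"
  assumes "0 \<le> s" "0 \<le> t" and H: "H \<in> borel_measurable (past (P x) Z s)"
    and bound: "\<And>\<omega>. \<omega> \<in> space (P x) \<Longrightarrow> \<bar>H \<omega>\<bar> \<le> B"
  shows "(\<integral>\<omega>. H \<omega> * (if Z (s + t) \<omega> = Some y then 1 else 0) \<partial>P x) =
    (\<Sum>u\<in>UNIV. (\<integral>\<omega>. H \<omega> * (if Z s \<omega> = Some u then 1 else 0) \<partial>P x) * p t u y)"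
proof -
  interpret prob_space "P x" by (rule prob_space)
  interpret finite_measure_subalgebra "P x" "past (P x) Z s"
    by unfold_locales (rule subalgebra_past)
  note [measurable] = measurable_state[of "s + t" x] measurable_state[of s x]
  have [measurable]: "H \<in> borel_measurable (P x)"
    by (rule measurable_from_subalg[OF subalgebra_past H])
  have st: "0 \<le> s + t" using assms by simp
  have int: "integrable (P x) (\<lambda>\<omega>. H \<omega> * f \<omega>)"
    if [measurable]: "f \<in> borel_measurable (P x)" and "\<And>\<omega>. \<bar>f \<omega>\<bar> \<le> 1" for f
  proof (rule integrable_const_bound[where B = "\<bar>B\<bar>"])
    show "AE \<omega> in P x. norm (H \<omega> * f \<omega>) \<le> \<bar>B\<bar>"
    proof (rule AE_I2)
      fix \<omega> assume "\<omega> \<in> space (P x)"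
      then have "\<bar>H \<omega>\<bar> * \<bar>f \<omega>\<bar> \<le> \<bar>B\<bar> * 1"
        using bound[of \<omega>] that(2)[of \<omega>] by (intro mult_mono) auto
      then show "norm (H \<omega> * f \<omega>) \<le> \<bar>B\<bar>" by (simp add: abs_mult)
    qed
  qed measurable
  let ?g = "indicat_real {\<omega> \<in> space (P x). Z (s + t) \<omega> = Some y}"
  have g: "?g \<in> borel_measurable (P x)" using st by measurable
  have "(\<integral>\<omega>. H \<omega> * (if Z (s + t) \<omega> = Some y then 1 else 0) \<partial>P x) = (\<integral>\<omega>. H \<omega> * ?g \<omega> \<partial>P x)"
    by (intro Bochner_Integration.integral_cong) (auto simp: indicator_def)
  also have "\<dots> = (\<integral>\<omega>. H \<omega> * real_cond_exp (P x) (past (P x) Z s) ?g \<omega> \<partial>P x)"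
    by (rule real_cond_exp_intg(2)[symmetric, OF int[OF g] H g]) (auto simp: indicator_def)
  also have "\<dots> = (\<integral>\<omega>. (\<Sum>u\<in>UNIV. H \<omega> * (if Z s \<omega> = Some u then 1 else 0) * p t u y) \<partial>P x)"
  proof (rule integral_cong_AE)
    show "AE \<omega> in P x. H \<omega> * real_cond_exp (P x) (past (P x) Z s) ?g \<omega> =
        (\<Sum>u\<in>UNIV. H \<omega> * (if Z s \<omega> = Some u then 1 else 0) * p t u y)"
      using markov[OF assms(1,2), of x y]
    proof eventually_elim
      case (elim \<omega>)
      show ?case unfolding elim
        by (cases "Z s \<omega>") (auto simp: if_distrib if_distribR cong: if_cong)
    qed
  qed (use assms(1) in measurable)
  also have "\<dots> = (\<Sum>u\<in>UNIV. \<integral>\<omega>. H \<omega> * (if Z s \<omega> = Some u then 1 else 0) * p t u y \<partial>P x)"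
    by (intro Bochner_Integration.integral_sum integrable_mult_left int) (use assms(1) in auto)
  finally show ?thesis by simp
qed

lemma p_zero: "p 0 x y = (if x = y then 1 else 0)"
proof -
  have space1: "measure (P x) (space (P x)) = 1" by (rule prob_space.prob_space[OF prob_space])
  interpret prob_space "P x" by (rule prob_space)
  note [measurable] = measurable_state[of 0 x]
  have "p 0 x y = measure (P x) {\<omega> \<in> space (P x). x = y}"
    unfolding p_eq using start[of x] by (intro finite_measure_eq_AE) auto
  then show ?thesis using space1 by auto
qed

lemma p_add:
  assumes "0 \<le> s" "0 \<le> t"
  shows "p (s + t) x y = (\<Sum>u\<in>UNIV. p s x u * p t u y)"
proof -
  interpret prob_space "P x" by (rule prob_space)
  have "p r x u = (\<integral>\<omega>. 1 * (if Z r \<omega> = Some u then 1 else 0) \<partial>P x)" if "0 \<le> r" for r u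
  proof -
    note [measurable] = measurable_state[OF that, of x]
    have "p r x u = (\<integral>\<omega>. indicator {\<omega> \<in> space (P x). Z r \<omega> = Some u} \<omega> \<partial>P x)"
      unfolding p_eq by (subst Bochner_Integration.integral_indicator) (auto simp: Int_def conj_commute)
    also have "\<dots> = (\<integral>\<omega>. 1 * (if Z r \<omega> = Some u then 1 else 0) \<partial>P x)"
      by (intro Bochner_Integration.integral_cong) (auto simp: indicator_def)
    finally show ?thesis .
  qed
  then show ?thesis
    using markov_integral[OF assms, of "\<lambda>_. 1" x 1 y] assms by simp
qed

lemma p_increment:
  assumes "0 \<le> s" "s \<le> t"
  shows "p t x y - p s x y = (\<Sum>u\<in>UNIV. p s x u * (p (t - s) u y - p 0 u y))"
proof -
  have "p s x u * p 0 u y = (if u = y then p s x u else 0)" for u by (simp add: p_zero)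
  then show ?thesis
    using p_add[of s "t - s" x y] assms by (simp add: right_diff_distrib sum_subtractf)
qed

lemma p_derivative_zero: "((\<lambda>h. (p h x y - p 0 x y) / h) \<longlongrightarrow> L $ x $ y) (at_right 0)"
proof -
  have "((\<lambda>t. p t x y) has_vector_derivative L $ x $ y) (at 0 within {0..})"
    by (intro bounded_linear.has_vector_derivative[OF bounded_linear_vec_nth] generator)
  then show ?thesis
    by (simp add: has_real_derivative_iff_has_vector_derivative[symmetric] has_field_derivative_iff
      at_within_Ici_at_right)
qed

lemma p_tendsto_zero: "((\<lambda>h. p h x y) \<longlongrightarrow> p 0 x y) (at_right 0)"
proof -
  have "((\<lambda>h. (p h x y - p 0 x y) / h * h + p 0 x y) \<longlongrightarrow> L $ x $ y * 0 + p 0 x y) (at_right 0)"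
    by (intro tendsto_intros p_derivative_zero)
  then have "((\<lambda>h. (p h x y - p 0 x y) / h * h + p 0 x y) \<longlongrightarrow> p 0 x y) (at_right 0)" by simp
  then show ?thesis
    by (rule Lim_transform_eventually) (auto simp: eventually_at_filter)
qed

text \<open>The increment from s to t is bounded by the sum of |p (t - s) - p 0| over the starting
  states, uniformly in s, because the factors p s are at most 1. Right continuity at 0 thus yields
  left continuity everywhere.\<close>

lemma p_tendsto_left:
  assumes "0 < t"
  shows "((\<lambda>s. p s x y) \<longlongrightarrow> p t x y) (at_left t)"
proof -
  have lim: "filterlim (\<lambda>s. t - s) (at_right 0) (at_left t)"
    unfolding filterlim_at
    by (auto intro!: tendsto_eq_intros simp: eventually_at_filter)
  have "((\<lambda>s. \<Sum>u\<in>UNIV. \<bar>p (t - s) u y - p 0 u y\<bar>) \<longlongrightarrow> (\<Sum>u\<in>UNIV. \<bar>p 0 u y - p 0 u y\<bar>)) (at_left t)"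
    by (intro tendsto_intros filterlim_compose[OF p_tendsto_zero lim])
  then have "((\<lambda>s. \<Sum>u\<in>UNIV. \<bar>p (t - s) u y - p 0 u y\<bar>) \<longlongrightarrow> 0) (at_left t)" by simp
  then have "((\<lambda>s. p s x y - p t x y) \<longlongrightarrow> 0) (at_left t)"
  proof (rule Lim_null_comparison[rotated])
    have "\<forall>\<^sub>F s in at_left t. 0 < s \<and> s < t"
      using assms by (auto simp: eventually_at_left_field)
    then show "\<forall>\<^sub>F s in at_left t. norm (p s x y - p t x y) \<le> (\<Sum>u\<in>UNIV. \<bar>p (t - s) u y - p 0 u y\<bar>)"
    proof eventually_elim
      case (elim s)
      have "\<bar>p t x y - p s x y\<bar> \<le> (\<Sum>u\<in>UNIV. \<bar>p s x u * (p (t - s) u y - p 0 u y)\<bar>)"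
        using elim by (subst p_increment) (auto intro: sum_abs)
      also have "\<dots> \<le> (\<Sum>u\<in>UNIV. \<bar>p (t - s) u y - p 0 u y\<bar>)"
        using p_bounds by (intro sum_mono) (auto simp: abs_mult intro!: mult_left_le_one_le)
      finally show ?case by (simp add: abs_minus_commute)
    qed
  qed
  then show ?thesis by (simp add: LIM_zero_iff)
qed

text \<open>Kolmogorov's forward equation. The semigroup property reduces both one-sided quotients
  to the derivative at 0; the left quotient has coefficients p s with s increasing to t, hence the
  preceding left continuity.\<close>

lemma p_derivative:
  assumes "0 \<le> t"
  shows "((\<lambda>s. p s x y) has_real_derivative (\<Sum>u\<in>UNIV. p t x u * L $ u $ y)) (at t within {0..})"
proof -
  have right: "((\<lambda>s. (p s x y - p t x y) / (s - t)) \<longlongrightarrow> (\<Sum>u\<in>UNIV. p t x u * L $ u $ y)) (at_right t)"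
  proof -
    have lim: "filterlim (\<lambda>s. s - t) (at_right 0) (at_right t)"
      unfolding filterlim_at by (auto intro!: tendsto_eq_intros simp: eventually_at_filter)
    have "((\<lambda>s. \<Sum>u\<in>UNIV. p t x u * ((p (s - t) u y - p 0 u y) / (s - t))) \<longlongrightarrow>
        (\<Sum>u\<in>UNIV. p t x u * L $ u $ y)) (at_right t)"
      by (intro tendsto_intros filterlim_compose[OF p_derivative_zero lim])
    then show ?thesis
    proof (rule Lim_transform_eventually)
      show "\<forall>\<^sub>F s in at_right t. (\<Sum>u\<in>UNIV. p t x u * ((p (s - t) u y - p 0 u y) / (s - t))) =
          (p s x y - p t x y) / (s - t)"
        unfolding eventually_at_filter
      proof (intro always_eventually allI impI)
        fix s assume "s \<in> {t<..}"
        then show "(\<Sum>u\<in>UNIV. p t x u * ((p (s - t) u y - p 0 u y) / (s - t))) = (p s x y - p t x y) / (s - t)"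
          by (subst p_increment[OF assms]) (simp_all add: sum_divide_distrib)
      qed
    qed
  qed
  have left: "((\<lambda>s. (p s x y - p t x y) / (s - t)) \<longlongrightarrow> (\<Sum>u\<in>UNIV. p t x u * L $ u $ y)) (at_left t)" if "0 < t"
  proof -
    have lim: "filterlim (\<lambda>s. t - s) (at_right 0) (at_left t)"
      unfolding filterlim_at by (auto intro!: tendsto_eq_intros simp: eventually_at_filter)
    have "((\<lambda>s. \<Sum>u\<in>UNIV. p s x u * ((p (t - s) u y - p 0 u y) / (t - s))) \<longlongrightarrow>
        (\<Sum>u\<in>UNIV. p t x u * L $ u $ y)) (at_left t)"
      by (intro tendsto_intros filterlim_compose[OF p_derivative_zero lim] p_tendsto_left that)
    then show ?thesis
    proof (rule Lim_transform_eventually)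
      have "\<forall>\<^sub>F s in at_left t. 0 < s \<and> s < t"
        using that by (auto simp: eventually_at_left_field)
      then show "\<forall>\<^sub>F s in at_left t. (\<Sum>u\<in>UNIV. p s x u * ((p (t - s) u y - p 0 u y) / (t - s))) =
          (p s x y - p t x y) / (s - t)"
      proof eventually_elim
        case (elim s)
        have "(\<Sum>u\<in>UNIV. p s x u * ((p (t - s) u y - p 0 u y) / (t - s))) = (p t x y - p s x y) / (t - s)"
          using elim by (subst p_increment[of s t]) (simp_all add: sum_divide_distrib)
        also have "\<dots> = (p s x y - p t x y) / (s - t)"
          by (metis minus_diff_eq minus_divide_divide)
        finally show ?case .
      qed
    qed
  qed
  show ?thesis
  proof (cases "t = 0")
    case True
    then show ?thesis using right by (simp add: has_field_derivative_iff at_within_Ici_at_right)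
  next
    case False
    then have "((\<lambda>s. p s x y) has_real_derivative (\<Sum>u\<in>UNIV. p t x u * L $ u $ y)) (at t)"
      unfolding has_field_derivative_iff
      using left right assms by (intro filterlim_split_at) auto
    then show ?thesis by (rule has_field_derivative_at_within)
  qed
qed

lemma continuous_on_p: "continuous_on {0..} (\<lambda>t. p t x y)"
  by (intro DERIV_continuous_on[where D = "\<lambda>t. \<Sum>u\<in>UNIV. p t x u * L $ u $ y"] p_derivative) auto

text \<open>The probability of being at \<open>y\<close> is at most that of being alive. The latter
  decreases to 0 along the integers because the cemetery is absorbing and is reached almost
  surely.\<close>

lemma p_tendsto_infinity: "(\<lambda>n. p (real n) x y) \<longlonglongrightarrow> 0"
proof -
  interpret prob_space "P x" by (rule prob_space)
  define A where "A n = {\<omega> \<in> space (P x). Z (real n) \<omega> \<noteq> None}" for n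
  have A[measurable]: "A n \<in> sets (P x)" for n
  proof -
    note [measurable] = measurable_state[of "real n" x]
    show ?thesis unfolding A_def by measurable
  qed
  have "decseq A"
    unfolding decseq_def
  proof (intro allI impI subsetI)
    fix n k :: nat and \<omega> assume "n \<le> k" "\<omega> \<in> A k"
    then show "\<omega> \<in> A n"
      using cemetery[of \<omega> x "real n" "real k"] by (cases "Z (real n) \<omega>") (auto simp: A_def)
  qed
  then have lim: "(\<lambda>n. measure (P x) (A n)) \<longlonglongrightarrow> measure (P x) (\<Inter>n. A n)"
    using A by (intro finite_Lim_measure_decseq) auto
  have "AE \<omega> in P x. \<omega> \<notin> (\<Inter>n. A n)"
    using finite_lifetime[of x]
  proof eventually_elim
    case (elim \<omega>)
    show ?case
    proof
      assume *: "\<omega> \<in> (\<Inter>n. A n)"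
      from elim obtain t where t: "0 \<le> t" "Z t \<omega> = None"
        unfolding lifetime_def Inf_less_iff by auto
      obtain n where "t \<le> real n" using real_arch_simple by blast
      moreover have "\<omega> \<in> A n" using * by blast
      ultimately show False using t cemetery[of \<omega> x t "real n"] by (auto simp: A_def)
    qed
  qed
  then have "measure (P x) (\<Inter>n. A n) = 0"
    by (intro measure_eq_0_null_sets AE_iff_null_sets[THEN iffD2]) auto
  with lim have lim: "(\<lambda>n. measure (P x) (A n)) \<longlonglongrightarrow> 0" by simp
  show ?thesis
  proof (rule tendsto_sandwich[OF _ _ tendsto_const lim])
    show "\<forall>\<^sub>F n in sequentially. p (real n) x y \<le> measure (P x) (A n)"
      unfolding p_eq by (intro always_eventually allI finite_measure_mono A) (auto simp: A_def)
  qed (auto simp: p_bounds)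
qed

text \<open>The entry h of V - P_t V has derivative - P_t L V = P_t, starts at 0 and tends to the
  entry of V along the integers. Integrating the derivative identifies V and shows its sign.\<close>

lemma potential:
  assumes V: "- L ** V = mat 1"
  shows "(\<integral>\<^sup>+t. indicator {0..} t * ennreal (p t x y) \<partial>lborel) = ennreal (V $ x $ y)" "0 \<le> V $ x $ y"
proof -
  define h where "h t = V $ x $ y - (\<Sum>w\<in>UNIV. p t x w * V $ w $ y)" for t
  have LV: "(\<Sum>w\<in>UNIV. L $ u $ w * V $ w $ y) = (if u = y then - 1 else 0)" for u
  proof -
    have "(- L ** V) $ u $ y = mat 1 $ u $ y" using V by simp
    then show ?thesis by (simp add: matrix_matrix_mult_def mat_def sum_negf split: if_splits)
  qed
  have h0: "h 0 = 0"
  proof -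
    have "p 0 x w * V $ w $ y = (if x = w then V $ w $ y else 0)" for w by (simp add: p_zero)
    then show ?thesis by (simp add: h_def)
  qed
  have "(h has_real_derivative p t x y) (at t within {0..})" if "0 \<le> t" for t
  proof -
    have "(h has_real_derivative - (\<Sum>w\<in>UNIV. (\<Sum>u\<in>UNIV. p t x u * L $ u $ w) * V $ w $ y)) (at t within {0..})"
      unfolding h_def using p_derivative[OF that] by (auto intro!: derivative_eq_intros)
    also have "(\<Sum>w\<in>UNIV. (\<Sum>u\<in>UNIV. p t x u * L $ u $ w) * V $ w $ y) =
        (\<Sum>u\<in>UNIV. p t x u * (\<Sum>w\<in>UNIV. L $ u $ w * V $ w $ y))"
      unfolding sum_distrib_left sum_distrib_right by (subst sum.swap) (simp add: mult_ac)
    also have "\<dots> = (\<Sum>u\<in>UNIV. if u = y then - p t x u else 0)"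
      unfolding LV by (intro sum.cong) auto
    finally show ?thesis by simp
  qed
  then have "((\<lambda>t. p t x y) has_integral (h T - h 0)) {0..T}" if "0 \<le> T" for T
    using that unfolding has_real_derivative_iff_has_vector_derivative
    by (intro fundamental_theorem_of_calculus)
      (auto intro!: has_vector_derivative_within_subset[where S = "{0..}" and T = "{0..T}"])
  then have hT: "((\<lambda>t. p t x y) has_integral h T) {0..T}" if "0 \<le> T" for T
    using that h0 by simp
  have nn: "(\<integral>\<^sup>+t. indicator {0..real n} t * ennreal (p t x y) \<partial>lborel) = ennreal (h (real n))" for n
  proof -
    have "set_integrable lborel {0..real n} (\<lambda>t. p t x y)"
      by (intro borel_integrable_atLeastAtMost' continuous_on_subset[OF continuous_on_p]) auto
    then have "(\<integral>\<^sup>+t. ennreal (indicator {0..real n} t *\<^sub>R p t x y) \<partial>lborel) = ennreal (LBINT t:{0..real n}. p t x y)"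
      unfolding set_integrable_def set_lebesgue_integral_def
      by (intro nn_integral_eq_integral) (auto simp: p_bounds)
    also have "(LBINT t:{0..real n}. p t x y) = h (real n)"
      using \<open>set_integrable _ _ _\<close> hT[of "real n"] by (simp add: set_borel_integral_eq_integral integral_unique)
    also have "(\<integral>\<^sup>+t. ennreal (indicator {0..real n} t *\<^sub>R p t x y) \<partial>lborel) =
        (\<integral>\<^sup>+t. indicator {0..real n} t * ennreal (p t x y) \<partial>lborel)"
      by (intro nn_integral_cong) (auto simp: indicator_def)
    finally show ?thesis .
  qed
  have h_nonneg: "0 \<le> h (real n)" for n
    by (rule has_integral_nonneg[OF hT]) (auto simp: p_bounds)
  have h_lim: "(\<lambda>n. h (real n)) \<longlonglongrightarrow> V $ x $ y - (\<Sum>w\<in>UNIV. 0 * V $ w $ y)"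
    unfolding h_def by (intro tendsto_intros p_tendsto_infinity)
  then have h_lim: "(\<lambda>n. h (real n)) \<longlonglongrightarrow> V $ x $ y" by simp
  show "0 \<le> V $ x $ y"
    using h_nonneg by (intro LIMSEQ_le_const[OF h_lim]) auto
  have [measurable]: "(\<lambda>t. indicator {0..real n} t * ennreal (p t x y)) \<in> borel_measurable lborel" for n
  proof -
    have "(\<lambda>t. indicator {0..real n} t *\<^sub>R p t x y) \<in> borel_measurable borel"
      by (intro borel_measurable_continuous_on_indicator continuous_on_subset[OF continuous_on_p]) auto
    then have "(\<lambda>t. ennreal (indicator {0..real n} t *\<^sub>R p t x y)) \<in> borel_measurable lborel" by simp
    then show ?thesis
      by (rule measurable_cong[THEN iffD1, rotated]) (auto simp: indicator_def)
  qed
  have "(\<lambda>n. \<integral>\<^sup>+t. indicator {0..real n} t * ennreal (p t x y) \<partial>lborel) \<longlonglongrightarrow>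
      (\<integral>\<^sup>+t. indicator {0..} t * ennreal (p t x y) \<partial>lborel)"
  proof (rule nn_integral_LIMSEQ)
    show "incseq (\<lambda>n t. indicator {0..real n} t * ennreal (p t x y))"
      by (auto simp: incseq_def le_fun_def indicator_def)
    fix t :: real
    obtain N where N: "t \<le> real N" using real_arch_simple by blast
    have "\<forall>\<^sub>F n in sequentially. indicator {0..real n} t * ennreal (p t x y) = indicator {0..} t * ennreal (p t x y)"
      using eventually_ge_at_top[of N]
      by eventually_elim (use N in \<open>auto simp: indicator_def\<close>)
    then show "(\<lambda>n. indicator {0..real n} t * ennreal (p t x y)) \<longlonglongrightarrow> indicator {0..} t * ennreal (p t x y)"
      by (rule tendsto_eventually)
  qed measurable
  then show "(\<integral>\<^sup>+t. indicator {0..} t * ennreal (p t x y) \<partial>lborel) = ennreal (V $ x $ y)"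
    unfolding nn using tendsto_ennrealI[OF h_lim] by (rule LIMSEQ_unique)
qed

end

section \<open>The Feynman-Kac formula\<close>

context killed_markov_process
begin

text \<open>The value 0 at negative times lets time integrals and convolutions run over the whole
  real line. After the lifetime the value is 0 by itself, since the path is then in
  \<open>None\<close>.\<close>

definition state_ind :: "'x \<Rightarrow> 'w \<Rightarrow> real \<Rightarrow> real" where
  "state_ind y \<omega> t = (if 0 \<le> t \<and> Z t \<omega> = Some y then 1 else 0)"

definition occupation :: "'x \<Rightarrow> 'w \<Rightarrow> real \<Rightarrow> real" where
  "occupation y \<omega> t = (\<integral>s. (if s \<le> t then state_ind y \<omega> s else 0) \<partial>lborel)"

lemma state_ind_bounds [simp]: "0 \<le> state_ind y \<omega> t" "state_ind y \<omega> t \<le> 1"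
  by (auto simp: state_ind_def)

lemma state_ind_neg [simp]: "t < 0 \<Longrightarrow> state_ind y \<omega> t = 0"
  by (simp add: state_ind_def)

lemma state_ind_mult: "state_ind u \<omega> t * state_ind v \<omega> t = (if u = v then state_ind u \<omega> t else 0)"
  by (auto simp: state_ind_def)

text \<open>Truncated at \<open>s\<close>, the indicator involves only times in [0, s]. Integration
  over t then makes occupation times up to \<open>s\<close> measurable for the past, as the Markov
  property demands.\<close>

lemma measurable_state_ind_past:
  assumes "0 \<le> s"
  shows "(\<lambda>(\<omega>, t). if t \<le> s then state_ind y \<omega> t else 0) \<in> borel_measurable (past (P x) Z s \<Otimes>\<^sub>M borel)"
proof -
  have "(\<lambda>(\<omega>, t). if 0 \<le> t \<and> t \<le> s \<and> Z t \<omega> = Some y then 1 else (0::real)) \<in>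
      borel_measurable (past (P x) Z s \<Otimes>\<^sub>M borel)"
    by (rule borel_measurable_right_continuous_state[OF assms measurable_past right_continuous[of _ x]])
      (simp_all add: space_past)
  also have "(\<lambda>(\<omega>, t). if 0 \<le> t \<and> t \<le> s \<and> Z t \<omega> = Some y then 1 else (0::real)) =
      (\<lambda>(\<omega>, t). if t \<le> s then state_ind y \<omega> t else 0)"
    by (auto simp: state_ind_def fun_eq_iff)
  finally show ?thesis .
qed

lemma measurable_state_ind: "(\<lambda>(\<omega>, t). state_ind y \<omega> t) \<in> borel_measurable (P x \<Otimes>\<^sub>M borel)"
proof (rule borel_measurable_LIMSEQ_real)
  show "(\<lambda>(\<omega>, t). if t \<le> real n then state_ind y \<omega> t else 0) \<in> borel_measurable (P x \<Otimes>\<^sub>M borel)" for n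
  proof -
    have "(\<lambda>(\<omega>, t). if 0 \<le> t \<and> t \<le> real n \<and> Z t \<omega> = Some y then 1 else (0::real)) \<in>
        borel_measurable (P x \<Otimes>\<^sub>M borel)"
      by (rule borel_measurable_right_continuous_state[OF of_nat_0_le_iff measurable_state right_continuous[of _ x]])
        simp_all
    also have "(\<lambda>(\<omega>, t). if 0 \<le> t \<and> t \<le> real n \<and> Z t \<omega> = Some y then 1 else (0::real)) =
        (\<lambda>(\<omega>, t). if t \<le> real n then state_ind y \<omega> t else 0)"
      by (auto simp: state_ind_def fun_eq_iff)
    finally show ?thesis .
  qed
  fix z :: "'w \<times> real"
  obtain N where "snd z \<le> real N" using real_arch_simple by blast
  have "\<forall>\<^sub>F n in sequentially. (case z of (\<omega>, t) \<Rightarrow> if t \<le> real n then state_ind y \<omega> t else 0) =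
      (case z of (\<omega>, t) \<Rightarrow> state_ind y \<omega> t)"
    using eventually_ge_at_top[of N]
  proof eventually_elim
    case (elim n)
    with \<open>snd z \<le> real N\<close> have "snd z \<le> real n" by linarith
    then show ?case by (simp add: case_prod_unfold)
  qed
  then show "(\<lambda>n. case z of (\<omega>, t) \<Rightarrow> if t \<le> real n then state_ind y \<omega> t else 0) \<longlonglongrightarrow>
      (case z of (\<omega>, t) \<Rightarrow> state_ind y \<omega> t)"
    by (rule tendsto_eventually)
qed

lemma measurable_state_ind_comp:
  assumes f: "f \<in> measurable M (P x)" and g: "g \<in> borel_measurable M"
  shows "(\<lambda>a. state_ind y (f a) (g a)) \<in> borel_measurable M"
  using measurable_compose[OF measurable_Pair[OF f g] measurable_state_ind[of y x]] by simp

lemma measurable_occupation_comp: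
  assumes f: "f \<in> measurable M (P x)" and g: "g \<in> borel_measurable M"
  shows "(\<lambda>a. occupation y (f a) (g a)) \<in> borel_measurable M"
proof -
  note [measurable (raw)] = measurable_state_ind_comp[of _ _ x]
  note [measurable] = f g
  have "(\<lambda>z. f (fst z)) \<in> measurable (M \<Otimes>\<^sub>M lborel) (P x)" by measurable
  then have [measurable]: "(\<lambda>z. state_ind y (f (fst z)) (snd z)) \<in> borel_measurable (M \<Otimes>\<^sub>M lborel)"
    by (rule measurable_state_ind_comp) simp
  have "(\<lambda>(a, s). if s \<le> g a then state_ind y (f a) s else 0) \<in> borel_measurable (M \<Otimes>\<^sub>M lborel)"
    unfolding split_beta' by measurable
  then show ?thesis
    unfolding occupation_def by (rule lborel.borel_measurable_lebesgue_integral)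
qed

lemma measurable_occupation_past:
  assumes "0 \<le> s"
  shows "(\<lambda>\<omega>. occupation y \<omega> s) \<in> borel_measurable (past (P x) Z s)"
  unfolding occupation_def
  by (rule lborel.borel_measurable_lebesgue_integral)
    (use measurable_state_ind_past[OF assms, of y x] in simp)

lemma measurable_state_ind_past_at:
  assumes "0 \<le> s"
  shows "(\<lambda>\<omega>. state_ind y \<omega> s) \<in> borel_measurable (past (P x) Z s)"
proof -
  note [measurable] = measurable_past[OF assms order_refl, of x]
  show ?thesis unfolding state_ind_def by measurable
qed

lemma measurable_state_ind_path:
  assumes "\<omega> \<in> space (P x)"
  shows "state_ind y \<omega> \<in> borel_measurable borel"
  using measurable_compose[OF measurable_Pair[OF measurable_const[OF assms] measurable_ident] measurable_state_ind[of y x]]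
  by (simp add: eta_contract_eq[symmetric])

end

lemma nn_integral_convolution:
  fixes f g :: "real \<Rightarrow> ennreal"
  assumes [measurable]: "f \<in> borel_measurable borel" "g \<in> borel_measurable borel"
  shows "(\<integral>\<^sup>+t. (\<integral>\<^sup>+s. f s * g (t - s) \<partial>lborel) \<partial>lborel) = (\<integral>\<^sup>+s. f s \<partial>lborel) * (\<integral>\<^sup>+t. g t \<partial>lborel)"
proof -
  have "(\<integral>\<^sup>+t. (\<integral>\<^sup>+s. f s * g (t - s) \<partial>lborel) \<partial>lborel) = (\<integral>\<^sup>+s. (\<integral>\<^sup>+t. f s * g (t - s) \<partial>lborel) \<partial>lborel)"
    by (rule lborel_pair.Fubini') measurable
  also have "\<dots> = (\<integral>\<^sup>+s. f s * (\<integral>\<^sup>+t. g t \<partial>lborel) \<partial>lborel)"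
  proof (rule nn_integral_cong)
    fix s
    have "(\<integral>\<^sup>+t. g (t - s) \<partial>lborel) = (\<integral>\<^sup>+t. g t \<partial>lborel)"
      using nn_integral_real_affine[of "\<lambda>t. g (t - s)" 1 s] by simp
    then show "(\<integral>\<^sup>+t. f s * g (t - s) \<partial>lborel) = f s * (\<integral>\<^sup>+t. g t \<partial>lborel)"
      by (simp add: nn_integral_cmult)
  qed
  also have "\<dots> = (\<integral>\<^sup>+s. f s \<partial>lborel) * (\<integral>\<^sup>+t. g t \<partial>lborel)"
    by (rule nn_integral_multc) measurable
  finally show ?thesis .
qed

context killed_markov_process
begin

lemma occupation_nonneg: "0 \<le> occupation u \<omega> t"
  unfolding occupation_def by (intro Bochner_Integration.integral_nonneg) simp

lemma integrable_state_ind: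
  assumes "\<omega> \<in> space (P x)"
  shows "integrable lborel (\<lambda>s. if s \<le> t then state_ind u \<omega> s else 0)"
proof (rule Bochner_Integration.integrable_bound)
  note [measurable] = measurable_state_ind_path[OF assms]
  show "(\<lambda>s. if s \<le> t then state_ind u \<omega> s else 0) \<in> borel_measurable lborel" by measurable
  show "integrable lborel (indicat_real {0..t})" by (auto simp: emeasure_lborel_Icc_eq)
  show "AE s in lborel. norm (if s \<le> t then state_ind u \<omega> s else 0) \<le> norm (indicat_real {0..t} s)"
    by (intro AE_I2) (auto simp: indicator_def not_le)
qed

text \<open>The transition probability extended by 0 to negative times. Extended nonnegative values
  allow convolutions and exchanges of integrals before any finiteness is known.\<close>

definition survival :: "'x \<Rightarrow> 'x \<Rightarrow> real \<Rightarrow> ennreal" where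
  "survival x y t = (\<integral>\<^sup>+\<omega>. ennreal (state_ind y \<omega> t) \<partial>P x)"

lemma survival_eq:
  assumes "0 \<le> t"
  shows "survival x y t = ennreal (p t x y)"
proof -
  interpret prob_space "P x" by (rule prob_space)
  note [measurable] = measurable_state[OF assms, of x]
  have "survival x y t = (\<integral>\<^sup>+\<omega>. indicator {\<omega> \<in> space (P x). Z t \<omega> = Some y} \<omega> \<partial>P x)"
    unfolding survival_def by (intro nn_integral_cong) (auto simp: state_ind_def assms)
  then show ?thesis unfolding p_eq by (simp add: emeasure_eq_measure)
qed

lemma survival_neg: "t < 0 \<Longrightarrow> survival x y t = 0"
  by (simp add: survival_def)

lemma measurable_survival [measurable]: "survival x y \<in> borel_measurable borel"
proof -
  interpret prob_space "P x" by (rule prob_space)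
  note [measurable (raw)] = measurable_state_ind_comp[of _ _ x]
  show ?thesis unfolding survival_def by measurable
qed

section \<open>Killing at the rate of an additive functional\<close>

context
  fixes k :: "'x \<Rightarrow> real"
  assumes k: "\<And>u. 0 \<le> k u"
begin

definition additive :: "'w \<Rightarrow> real \<Rightarrow> real" where
  "additive \<omega> t = (\<Sum>u\<in>UNIV. k u * occupation u \<omega> t)"

definition rate :: "'w \<Rightarrow> real \<Rightarrow> real" where
  "rate \<omega> t = (\<Sum>u\<in>UNIV. k u * state_ind u \<omega> t)"

lemma rate_bounds: "0 \<le> rate \<omega> t" "rate \<omega> t \<le> (\<Sum>u\<in>UNIV. k u)"
  unfolding rate_def
  by (auto intro!: sum_nonneg sum_mono mult_nonneg_nonneg k mult_left_le)

lemma rate_state_ind: "rate \<omega> t * state_ind w \<omega> t = k w * state_ind w \<omega> t"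
proof -
  have "rate \<omega> t * state_ind w \<omega> t = (\<Sum>u\<in>UNIV. if u = w then k u * state_ind u \<omega> t else 0)"
    unfolding rate_def sum_distrib_right mult.assoc state_ind_mult by (intro sum.cong) auto
  then show ?thesis by simp
qed

lemma additive_nonneg: "0 \<le> additive \<omega> t"
  unfolding additive_def by (intro sum_nonneg mult_nonneg_nonneg k occupation_nonneg)

lemma exp_additive: "0 \<le> exp (- additive \<omega> t)" "exp (- additive \<omega> t) \<le> 1"
  using additive_nonneg by auto

lemma additive_eq:
  assumes "\<omega> \<in> space (P x)"
  shows "additive \<omega> t = (\<integral>s. indicator {..t} s * rate \<omega> s \<partial>lborel)"
proof -
  have "additive \<omega> t = (\<integral>s. (\<Sum>u\<in>UNIV. k u * (if s \<le> t then state_ind u \<omega> s else 0)) \<partial>lborel)"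
    unfolding additive_def occupation_def
    by (subst Bochner_Integration.integral_sum) (auto intro!: integrable_state_ind[OF assms])
  also have "\<dots> = (\<integral>s. indicator {..t} s * rate \<omega> s \<partial>lborel)"
    by (intro Bochner_Integration.integral_cong) (auto simp: rate_def indicator_def)
  finally show ?thesis .
qed

lemma measurable_additive_comp:
  assumes "f \<in> measurable M (P x)" "g \<in> borel_measurable M"
  shows "(\<lambda>a. additive (f a) (g a)) \<in> borel_measurable M"
  unfolding additive_def
  by (intro borel_measurable_sum borel_measurable_times borel_measurable_const
      measurable_occupation_comp[OF assms])

lemma measurable_rate_comp:
  assumes "f \<in> measurable M (P x)" "g \<in> borel_measurable M"
  shows "(\<lambda>a. rate (f a) (g a)) \<in> borel_measurable M"
  unfolding rate_def
  by (intro borel_measurable_sum borel_measurable_times borel_measurable_const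
      measurable_state_ind_comp[OF assms])

definition killed :: "'x \<Rightarrow> 'x \<Rightarrow> real \<Rightarrow> ennreal" where
  "killed x y t = (\<integral>\<^sup>+\<omega>. ennreal (exp (- additive \<omega> t) * state_ind y \<omega> t) \<partial>P x)"

lemma measurable_killed [measurable]: "killed x y \<in> borel_measurable borel"
proof -
  interpret prob_space "P x" by (rule prob_space)
  note [measurable (raw)] = measurable_state_ind_comp[of _ _ x] measurable_additive_comp[of _ _ x]
  show ?thesis unfolding killed_def by measurable
qed

lemma killed_le_survival: "killed x y t \<le> survival x y t"
  unfolding killed_def survival_def
  by (intro nn_integral_mono ennreal_leI mult_left_le_one_le) (auto simp: additive_nonneg)

lemma killed_neg: "t < 0 \<Longrightarrow> killed x y t = 0"
  by (simp add: killed_def)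

text \<open>The rate times the exponential at time \<open>s\<close> is bounded and past-measurable,
  so the Markov property applies at \<open>s\<close>. Splitting by the state w at that time replaces
  the rate by the constant \<open>k w\<close>.\<close>

lemma killed_markov:
  assumes "0 \<le> s" "s \<le> t"
  shows "(\<integral>\<^sup>+\<omega>. ennreal (rate \<omega> s * exp (- additive \<omega> s) * state_ind y \<omega> t) \<partial>P x) =
    (\<Sum>w\<in>UNIV. ennreal (k w) * (killed x w s * survival w y (t - s)))"
proof -
  interpret prob_space "P x" by (rule prob_space)
  note [measurable (raw)] = measurable_state_ind_comp[of _ _ x] measurable_additive_comp[of _ _ x]
    measurable_rate_comp[of _ _ x]
  define H where "H \<omega> = rate \<omega> s * exp (- additive \<omega> s)" for \<omega>
  define K where "K = (\<Sum>u\<in>UNIV. k u)"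
  have H: "H \<in> borel_measurable (past (P x) Z s)"
  proof -
    note [measurable] = measurable_state_ind_past_at[OF \<open>0 \<le> s\<close>] measurable_occupation_past[OF \<open>0 \<le> s\<close>]
    show ?thesis unfolding H_def rate_def additive_def by measurable
  qed
  have [measurable]: "H \<in> borel_measurable (P x)" by (rule measurable_from_subalg[OF subalgebra_past H])
  have H_bound: "0 \<le> H \<omega>" "H \<omega> \<le> K" for \<omega>
  proof -
    show "0 \<le> H \<omega>" unfolding H_def by (intro mult_nonneg_nonneg rate_bounds exp_additive)
    have "H \<omega> \<le> K * 1"
      unfolding H_def K_def by (intro mult_mono rate_bounds exp_additive sum_nonneg k)
    then show "H \<omega> \<le> K" by simp
  qed
  have K: "0 \<le> K" using H_bound order_trans by blast
  have int: "integrable (P x) (\<lambda>\<omega>. f \<omega> * state_ind u \<omega> r)"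
    if [measurable]: "f \<in> borel_measurable (P x)" and "\<And>\<omega>. 0 \<le> f \<omega>" "\<And>\<omega>. f \<omega> \<le> c" for f u r c
  proof (rule integrable_const_bound[where B = c])
    show "AE \<omega> in P x. norm (f \<omega> * state_ind u \<omega> r) \<le> c"
    proof (rule AE_I2)
      fix \<omega>
      have "f \<omega> * state_ind u \<omega> r \<le> c * 1"
        using that(2,3)[of \<omega>] by (intro mult_mono) (auto intro: order_trans)
      then show "norm (f \<omega> * state_ind u \<omega> r) \<le> c" using that(2)[of \<omega>] by (simp add: abs_mult)
    qed
  qed measurable
  have real_killed: "killed x w s = ennreal (\<integral>\<omega>. exp (- additive \<omega> s) * state_ind w \<omega> s \<partial>P x)" for w
    unfolding killed_def
  proof (rule nn_integral_eq_integral)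
    show "integrable (P x) (\<lambda>\<omega>. exp (- additive \<omega> s) * state_ind w \<omega> s)"
      by (rule int[OF _ exp_additive]) measurable
  qed simp
  have "(\<integral>\<^sup>+\<omega>. ennreal (H \<omega> * state_ind y \<omega> t) \<partial>P x) = ennreal (\<integral>\<omega>. H \<omega> * state_ind y \<omega> t \<partial>P x)"
  proof (rule nn_integral_eq_integral)
    show "integrable (P x) (\<lambda>\<omega>. H \<omega> * state_ind y \<omega> t)"
      by (rule int[OF _ H_bound]) measurable
  qed (simp add: H_bound)
  also have "(\<integral>\<omega>. H \<omega> * state_ind y \<omega> t \<partial>P x) = (\<integral>\<omega>. H \<omega> * (if Z (s + (t - s)) \<omega> = Some y then 1 else 0) \<partial>P x)"
    using assms by (intro Bochner_Integration.integral_cong) (auto simp: state_ind_def)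
  also have "\<dots> = (\<Sum>u\<in>UNIV. (\<integral>\<omega>. H \<omega> * (if Z s \<omega> = Some u then 1 else 0) \<partial>P x) * p (t - s) u y)"
    by (rule markov_integral[where B = K]) (use assms H H_bound in auto)
  also have "\<dots> = (\<Sum>u\<in>UNIV. k u * ((\<integral>\<omega>. exp (- additive \<omega> s) * state_ind u \<omega> s \<partial>P x) * p (t - s) u y))"
  proof (intro sum.cong refl)
    fix u
    have "(\<integral>\<omega>. H \<omega> * (if Z s \<omega> = Some u then 1 else 0) \<partial>P x) =
        (\<integral>\<omega>. k u * (exp (- additive \<omega> s) * state_ind u \<omega> s) \<partial>P x)"
    proof (intro Bochner_Integration.integral_cong refl)
      fix \<omega>
      have "H \<omega> * (if Z s \<omega> = Some u then 1 else 0) = exp (- additive \<omega> s) * (rate \<omega> s * state_ind u \<omega> s)"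
        using assms by (auto simp: H_def state_ind_def)
      then show "H \<omega> * (if Z s \<omega> = Some u then 1 else 0) = k u * (exp (- additive \<omega> s) * state_ind u \<omega> s)"
        by (simp add: rate_state_ind)
    qed
    then show "(\<integral>\<omega>. H \<omega> * (if Z s \<omega> = Some u then 1 else 0) \<partial>P x) * p (t - s) u y =
        k u * ((\<integral>\<omega>. exp (- additive \<omega> s) * state_ind u \<omega> s \<partial>P x) * p (t - s) u y)" by simp
  qed
  also have "ennreal \<dots> = (\<Sum>w\<in>UNIV. ennreal (k w) * (killed x w s * survival w y (t - s)))"
  proof -
    have nn: "0 \<le> (\<integral>\<omega>. exp (- additive \<omega> s) * state_ind u \<omega> s \<partial>P x)" for u
      by (intro Bochner_Integration.integral_nonneg mult_nonneg_nonneg) auto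
    show ?thesis
      using assms by (simp add: real_killed survival_eq sum_ennreal[symmetric] ennreal_mult k nn p_bounds)
  qed
  finally show ?thesis by (simp add: H_def)
qed

text \<open>Duhamel's formula: a path alive at t either escapes the extra killing, or is killed at
  some time s in state w and is then followed without extra killing. Pathwise it is the integral
  identity for 1 - exp(-A t), multiplied by the indicator of \<open>y\<close> at time t.\<close>

lemma survival_killed:
  "survival x y t = killed x y t + (\<Sum>w\<in>UNIV. ennreal (k w) * (\<integral>\<^sup>+s. killed x w s * survival w y (t - s) \<partial>lborel))"
proof -
  interpret prob_space "P x" by (rule prob_space)
  interpret pair_sigma_finite "P x" lborel ..
  note [measurable (raw)] = measurable_state_ind_comp[of _ _ x] measurable_additive_comp[of _ _ x]
    measurable_rate_comp[of _ _ x]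
  have path: "ennreal (state_ind y \<omega> t) = ennreal (exp (- additive \<omega> t) * state_ind y \<omega> t) +
      (\<integral>\<^sup>+s. indicator {..t} s * ennreal (rate \<omega> s * exp (- additive \<omega> s) * state_ind y \<omega> t) \<partial>lborel)"
    if \<omega>: "\<omega> \<in> space (P x)" for \<omega>
  proof -
    note [measurable] = measurable_state_ind_path[OF \<omega>]
    have [measurable]: "rate \<omega> \<in> borel_measurable borel" unfolding rate_def by measurable
    have rate_neg: "rate \<omega> s = 0" if "s < 0" for s using that by (simp add: rate_def)
    note A = exp_minus_integral[of "rate \<omega>", OF _ rate_bounds rate_neg, folded additive_eq[OF \<omega>]]
    let ?f = "\<lambda>s. indicator {..t} s * (rate \<omega> s * exp (- additive \<omega> s))"
    have "ennreal (1 - exp (- additive \<omega> t)) = (\<integral>\<^sup>+s. ennreal (?f s) \<partial>lborel)"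
      using A by (subst nn_integral_eq_integral) (auto simp: rate_bounds)
    then have "ennreal (1 - exp (- additive \<omega> t)) * ennreal (state_ind y \<omega> t) =
        (\<integral>\<^sup>+s. ennreal (?f s) * ennreal (state_ind y \<omega> t) \<partial>lborel)"
      using borel_measurable_integrable[OF A(1)] by (simp add: nn_integral_multc)
    also have "\<dots> = (\<integral>\<^sup>+s. indicator {..t} s * ennreal (rate \<omega> s * exp (- additive \<omega> s) * state_ind y \<omega> t) \<partial>lborel)"
      by (intro nn_integral_cong) (auto simp: indicator_def ennreal_mult rate_bounds)
    also have "ennreal (1 - exp (- additive \<omega> t)) * ennreal (state_ind y \<omega> t) =
        ennreal ((1 - exp (- additive \<omega> t)) * state_ind y \<omega> t)"
      by (rule ennreal_mult[symmetric]) (auto simp: additive_nonneg)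
    finally have *: "(\<integral>\<^sup>+s. indicator {..t} s * ennreal (rate \<omega> s * exp (- additive \<omega> s) * state_ind y \<omega> t) \<partial>lborel) =
      ennreal ((1 - exp (- additive \<omega> t)) * state_ind y \<omega> t)" by simp
    show ?thesis unfolding *
      using additive_nonneg[of \<omega> t]
      by (subst ennreal_plus[symmetric]) (auto simp: left_diff_distrib intro!: mult_left_le_one_le)
  qed
  have "survival x y t = (\<integral>\<^sup>+\<omega>. ennreal (exp (- additive \<omega> t) * state_ind y \<omega> t) +
      (\<integral>\<^sup>+s. indicator {..t} s * ennreal (rate \<omega> s * exp (- additive \<omega> s) * state_ind y \<omega> t) \<partial>lborel) \<partial>P x)"
    unfolding survival_def by (intro nn_integral_cong path)
  also have "\<dots> = killed x y t + (\<integral>\<^sup>+\<omega>.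
      (\<integral>\<^sup>+s. indicator {..t} s * ennreal (rate \<omega> s * exp (- additive \<omega> s) * state_ind y \<omega> t) \<partial>lborel) \<partial>P x)"
    unfolding killed_def by (rule nn_integral_add) measurable
  also have "(\<integral>\<^sup>+\<omega>. (\<integral>\<^sup>+s. indicator {..t} s * ennreal (rate \<omega> s * exp (- additive \<omega> s) * state_ind y \<omega> t) \<partial>lborel) \<partial>P x) =
      (\<integral>\<^sup>+s. (\<integral>\<^sup>+\<omega>. indicator {..t} s * ennreal (rate \<omega> s * exp (- additive \<omega> s) * state_ind y \<omega> t) \<partial>P x) \<partial>lborel)"
    by (rule Fubini'[symmetric]) measurable
  also have "\<dots> = (\<integral>\<^sup>+s. (\<Sum>w\<in>UNIV. ennreal (k w) * (killed x w s * survival w y (t - s))) \<partial>lborel)"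
  proof (rule nn_integral_cong)
    fix s
    have *: "(\<integral>\<^sup>+\<omega>. indicator {..t} s * ennreal (rate \<omega> s * exp (- additive \<omega> s) * state_ind y \<omega> t) \<partial>P x) =
        indicator {..t} s * (\<integral>\<^sup>+\<omega>. ennreal (rate \<omega> s * exp (- additive \<omega> s) * state_ind y \<omega> t) \<partial>P x)"
      by (rule nn_integral_cmult) measurable
    \<comment> \<open>Outside [0, t] both sides vanish: \<open>killed\<close> is 0 for s < 0 and
      \<open>survival\<close> is 0 for t < s. The sum is therefore a convolution over the whole
      line.\<close>
    consider "s < 0" | "t < s" | "0 \<le> s" "s \<le> t" by linarith
    then show "(\<integral>\<^sup>+\<omega>. indicator {..t} s * ennreal (rate \<omega> s * exp (- additive \<omega> s) * state_ind y \<omega> t) \<partial>P x) =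
        (\<Sum>w\<in>UNIV. ennreal (k w) * (killed x w s * survival w y (t - s)))"
    proof cases
      case 1
      then show ?thesis by (simp add: killed_neg rate_def)
    next
      case 2
      then show ?thesis by (simp add: * survival_neg)
    next
      case 3
      then show ?thesis by (simp add: * killed_markov)
    qed
  qed
  also have "\<dots> = (\<Sum>w\<in>UNIV. ennreal (k w) * (\<integral>\<^sup>+s. killed x w s * survival w y (t - s) \<partial>lborel))"
    by (simp add: nn_integral_sum nn_integral_cmult)
  finally show ?thesis .
qed

text \<open>Integration over t turns the convolutions of Duhamel's formula into products. Domination
  by the potential makes these integrals finite, so the identity descends to real matrices and can
  be multiplied by \<open>- L\<close> on the right.\<close>

lemma killed_resolvent:
  assumes V: "- L ** V = mat 1" "V ** - L = mat 1"
  obtains u where "\<And>x y. (\<integral>\<^sup>+t. killed x y t \<partial>lborel) = ennreal (u x y)" "\<And>x y. 0 \<le> u x y"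
    "\<And>x y. (\<Sum>w\<in>UNIV. u x w * (- L $ w $ y + (if w = y then k y else 0))) = (if x = y then 1 else 0)"
proof -
  have surv: "(\<integral>\<^sup>+t. survival x y t \<partial>lborel) = ennreal (V $ x $ y)" for x y
  proof -
    have "(\<integral>\<^sup>+t. survival x y t \<partial>lborel) = (\<integral>\<^sup>+t. indicator {0..} t * ennreal (p t x y) \<partial>lborel)"
      by (intro nn_integral_cong) (auto simp: indicator_def survival_eq survival_neg)
    then show ?thesis using potential(1)[OF V(1)] by simp
  qed
  have V_nonneg: "0 \<le> V $ x $ y" for x y using potential(2)[OF V(1)] .
  define u where "u x y = enn2real (\<integral>\<^sup>+t. killed x y t \<partial>lborel)" for x y
  have u_nonneg: "0 \<le> u x y" for x y by (simp add: u_def)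
  have u: "(\<integral>\<^sup>+t. killed x y t \<partial>lborel) = ennreal (u x y)" for x y
  proof -
    have "(\<integral>\<^sup>+t. killed x y t \<partial>lborel) \<le> ennreal (V $ x $ y)"
      unfolding surv[symmetric] by (intro nn_integral_mono killed_le_survival)
    then have "(\<integral>\<^sup>+t. killed x y t \<partial>lborel) < top" by (rule le_less_trans) simp
    then show ?thesis by (simp add: u_def)
  qed
  have resolvent: "V $ x $ y = u x y + (\<Sum>w\<in>UNIV. k w * (u x w * V $ w $ y))" for x y
  proof -
    have "ennreal (V $ x $ y) = (\<integral>\<^sup>+t. killed x y t +
        (\<Sum>w\<in>UNIV. ennreal (k w) * (\<integral>\<^sup>+s. killed x w s * survival w y (t - s) \<partial>lborel)) \<partial>lborel)"
      unfolding surv[symmetric] by (intro nn_integral_cong survival_killed)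
    also have "\<dots> = ennreal (u x y) + (\<Sum>w\<in>UNIV. ennreal (k w) * (ennreal (u x w) * ennreal (V $ w $ y)))"
      by (simp add: nn_integral_add nn_integral_sum nn_integral_cmult nn_integral_convolution u surv)
    also have "\<dots> = ennreal (u x y + (\<Sum>w\<in>UNIV. k w * (u x w * V $ w $ y)))"
      by (simp add: k u_nonneg V_nonneg ennreal_mult'[symmetric] sum_nonneg)
    finally show ?thesis
      by (subst (asm) ennreal_inj) (auto simp: k u_nonneg V_nonneg intro!: add_nonneg_nonneg sum_nonneg)
  qed
  have VL: "(\<Sum>z\<in>UNIV. V $ w $ z * - L $ z $ y) = (if w = y then 1 else 0)" for w y
  proof -
    have "(V ** - L) $ w $ y = mat 1 $ w $ y" using V by simp
    then show ?thesis by (simp add: matrix_matrix_mult_def mat_def)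
  qed
  show thesis
  proof (rule that[of u, OF u u_nonneg])
    fix x y
    have "(if x = y then 1 else 0) = (\<Sum>z\<in>UNIV. V $ x $ z * - L $ z $ y)" by (simp only: VL)
    also have "\<dots> = (\<Sum>z\<in>UNIV. u x z * - L $ z $ y) + (\<Sum>z\<in>UNIV. \<Sum>w\<in>UNIV. k w * u x w * (V $ w $ z * - L $ z $ y))"
      by (subst resolvent) (simp only: distrib_right sum.distrib sum_distrib_right mult.assoc)
    also have "(\<Sum>z\<in>UNIV. \<Sum>w\<in>UNIV. k w * u x w * (V $ w $ z * - L $ z $ y)) =
        (\<Sum>w\<in>UNIV. k w * u x w * (\<Sum>z\<in>UNIV. V $ w $ z * - L $ z $ y))"
      unfolding sum_distrib_left by (rule sum.swap)
    also have "\<dots> = (\<Sum>w\<in>UNIV. if w = y then u x w * k y else 0)"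
      unfolding VL by (intro sum.cong) auto
    also have "(\<Sum>z\<in>UNIV. u x z * - L $ z $ y) + \<dots> = (\<Sum>w\<in>UNIV. u x w * (- L $ w $ y + (if w = y then k y else 0)))"
      unfolding sum.distrib[symmetric] by (intro sum.cong) (auto simp: ring_distribs)
    finally show "(\<Sum>w\<in>UNIV. u x w * (- L $ w $ y + (if w = y then k y else 0))) = (if x = y then 1 else 0)"
      by simp
  qed
qed

end

end

section \<open>Bridge measures and the isomorphism\<close>

text \<open>A bounded nonnegative density makes \<open>F\<close> increasing and Lipschitz, so its
  Stieltjes measure is given by increments on half-open intervals. These form an intersection-stable
  generator on which the density agrees.\<close>

lemma interval_measure_eq_density:
  fixes f :: "real \<Rightarrow> real"
  assumes [measurable]: "f \<in> borel_measurable borel" and "\<And>t. 0 \<le> f t" "\<And>t. f t \<le> K"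
    and F: "\<And>a b. a \<le> b \<Longrightarrow> F b - F a = (\<integral>t. indicator {a<..b} t * f t \<partial>lborel)"
  shows "interval_measure F = density lborel (\<lambda>t. ennreal (f t))"
proof -
  have int: "integrable lborel (\<lambda>t. indicator {a<..b} t * f t)" if "a \<le> b" for a b
  proof (rule Bochner_Integration.integrable_bound)
    show "integrable lborel (\<lambda>t. indicator {a<..b} t * K)"
      using that by (intro integrable_mult_left integrable_real_indicator) auto
    show "AE t in lborel. norm (indicator {a<..b} t * f t) \<le> norm (indicator {a<..b} t * K)"
      using assms(2,3) by (intro AE_I2) (auto simp: indicator_def intro: order_trans[OF assms(3) abs_ge_self])
  qed measurable
  have mono: "F a \<le> F b" if "a \<le> b" for a b
  proof -
    have "0 \<le> F b - F a"
      unfolding F[OF that] by (intro Bochner_Integration.integral_nonneg) (simp add: assms(2))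
    then show ?thesis by simp
  qed
  have upper: "F b - F a \<le> K * (b - a)" if "a \<le> b" for a b
  proof -
    have "F b - F a \<le> (\<integral>t. indicator {a<..b} t * K \<partial>lborel)"
      unfolding F[OF that] using that
      by (intro integral_mono int integrable_mult_left integrable_real_indicator)
        (auto simp: assms(3) indicator_def)
    then show ?thesis using that by (simp add: mult.commute)
  qed
  have right_cont: "continuous (at_right a) F" for a
    unfolding continuous_within
  proof (rule tendsto_sandwich)
    show "\<forall>\<^sub>F b in at_right a. F a \<le> F b"
      using mono by (auto simp: eventually_at_filter)
    show "\<forall>\<^sub>F b in at_right a. F b \<le> F a + K * (b - a)"
      unfolding eventually_at_filter
    proof (intro always_eventually allI impI)
      fix b assume "b \<in> {a<..}"
      then show "F b \<le> F a + K * (b - a)" using upper[of a b] by simp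
    qed
    have "((\<lambda>b. F a + K * (b - a)) \<longlongrightarrow> F a + K * (a - a)) (at_right a)"
      by (intro tendsto_intros)
    then show "((\<lambda>b. F a + K * (b - a)) \<longlongrightarrow> F a) (at_right a)" by simp
  qed simp
  have Ioc: "emeasure (density lborel (\<lambda>t. ennreal (f t))) {a<..b} = ennreal (F b - F a)" if "a \<le> b" for a b
  proof -
    have "emeasure (density lborel (\<lambda>t. ennreal (f t))) {a<..b} = (\<integral>\<^sup>+t. ennreal (indicator {a<..b} t * f t) \<partial>lborel)"
      by (subst emeasure_density) (auto intro!: nn_integral_cong simp: indicator_def)
    also have "\<dots> = ennreal (F b - F a)"
      unfolding F[OF that] using assms(2) by (intro nn_integral_eq_integral int that) auto
    finally show ?thesis .
  qed
  let ?E = "range (\<lambda>(a, b). {a<..b::real})"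
  show ?thesis
  proof (rule measure_eqI_generator_eq[where E = ?E and \<Omega> = UNIV and A = "\<lambda>n. {- real n<..real n}"])
    show "Int_stable ?E"
    proof (rule Int_stableI_image)
      fix i j :: "real \<times> real"
      show "\<exists>k\<in>UNIV. (case i of (a, b) \<Rightarrow> {a<..b}) \<inter> (case j of (a, b) \<Rightarrow> {a<..b}) = (case k of (a, b) \<Rightarrow> {a<..b})"
        by (intro bexI[of _ "(max (fst i) (fst j), min (snd i) (snd j))"]) (auto split: prod.split)
    qed
    show "emeasure (interval_measure F) X = emeasure (density lborel (\<lambda>t. ennreal (f t))) X" if "X \<in> ?E" for X
    proof -
      from that obtain a b where X: "X = {a<..b}" by auto
      show ?thesis
        unfolding X using mono right_cont
        by (cases "a \<le> b") (simp_all add: emeasure_interval_measure_Ioc Ioc)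
    qed
    show "sets (interval_measure F) = sigma_sets UNIV ?E"
      by (simp add: borel_sigma_sets_Ioc)
    show "sets (density lborel (\<lambda>t. ennreal (f t))) = sigma_sets UNIV ?E"
      by (simp add: borel_sigma_sets_Ioc)
    show "(\<Union>n. {- real n<..real n}) = UNIV"
    proof (intro set_eqI iffI UNIV_I)
      fix t :: real
      obtain n where "\<bar>t\<bar> < real n" using reals_Archimedean2 by blast
      then show "t \<in> (\<Union>n. {- real n<..real n})" by (intro UN_I[of n]) auto
    qed
    show "emeasure (interval_measure F) {- real n<..real n} \<noteq> \<infinity>" for n
      using mono right_cont by (simp add: emeasure_interval_measure_Ioc)
  qed auto
qed

lemma borel_measurable_vec_lambda:
  fixes f :: "'x::finite \<Rightarrow> 'a \<Rightarrow> real"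
  assumes "\<And>u. f u \<in> borel_measurable M"
  shows "(\<lambda>a. \<chi> u. f u a) \<in> borel_measurable M"
  using assms by (subst borel_measurable_euclidean_space) (auto simp: Basis_vec_def inner_axis)

section \<open>Local times and bridge measures as densities\<close>

locale killed_potential_process = killed_markov_process L P Z + positive_potential L \<mu> m
  for L :: "real^'x^'x::finite" and P :: "'x \<Rightarrow> 'w measure" and Z \<mu> m
begin

text \<open>Right continuity keeps the path in \<open>u\<close> for a short time after s, and
  absorption excludes an earlier death. The strict inequality matches the range of durations in the
  bridge expectations.\<close>

lemma less_lifetime:
  assumes "\<omega> \<in> space (P x)" "0 \<le> s" "Z s \<omega> = Some u"
  shows "ereal s < lifetime Z \<omega>"
proof -
  from right_continuous[OF assms(1,2)] obtain b where b: "s < b" "\<And>r. s < r \<Longrightarrow> r < b \<Longrightarrow> Z r \<omega> = Z s \<omega>"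
    unfolding eventually_at_right_field by auto
  have "ereal b \<le> lifetime Z \<omega>"
    unfolding lifetime_def
  proof (rule Inf_greatest, clarify)
    fix t assume t: "0 \<le> t" "Z t \<omega> = None"
    have "\<not> t \<le> s" using cemetery[OF assms(1) t(1) _ t(2), of s] assms(3) by auto
    moreover have "\<not> (s < t \<and> t < b)" using b(2)[of t] t assms(3) by auto
    ultimately show "ereal b \<le> ereal t" by simp
  qed
  then show ?thesis using b(1) by (meson ereal_less_eq(3) less_ereal.simps(1) order_less_le_trans)
qed

lemma local_time_eq:
  assumes \<omega>: "\<omega> \<in> space (P x)"
  shows "local_time Z m t u \<omega> = occupation u \<omega> t / m $ u"
proof -
  have "local_time Z m t u \<omega> = (\<integral>s. (if s \<le> t then state_ind u \<omega> s else 0) / m $ u \<partial>lborel)"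
    unfolding local_time_def set_lebesgue_integral_def
    using less_lifetime[OF \<omega>]
    by (intro Bochner_Integration.integral_cong) (auto simp: state_ind_def indicator_def less_imp_le)
  then show ?thesis by (simp add: occupation_def)
qed

lemma local_time_measure_eq:
  assumes \<omega>: "\<omega> \<in> space (P x)"
  shows "local_time_measure Z m y \<omega> = density lborel (\<lambda>t. ennreal (state_ind y \<omega> t / m $ y))"
  unfolding local_time_measure_def
proof (rule interval_measure_eq_density[where K = "1 / m $ y"])
  note [measurable] = measurable_state_ind_path[OF \<omega>]
  show "(\<lambda>t. state_ind y \<omega> t / m $ y) \<in> borel_measurable borel" by measurable
  show "0 \<le> state_ind y \<omega> t / m $ y" "state_ind y \<omega> t / m $ y \<le> 1 / m $ y" for t
    using m_pos[of y] by (auto intro: divide_right_mono less_imp_le)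
  fix a b :: real assume "a \<le> b"
  have "occupation y \<omega> b - occupation y \<omega> a =
      (\<integral>s. (if s \<le> b then state_ind y \<omega> s else 0) - (if s \<le> a then state_ind y \<omega> s else 0) \<partial>lborel)"
    unfolding occupation_def
    by (rule Bochner_Integration.integral_diff[symmetric]) (rule integrable_state_ind[OF \<omega>])+
  also have "\<dots> = (\<integral>s. indicator {a<..b} s * state_ind y \<omega> s \<partial>lborel)"
    using \<open>a \<le> b\<close> by (intro Bochner_Integration.integral_cong) (auto simp: indicator_def)
  finally have "(occupation y \<omega> b - occupation y \<omega> a) / m $ y =
      (\<integral>s. indicator {a<..b} s * state_ind y \<omega> s / m $ y \<partial>lborel)" by simp
  then show "local_time Z m b y \<omega> - local_time Z m a y \<omega> =
      (\<integral>t. indicator {a<..b} t * (state_ind y \<omega> t / m $ y) \<partial>lborel)"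
    by (simp add: local_time_eq[OF \<omega>] diff_divide_distrib)
qed

definition occupation_field :: "'w \<times> real \<Rightarrow> real^'x" where
  "occupation_field = (\<lambda>(\<omega>, t). \<chi> u. occupation u \<omega> t / m $ u)"

text \<open>The measure \<open>E\<^sub>x\<^sub>,\<^sub>y\<close> carried by pairs (path, duration):
  the local time at \<open>y\<close> has density 1 / m_y on the times spent in
  \<open>y\<close>.\<close>

definition bridge_measure :: "'x \<Rightarrow> 'x \<Rightarrow> ('w \<times> real) measure" where
  "bridge_measure x y = density (P x \<Otimes>\<^sub>M lborel) (\<lambda>(\<omega>, t). ennreal (state_ind y \<omega> t / m $ y))"

lemma local_time_field_eq: "\<omega> \<in> space (P x) \<Longrightarrow> local_time_field Z m \<omega> t = occupation_field (\<omega>, t)"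
  by (simp add: local_time_field_def occupation_field_def local_time_eq)

lemma occupation_field_nonneg: "0 \<le> occupation_field a $ u"
  using m_pos[of u] by (simp add: occupation_field_def occupation_nonneg split: prod.split)

lemma measurable_occupation_field: "occupation_field \<in> borel_measurable (P x \<Otimes>\<^sub>M borel)"
proof -
  note [measurable (raw)] = measurable_occupation_comp[of _ _ x]
  show ?thesis
    unfolding occupation_field_def case_prod_beta
    by (intro borel_measurable_vec_lambda) measurable
qed

lemma measurable_bridge_density:
  "(\<lambda>(\<omega>, t). state_ind y \<omega> t / m $ y) \<in> borel_measurable (P x \<Otimes>\<^sub>M lborel)"
  using measurable_state_ind[of y x] by (simp add: case_prod_beta)

lemma bridge_density_nonneg: "0 \<le> state_ind y \<omega> t / m $ y"
  using m_pos[of y] by simp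

lemma sets_bridge_measure [measurable_cong]: "sets (bridge_measure x y) = sets (P x \<Otimes>\<^sub>M borel)"
  unfolding bridge_measure_def sets_density by (intro sets_pair_measure_cong) auto

text \<open>Where the density is nonzero the path is in \<open>y\<close>, hence before its lifetime,
  so the restriction on the duration is absorbed. What remains is Tonelli's theorem.\<close>

lemma bridge_nn_expectation_eq:
  fixes G :: "'w \<times> real \<Rightarrow> ennreal"
  assumes G: "G \<in> borel_measurable (P x \<Otimes>\<^sub>M borel)"
    and G': "\<And>\<omega> t. \<omega> \<in> space (P x) \<Longrightarrow> G' \<omega> t = G (\<omega>, t)"
  shows "bridge_nn_expectation P Z m x y G' = (\<integral>\<^sup>+a. G a \<partial>bridge_measure x y)"
proof -
  interpret prob_space "P x" by (rule prob_space)
  interpret pair_sigma_finite "P x" lborel ..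
  have [measurable]: "G \<in> borel_measurable (P x \<Otimes>\<^sub>M lborel)" using G by simp
  note [measurable] = measurable_bridge_density[of y x]
  have path: "(\<integral>\<^sup>+t\<in>{t. 0 \<le> t \<and> ereal t < lifetime Z \<omega>}. G' \<omega> t \<partial>local_time_measure Z m y \<omega>) =
      (\<integral>\<^sup>+t. ennreal (state_ind y \<omega> t / m $ y) * G (\<omega>, t) \<partial>lborel)" if \<omega>: "\<omega> \<in> space (P x)" for \<omega>
  proof -
    note [measurable] = measurable_state_ind_path[OF \<omega>]
    have [measurable]: "(\<lambda>t. G (\<omega>, t)) \<in> borel_measurable borel"
      using measurable_compose[OF measurable_Pair1'[OF \<omega>] G] by simp
    have "(\<integral>\<^sup>+t\<in>{t. 0 \<le> t \<and> ereal t < lifetime Z \<omega>}. G' \<omega> t \<partial>local_time_measure Z m y \<omega>) =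
        (\<integral>\<^sup>+t. ennreal (state_ind y \<omega> t / m $ y) * (G (\<omega>, t) * indicator {t. 0 \<le> t \<and> ereal t < lifetime Z \<omega>} t) \<partial>lborel)"
      unfolding local_time_measure_eq[OF \<omega>] G'[OF \<omega>] by (rule nn_integral_density) measurable
    also have "\<dots> = (\<integral>\<^sup>+t. ennreal (state_ind y \<omega> t / m $ y) * G (\<omega>, t) \<partial>lborel)"
      using less_lifetime[OF \<omega>] by (intro nn_integral_cong) (auto simp: indicator_def state_ind_def)
    finally show ?thesis .
  qed
  have "bridge_nn_expectation P Z m x y G' =
      (\<integral>\<^sup>+\<omega>. (\<integral>\<^sup>+t. ennreal (state_ind y \<omega> t / m $ y) * G (\<omega>, t) \<partial>lborel) \<partial>P x)"
    unfolding bridge_nn_expectation_def by (intro nn_integral_cong path)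
  also have "\<dots> = (\<integral>\<^sup>+a. (case a of (\<omega>, t) \<Rightarrow> ennreal (state_ind y \<omega> t / m $ y)) * G a \<partial>(P x \<Otimes>\<^sub>M lborel))"
    by (subst lborel.nn_integral_fst[symmetric]) (simp_all add: case_prod_beta)
  also have "\<dots> = (\<integral>\<^sup>+a. G a \<partial>bridge_measure x y)"
    unfolding bridge_measure_def by (rule nn_integral_density[symmetric]) measurable
  finally show ?thesis .
qed

definition bridge_density :: "'x \<Rightarrow> 'w \<times> real \<Rightarrow> real" where
  "bridge_density y = (\<lambda>(\<omega>, t). state_ind y \<omega> t / m $ y)"

lemma measurable_bridge_density_real: "bridge_density y \<in> borel_measurable (P x \<Otimes>\<^sub>M lborel)"
  unfolding bridge_density_def by (rule measurable_bridge_density)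

text \<open>Measurability of \<open>G\<close> suffices, so the formula also covers those field
  values at which the double integral fails to converge. Measurability in the field variable rests
  on this.\<close>

lemma bridge_expectation_iterated:
  fixes G :: "'w \<times> real \<Rightarrow> complex"
  assumes G: "G \<in> borel_measurable (P x \<Otimes>\<^sub>M borel)"
    and G': "\<And>\<omega> t. \<omega> \<in> space (P x) \<Longrightarrow> G' \<omega> t = G (\<omega>, t)"
  shows "bridge_expectation P Z m x y G' = (\<integral>\<omega>. (\<integral>t. bridge_density y (\<omega>, t) *\<^sub>R G (\<omega>, t) \<partial>lborel) \<partial>P x)"
  unfolding bridge_expectation_def
proof (intro Bochner_Integration.integral_cong refl)
  fix \<omega> assume \<omega>: "\<omega> \<in> space (P x)"
  note [measurable] = measurable_state_ind_path[OF \<omega>]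
  have [measurable]: "(\<lambda>t. G (\<omega>, t)) \<in> borel_measurable borel"
    using measurable_compose[OF measurable_Pair1'[OF \<omega>] G] by simp
  have "(LINT t:{t. 0 \<le> t \<and> ereal t < lifetime Z \<omega>}|local_time_measure Z m y \<omega>. G' \<omega> t) =
      (\<integral>t. (state_ind y \<omega> t / m $ y) *\<^sub>R (indicator {t. 0 \<le> t \<and> ereal t < lifetime Z \<omega>} t *\<^sub>R G (\<omega>, t)) \<partial>lborel)"
    unfolding local_time_measure_eq[OF \<omega>] G'[OF \<omega>] set_lebesgue_integral_def
    by (rule integral_density) (auto simp: bridge_density_nonneg)
  also have "\<dots> = (\<integral>t. bridge_density y (\<omega>, t) *\<^sub>R G (\<omega>, t) \<partial>lborel)"
    using less_lifetime[OF \<omega>]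
    by (intro Bochner_Integration.integral_cong) (auto simp: indicator_def state_ind_def bridge_density_def)
  finally show "(LINT t:{t. 0 \<le> t \<and> ereal t < lifetime Z \<omega>}|local_time_measure Z m y \<omega>. G' \<omega> t) =
      (\<integral>t. bridge_density y (\<omega>, t) *\<^sub>R G (\<omega>, t) \<partial>lborel)" .
qed

lemma bridge_expectation_eq:
  fixes G :: "'w \<times> real \<Rightarrow> complex"
  assumes int: "integrable (bridge_measure x y) G"
    and G': "\<And>\<omega> t. \<omega> \<in> space (P x) \<Longrightarrow> G' \<omega> t = G (\<omega>, t)"
  shows "bridge_expectation P Z m x y G' = (\<integral>a. G a \<partial>bridge_measure x y)"
proof -
  interpret prob_space "P x" by (rule prob_space)
  interpret pair_sigma_finite "P x" lborel ..
  have G: "G \<in> borel_measurable (P x \<Otimes>\<^sub>M borel)"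
    using borel_measurable_integrable[OF int] by measurable
  then have [measurable]: "G \<in> borel_measurable (P x \<Otimes>\<^sub>M lborel)" by simp
  note [measurable] = measurable_bridge_density_real[of y x]
  have nonneg: "0 \<le> bridge_density y a" for a
    unfolding bridge_density_def case_prod_unfold by (rule bridge_density_nonneg)
  have density: "bridge_measure x y = density (P x \<Otimes>\<^sub>M lborel) (\<lambda>a. ennreal (bridge_density y a))"
    unfolding bridge_measure_def bridge_density_def by (simp only: case_prod_unfold)
  have int': "integrable (P x \<Otimes>\<^sub>M lborel) (\<lambda>a. bridge_density y a *\<^sub>R G a)"
    using int unfolding density by (subst (asm) integrable_density) (auto simp: nonneg)
  have "bridge_expectation P Z m x y G' = (\<integral>a. bridge_density y a *\<^sub>R G a \<partial>(P x \<Otimes>\<^sub>M lborel))"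
    using bridge_expectation_iterated[OF G, of G' y, OF G'] integral_fst'[OF int'] by simp
  also have "\<dots> = (\<integral>a. G a \<partial>bridge_measure x y)"
    unfolding density by (rule integral_density[symmetric]) (auto simp: nonneg)
  finally show ?thesis .
qed

text \<open>Equality almost everywhere with a measurable function would not suffice in the final step:
  \<open>lborel\<close> is not complete and the integral of a function that is not measurable is 0.\<close>

lemma measurable_bridge_expectation:
  fixes G :: "'a \<Rightarrow> 'w \<times> real \<Rightarrow> complex"
  assumes G: "(\<lambda>(a, q). G a q) \<in> borel_measurable (N \<Otimes>\<^sub>M (P x \<Otimes>\<^sub>M borel))"
    and G': "\<And>a \<omega> t. \<omega> \<in> space (P x) \<Longrightarrow> G' a \<omega> t = G a (\<omega>, t)"
  shows "(\<lambda>a. bridge_expectation P Z m x y (G' a)) \<in> borel_measurable N"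
proof -
  interpret prob_space "P x" by (rule prob_space)
  note [measurable] = measurable_bridge_density_real[of y x] G
  have "(\<lambda>b. (fst (fst b), snd (fst b), snd b)) \<in> measurable ((N \<Otimes>\<^sub>M P x) \<Otimes>\<^sub>M lborel) (N \<Otimes>\<^sub>M (P x \<Otimes>\<^sub>M borel))"
    by measurable
  from measurable_compose[OF this G]
  have [measurable]: "(\<lambda>b. G (fst (fst b)) (snd (fst b), snd b)) \<in> borel_measurable ((N \<Otimes>\<^sub>M P x) \<Otimes>\<^sub>M lborel)"
    by simp
  have "(\<lambda>a. \<integral>\<omega>. (\<integral>t. bridge_density y (\<omega>, t) *\<^sub>R G a (\<omega>, t) \<partial>lborel) \<partial>P x) \<in> borel_measurable N"
    by measurable
  also have "?this \<longleftrightarrow> ?thesis"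
  proof (rule measurable_cong)
    fix a assume "a \<in> space N"
    then have "G a \<in> borel_measurable (P x \<Otimes>\<^sub>M borel)"
      using measurable_compose[OF measurable_Pair1' G] by simp
    from bridge_expectation_iterated[OF this G']
    show "(\<integral>\<omega>. (\<integral>t. bridge_density y (\<omega>, t) *\<^sub>R G a (\<omega>, t) \<partial>lborel) \<partial>P x) = bridge_expectation P Z m x y (G' a)"
      by simp
  qed
  finally show ?thesis .
qed

text \<open>With k = c / m the exponent is the additive functional of the occupation times, so the
  transform is the killed potential divided by m_y. The factors of \<open>m\<close> convert the
  resolvent equation into one for the matrix \<open>B\<close>.\<close>

lemma bridge_laplace:
  fixes c :: "real^'x"
  assumes c: "\<And>u. 0 \<le> c $ u"
  shows "integrable (bridge_measure x y) (\<lambda>a. exp (- (c \<bullet> occupation_field a)))"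
    and "(\<Sum>v\<in>UNIV. (\<integral>a. exp (- (c \<bullet> occupation_field a)) \<partial>bridge_measure x v) *
      (m $ v * - L $ v $ y + (if v = y then c $ v else 0))) = (if x = y then 1 else 0)"
proof -
  define k where "k u = c $ u / m $ u" for u
  have k: "0 \<le> k u" for u unfolding k_def by (rule divide_nonneg_pos[OF c m_pos])
  obtain u where
    u: "\<And>x y. (\<integral>\<^sup>+t. killed k x y t \<partial>lborel) = ennreal (u x y)" "\<And>x y. 0 \<le> u x y"
    "\<And>x y. (\<Sum>w\<in>UNIV. u x w * (- L $ w $ y + (if w = y then k y else 0))) = (if x = y then 1 else 0)"
    by (rule killed_resolvent[of k, OF k potential_matrix_inverse[OF irreducible]]) blast
  have exp_eq: "c \<bullet> occupation_field (\<omega>, t) = additive k \<omega> t" for \<omega> t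
    by (simp add: inner_vec_def occupation_field_def additive_def[of k, OF k] k_def)
  have nn: "(\<integral>\<^sup>+a. ennreal (exp (- (c \<bullet> occupation_field a))) \<partial>bridge_measure x y) = ennreal (u x y / m $ y)" for x y
  proof -
    interpret prob_space "P x" by (rule prob_space)
    interpret pair_sigma_finite "P x" lborel ..
    note [measurable] = measurable_occupation_field[of x] measurable_bridge_density[of y x]
    note [measurable (raw)] = measurable_state_ind_comp[of _ _ x] measurable_additive_comp[of k _ _ x, OF k]
    have [measurable]: "occupation_field \<in> borel_measurable (P x \<Otimes>\<^sub>M lborel)" using measurable_occupation_field[of x] by simp
    have "(\<integral>\<^sup>+a. ennreal (exp (- (c \<bullet> occupation_field a))) \<partial>bridge_measure x y) =
        (\<integral>\<^sup>+a. (case a of (\<omega>, t) \<Rightarrow> ennreal (state_ind y \<omega> t / m $ y)) * ennreal (exp (- (c \<bullet> occupation_field a))) \<partial>(P x \<Otimes>\<^sub>M lborel))"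
      unfolding bridge_measure_def by (rule nn_integral_density) measurable
    also have "\<dots> = (\<integral>\<^sup>+a. (case a of (\<omega>, t) \<Rightarrow> ennreal (1 / m $ y) * ennreal (exp (- additive k \<omega> t) * state_ind y \<omega> t)) \<partial>(P x \<Otimes>\<^sub>M lborel))"
      using m_pos[of y]
      by (intro nn_integral_cong) (auto simp: exp_eq ennreal_mult[symmetric] field_simps)
    also have "\<dots> = (\<integral>\<^sup>+t. (\<integral>\<^sup>+\<omega>. ennreal (1 / m $ y) * ennreal (exp (- additive k \<omega> t) * state_ind y \<omega> t) \<partial>P x) \<partial>lborel)"
      by (subst nn_integral_snd[symmetric]) (simp_all add: case_prod_beta)
    also have "\<dots> = (\<integral>\<^sup>+t. ennreal (1 / m $ y) * killed k x y t \<partial>lborel)"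
      unfolding killed_def[of k, OF k] by (intro nn_integral_cong nn_integral_cmult) measurable
    also have "\<dots> = ennreal (1 / m $ y) * ennreal (u x y)"
      using measurable_killed[of k x y, OF k] by (simp add: nn_integral_cmult u)
    also have "\<dots> = ennreal (u x y / m $ y)"
      using m_pos[of y] u(2)[of x y] by (simp add: ennreal_mult[symmetric])
    finally show ?thesis .
  qed
  have int: "integrable (bridge_measure x y) (\<lambda>a. exp (- (c \<bullet> occupation_field a)))" for x y
  proof (rule integrableI_bounded)
    note [measurable] = measurable_occupation_field[of x]
    show "(\<lambda>a. exp (- (c \<bullet> occupation_field a))) \<in> borel_measurable (bridge_measure x y)" by measurable
  qed (simp add: nn)
  then show "integrable (bridge_measure x y) (\<lambda>a. exp (- (c \<bullet> occupation_field a)))" .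
  have eq: "(\<integral>a. exp (- (c \<bullet> occupation_field a)) \<partial>bridge_measure x y) = u x y / m $ y" for x y
    using u(2)[of x y] m_pos[of y] nn[of x y] int[of x y]
    by (subst integral_eq_nn_integral) (auto intro: borel_measurable_integrable)
  have "u x v / m $ v * (m $ v * - L $ v $ y + (if v = y then c $ v else 0)) =
      u x v * (- L $ v $ y + (if v = y then k y else 0))" for v
    using m_pos[of v] by (auto simp: k_def field_simps)
  then show "(\<Sum>v\<in>UNIV. (\<integral>a. exp (- (c \<bullet> occupation_field a)) \<partial>bridge_measure x v) *
      (m $ v * - L $ v $ y + (if v = y then c $ v else 0))) = (if x = y then 1 else 0)"
    unfolding eq using u(3)[of x y] by simp
qed

end

section \<open>The Gaussian side and its comparison with the bridges\<close>

context killed_potential_process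
begin

lemma half_square_nonneg: "0 \<le> half_square z $ u"
  by (simp add: half_square_def)

lemma measurable_half_square [measurable]: "half_square \<in> borel_measurable borel"
  unfolding half_square_def
  by (intro borel_measurable_continuous_onI continuous_on_vec_lambda continuous_intros) auto

text \<open>The constant 1 is the exponential with c = 0.\<close>

lemma finite_bridge_measure: "finite_measure (bridge_measure x y)"
proof -
  have "integrable (bridge_measure x y) (\<lambda>_. 1 :: real)"
    using bridge_laplace(1)[of 0 x y] by simp
  then show ?thesis by (intro finite_measureI) (simp add: integrable_iff_bounded less_top)
qed

definition shifted_generator :: "real^'x \<Rightarrow> real^'x^'x" where
  "shifted_generator c = (\<chi> v w. m $ v * - L $ v $ w + (if v = w then c $ v else 0))"

definition shifted_energy :: "real^'x \<Rightarrow> complex^'x \<Rightarrow> complex" where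
  "shifted_energy c z = (\<Sum>v\<in>UNIV. \<Sum>w\<in>UNIV. of_real (shifted_generator c $ v $ w) * (z $ w * cnj (z $ v)))"

lemma shifted_energy_eq: "shifted_energy c z = 2 * of_real (c \<bullet> half_square z) - energy_form L m z"
proof -
  have sq: "of_real (c $ v) * (z $ v * cnj (z $ v)) = 2 * of_real (c $ v * half_square z $ v)" for v
    by (simp add: half_square_def complex_eq_iff)
  have "shifted_energy c z = (\<Sum>v\<in>UNIV. \<Sum>w\<in>UNIV. (if v = w then of_real (c $ v) * (z $ v * cnj (z $ v)) else 0) -
      of_real (L $ v $ w) * z $ w * cnj (z $ v) * of_real (m $ v))"
    unfolding shifted_energy_def shifted_generator_def
    by (intro sum.cong refl) (auto simp: algebra_simps)
  also have "\<dots> = (\<Sum>v\<in>UNIV. of_real (c $ v) * (z $ v * cnj (z $ v))) - energy_form L m z"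
    by (simp add: sum_subtractf energy_form_def sum_distrib_right)
  also have "(\<Sum>v\<in>UNIV. of_real (c $ v) * (z $ v * cnj (z $ v))) = 2 * of_real (c \<bullet> half_square z)"
    unfolding sq inner_vec_def by (simp add: sum_distrib_left)
  finally show ?thesis .
qed

text \<open>Adding diag c to the matrix tilts the Gaussian weight by exactly the test exponential,
  since \<open>half_square\<close> carries the same factor 1 / 2 as the exponent.\<close>

lemma exp_shifted_energy:
  "exp (- shifted_energy c z / 2) = of_real (exp (- (c \<bullet> half_square z))) * exp (energy_form L m z / 2)"
proof -
  have "- shifted_energy c z / 2 = of_real (- (c \<bullet> half_square z)) + energy_form L m z / 2"
    by (simp add: shifted_energy_eq diff_divide_distrib)
  then show ?thesis by (simp only: exp_add exp_of_real)
qed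

text \<open>A nonnegative \<open>c\<close> can only increase the real part, so the coercivity
  constant of the energy form serves every \<open>c\<close>.\<close>

lemma shifted_gaussian:
  assumes "\<And>u. 0 \<le> c $ u"
  shows "integrable lborel (\<lambda>z. exp (- shifted_energy c z / 2))"
    and "integrable lborel (\<lambda>z. z $ w * cnj (z $ y) / 2 * exp (- shifted_energy c z / 2))"
    and "(\<Sum>w\<in>UNIV. of_real (shifted_generator c $ x $ w) *
        (\<integral>z. z $ w * cnj (z $ y) / 2 * exp (- shifted_energy c z / 2) \<partial>lborel))
      = (if x = y then (\<integral>z. exp (- shifted_energy c z / 2) \<partial>lborel) else 0)"
proof -
  obtain a where a: "0 < a" "\<And>z. a * (norm z)\<^sup>2 \<le> - Re (energy_form L m z)"
    by (rule energy_form_coercive) blast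
  have nonneg: "0 \<le> c \<bullet> half_square z" for z
    unfolding inner_vec_def by (intro sum_nonneg) (simp add: assms half_square_nonneg)
  have pos: "a * (norm z)\<^sup>2 \<le> Re (shifted_energy c z)" for z
    using a(2)[of z] nonneg[of z] by (simp add: shifted_energy_eq)
  note * = gaussian_covariance[OF shifted_energy_def a(1) pos]
  show "integrable lborel (\<lambda>z. exp (- shifted_energy c z / 2))" by (rule *)
  show "integrable lborel (\<lambda>z. z $ w * cnj (z $ y) / 2 * exp (- shifted_energy c z / 2))" by (rule *)
  show "(\<Sum>w\<in>UNIV. of_real (shifted_generator c $ x $ w) *
        (\<integral>z. z $ w * cnj (z $ y) / 2 * exp (- shifted_energy c z / 2) \<partial>lborel))
      = (if x = y then (\<integral>z. exp (- shifted_energy c z / 2) \<partial>lborel) else 0)" by (rule *)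
qed

text \<open>A left inverse and a right inverse of the same matrix coincide. The bridge transforms
  invert \<open>shifted_generator c\<close> from the left, the Gaussian moments from the right up to
  the total mass.\<close>

lemma laplace_identity:
  assumes c: "\<And>u. 0 \<le> c $ u"
  shows "(\<integral>z. z $ x * cnj (z $ y) / 2 * exp (- shifted_energy c z / 2) \<partial>lborel) =
    of_real (\<integral>a. exp (- (c \<bullet> occupation_field a)) \<partial>bridge_measure x y) * (\<integral>z. exp (- shifted_energy c z / 2) \<partial>lborel)"
proof -
  let ?B = "shifted_generator c"
  define g where "g w = (\<integral>z. z $ w * cnj (z $ y) / 2 * exp (- shifted_energy c z / 2) \<partial>lborel)" for w
  define I where "I = (\<integral>z. exp (- shifted_energy c z / 2) \<partial>lborel)"
  define G where "G v = (\<integral>a. exp (- (c \<bullet> occupation_field a)) \<partial>bridge_measure x v)" for v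
  have GB: "(\<Sum>v\<in>UNIV. complex_of_real (G v) * of_real (?B $ v $ w)) = (if x = w then 1 else 0)" for w
  proof -
    have "(\<Sum>v\<in>UNIV. complex_of_real (G v) * of_real (?B $ v $ w)) = of_real (\<Sum>v\<in>UNIV. G v * ?B $ v $ w)"
      by simp
    also have "(\<Sum>v\<in>UNIV. G v * ?B $ v $ w) = (if x = w then 1 else 0)"
      using bridge_laplace(2)[of c x w, OF c] by (simp add: shifted_generator_def G_def)
    finally show ?thesis by simp
  qed
  have "g x = (\<Sum>w\<in>UNIV. (if x = w then 1 else 0) * g w)"
  proof -
    have "(if x = w then 1 else 0) * g w = (if x = w then g w else 0)" for w by simp
    then show ?thesis by simp
  qed
  also have "\<dots> = (\<Sum>w\<in>UNIV. \<Sum>v\<in>UNIV. of_real (G v) * (of_real (?B $ v $ w) * g w))"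
    unfolding GB[symmetric] by (simp add: sum_distrib_right mult.assoc)
  also have "\<dots> = (\<Sum>v\<in>UNIV. of_real (G v) * (\<Sum>w\<in>UNIV. of_real (?B $ v $ w) * g w))"
    unfolding sum_distrib_left by (rule sum.swap)
  also have "\<dots> = (\<Sum>v\<in>UNIV. if v = y then of_real (G v) * I else 0)"
    unfolding g_def I_def shifted_gaussian(3)[OF c] by (intro sum.cong) auto
  finally show ?thesis by (simp add: g_def I_def G_def)
qed

theorem dynkin_isomorphism:
  fixes F :: "real^'x \<Rightarrow> complex"
  assumes F: "continuous_on {v. \<forall>u. 0 \<le> v $ u} F"
    and int1: "integrable lborel (\<lambda>z :: complex^'x.
           z $ x * cnj (z $ y) / 2 * F (half_square z) * exp (energy_form L m z / 2))"
    and int2: "(\<integral>\<^sup>+z. bridge_nn_expectation P Z m x y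
             (\<lambda>\<omega> t. ennreal (norm (F (local_time_field Z m \<omega> t + half_square z)))) *
           ennreal (norm (exp (energy_form L m z / 2))) \<partial>(lborel :: (complex^'x) measure)) < \<infinity>"
  shows "(\<integral>z. z $ x * cnj (z $ y) / 2 * F (half_square z) * exp (energy_form L m z / 2)
            \<partial>(lborel :: (complex^'x) measure)) =
         (\<integral>z. bridge_expectation P Z m x y (\<lambda>\<omega> t. F (local_time_field Z m \<omega> t + half_square z)) *
            exp (energy_form L m z / 2) \<partial>(lborel :: (complex^'x) measure))"
proof -
  define M where "M = bridge_measure x y"
  interpret M: finite_measure M unfolding M_def by (rule finite_bridge_measure)
  interpret pair: pair_sigma_finite "lborel :: (complex^'x) measure" M ..
  define e where "e z = exp (energy_form L m z / 2)" for z
  define T where "T q = occupation_field (snd q) + half_square (fst q)" for q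
  have occupation_field_M [measurable]: "occupation_field \<in> borel_measurable M"
    unfolding M_def using measurable_occupation_field[of x] by measurable
  have T: "T \<in> borel_measurable (lborel \<Otimes>\<^sub>M M)"
    unfolding T_def by measurable
  have T_nonneg: "0 \<le> T q $ u" for q u
    by (simp add: T_def occupation_field_nonneg half_square_nonneg)
  have e0: "exp (- shifted_energy 0 z / 2) = e z" for z
    unfolding exp_shifted_energy e_def by simp
  have int_e: "integrable lborel e"
    using shifted_gaussian(1)[of 0] unfolding e0 by simp
  then have [measurable]: "e \<in> borel_measurable borel" by simp
  have int_w1: "integrable lborel (\<lambda>z. z $ x * cnj (z $ y) / 2 * e z)"
    using shifted_gaussian(2)[of 0 x y] unfolding e0 by simp
  \<comment> \<open>The weight does not depend on the path, and \<open>M\<close> is finite.\<close>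
  have int_w2: "integrable (lborel \<Otimes>\<^sub>M M) (\<lambda>q. e (fst q))"
  proof (rule pair.Fubini_integrable)
    show "integrable lborel (\<lambda>z. \<integral>a. norm (e (fst (z, a))) \<partial>M)"
      using int_e by simp
  qed simp_all
  have laplace: "(\<integral>z. of_real (exp (- (c \<bullet> half_square z))) * (z $ x * cnj (z $ y) / 2 * e z) \<partial>lborel) =
      (\<integral>q. of_real (exp (- (c \<bullet> T q))) * e (fst q) \<partial>(lborel \<Otimes>\<^sub>M M))"
    if c: "\<And>u. 0 \<le> c $ u" for c
  proof -
    have int_cT: "integrable (lborel \<Otimes>\<^sub>M M) (\<lambda>q. of_real (exp (- (c \<bullet> T q))) * e (fst q))"
    proof (rule integrable_bounded_mult[OF int_w2])
      show "(\<lambda>q. complex_of_real (exp (- (c \<bullet> T q)))) \<in> borel_measurable (lborel \<Otimes>\<^sub>M M)"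
        using T by measurable
      have "0 \<le> c \<bullet> T q" for q
        unfolding inner_vec_def by (intro sum_nonneg) (simp add: c T_nonneg)
      then show "norm (complex_of_real (exp (- (c \<bullet> T q)))) \<le> 1" for q by simp
    qed
    have "(\<integral>q. of_real (exp (- (c \<bullet> T q))) * e (fst q) \<partial>(lborel \<Otimes>\<^sub>M M)) =
        (\<integral>z. (\<integral>a. of_real (exp (- (c \<bullet> occupation_field a))) * exp (- shifted_energy c z / 2) \<partial>M) \<partial>lborel)"
    proof -
      have "of_real (exp (- (c \<bullet> T (z, a)))) * e z =
          of_real (exp (- (c \<bullet> occupation_field a))) * exp (- shifted_energy c z / 2)" for z a
        unfolding exp_shifted_energy e_def mult.assoc[symmetric] of_real_mult[symmetric] exp_add[symmetric]
        by (simp add: T_def inner_add_right)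
      then show ?thesis using pair.integral_fst'[OF int_cT] by simp
    qed
    also have "\<dots> = of_real (\<integral>a. exp (- (c \<bullet> occupation_field a)) \<partial>M) * (\<integral>z. exp (- shifted_energy c z / 2) \<partial>lborel)"
      by simp
    also have "\<dots> = (\<integral>z. z $ x * cnj (z $ y) / 2 * exp (- shifted_energy c z / 2) \<partial>lborel)"
      unfolding M_def by (rule laplace_identity[OF c, symmetric])
    finally show ?thesis unfolding exp_shifted_energy e_def by (simp add: mult_ac)
  qed
  have F_M [measurable]: "(\<lambda>q. F (T q)) \<in> borel_measurable (lborel \<Otimes>\<^sub>M M)"
    by (rule borel_measurable_orthant[OF F T T_nonneg])
  have F_path: "(\<lambda>a. F (occupation_field a + half_square z)) \<in> borel_measurable (P x \<Otimes>\<^sub>M borel)" for z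
  proof (rule borel_measurable_orthant[OF F])
    show "(\<lambda>a. occupation_field a + half_square z) \<in> borel_measurable (P x \<Otimes>\<^sub>M borel)"
      using measurable_occupation_field[of x] by measurable
  qed (simp add: occupation_field_nonneg half_square_nonneg)
  \<comment> \<open>By Tonelli, the second convergence hypothesis is the finiteness of one integral
    over the product space.\<close>
  have int_F: "integrable (lborel \<Otimes>\<^sub>M M) (\<lambda>q. F (T q) * e (fst q))"
  proof (rule integrableI_bounded)
    have meas: "(\<lambda>q. ennreal (norm (F (T q) * e (fst q)))) \<in> borel_measurable (lborel \<Otimes>\<^sub>M M)"
      by measurable
    have "(\<integral>\<^sup>+q. ennreal (norm (F (T q) * e (fst q))) \<partial>(lborel \<Otimes>\<^sub>M M)) =
        (\<integral>\<^sup>+z. (\<integral>\<^sup>+a. ennreal (norm (F (occupation_field a + half_square z))) * ennreal (norm (e z)) \<partial>M) \<partial>lborel)"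
      unfolding M.nn_integral_fst[OF meas, symmetric] by (simp add: T_def norm_mult ennreal_mult)
    also have "\<dots> = (\<integral>\<^sup>+z. bridge_nn_expectation P Z m x y
          (\<lambda>\<omega> t. ennreal (norm (F (local_time_field Z m \<omega> t + half_square z)))) * ennreal (norm (e z)) \<partial>lborel)"
    proof (rule nn_integral_cong)
      fix z
      note [measurable] = F_path[of z]
      have [measurable]: "(\<lambda>a. F (occupation_field a + half_square z)) \<in> borel_measurable M"
        unfolding M_def by measurable
      have "(\<integral>\<^sup>+a. ennreal (norm (F (occupation_field a + half_square z))) * ennreal (norm (e z)) \<partial>M) =
          (\<integral>\<^sup>+a. ennreal (norm (F (occupation_field a + half_square z))) \<partial>M) * ennreal (norm (e z))"
        by (rule nn_integral_multc) measurable
      also have "(\<integral>\<^sup>+a. ennreal (norm (F (occupation_field a + half_square z))) \<partial>M) = bridge_nn_expectation P Z m x y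
          (\<lambda>\<omega> t. ennreal (norm (F (local_time_field Z m \<omega> t + half_square z))))"
        unfolding M_def
        by (rule bridge_nn_expectation_eq[symmetric]) (measurable, simp add: local_time_field_eq)
      finally show "(\<integral>\<^sup>+a. ennreal (norm (F (occupation_field a + half_square z))) * ennreal (norm (e z)) \<partial>M) =
        bridge_nn_expectation P Z m x y
          (\<lambda>\<omega> t. ennreal (norm (F (local_time_field Z m \<omega> t + half_square z)))) * ennreal (norm (e z))" .
    qed
    also have "\<dots> < \<infinity>" using int2 by (simp add: e_def)
    finally show "(\<integral>\<^sup>+q. ennreal (norm (F (T q) * e (fst q))) \<partial>(lborel \<Otimes>\<^sub>M M)) < \<infinity>" .
  qed measurable
  have "(\<integral>z. z $ x * cnj (z $ y) / 2 * F (half_square z) * exp (energy_form L m z / 2) \<partial>lborel) =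
      (\<integral>z. F (half_square z) * (z $ x * cnj (z $ y) / 2 * e z) \<partial>lborel)"
    by (simp add: e_def mult_ac)
  also have "\<dots> = (\<integral>q. F (T q) * e (fst q) \<partial>(lborel \<Otimes>\<^sub>M M))"
  proof (rule laplace_unique[OF _ _ T T_nonneg int_w1 int_w2 laplace F _ int_F])
    show "integrable lborel (\<lambda>z. F (half_square z) * (z $ x * cnj (z $ y) / 2 * e z))"
      using int1 by (simp add: e_def mult_ac)
  qed (auto simp: half_square_nonneg)
  also have "\<dots> = (\<integral>z. (\<integral>a. F (occupation_field a + half_square z) * e z \<partial>M) \<partial>lborel)"
    using pair.integral_fst'[OF int_F] by (simp add: T_def)
  also have "\<dots> = (\<integral>z. bridge_expectation P Z m x y (\<lambda>\<omega> t. F (local_time_field Z m \<omega> t + half_square z)) * e z \<partial>lborel)"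
  proof (rule integral_cong_AE)
    show "(\<lambda>z. \<integral>a. F (occupation_field a + half_square z) * e z \<partial>M) \<in> borel_measurable lborel"
      using pair.integrable_fst'[OF int_F] by (simp add: T_def)
    have "(\<lambda>(z, a). F (occupation_field a + half_square z)) \<in> borel_measurable (lborel \<Otimes>\<^sub>M (P x \<Otimes>\<^sub>M borel))"
      unfolding case_prod_unfold
    proof (rule borel_measurable_orthant[OF F])
      note [measurable] = measurable_occupation_field[of x]
      show "(\<lambda>q. occupation_field (snd q) + half_square (fst q)) \<in> borel_measurable (lborel \<Otimes>\<^sub>M (P x \<Otimes>\<^sub>M borel))"
        by measurable
    qed (simp add: occupation_field_nonneg half_square_nonneg)
    from measurable_bridge_expectation[OF this,
        of "\<lambda>z \<omega> t. F (local_time_field Z m \<omega> t + half_square z)" y]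
    show "(\<lambda>z. bridge_expectation P Z m x y (\<lambda>\<omega> t. F (local_time_field Z m \<omega> t + half_square z)) * e z)
        \<in> borel_measurable lborel"
      by (simp add: local_time_field_eq)
    show "AE z in lborel. (\<integral>a. F (occupation_field a + half_square z) * e z \<partial>M) =
        bridge_expectation P Z m x y (\<lambda>\<omega> t. F (local_time_field Z m \<omega> t + half_square z)) * e z"
      using pair.AE_integrable_fst'[OF int_F]
    proof eventually_elim
      case (elim z)
      \<comment> \<open>The factor \<open>e z\<close> is a nonzero constant on the slice, so it can
        be divided out. This gives integrability of \<open>F\<close> itself under the bridge measure
        for almost every z.\<close>
      then have "integrable M (\<lambda>a. F (occupation_field a + half_square z) * e z * inverse (e z))"
        unfolding T_def fst_conv snd_conv by (rule integrable_mult_left)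
      moreover have "F (occupation_field a + half_square z) * e z * inverse (e z) = F (occupation_field a + half_square z)" for a
        by (simp add: e_def)
      ultimately have "integrable M (\<lambda>a. F (occupation_field a + half_square z))" by (simp only:)
      then have "bridge_expectation P Z m x y (\<lambda>\<omega> t. F (local_time_field Z m \<omega> t + half_square z)) =
          (\<integral>a. F (occupation_field a + half_square z) \<partial>M)"
        unfolding M_def by (rule bridge_expectation_eq) (simp add: local_time_field_eq)
      then show ?case by simp
    qed
  qed
  finally show ?thesis by (simp add: e_def)
qed

end

theorem proposition1:
  fixes L :: "real^'x^'x::finite"
    and P :: "'x \<Rightarrow> 'w measure"
    and Z :: "real \<Rightarrow> 'w \<Rightarrow> 'x option"
    and \<mu> :: "'x pmf"
    and m :: "real^'x"
    and x y :: 'x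
    and F :: "real^'x \<Rightarrow> complex"
  assumes "irreducible_killed_generator L"
    and "killed_markov_process L P Z"
    and "m = potential_measure L \<mu>"
    and "continuous_on {v. \<forall>u. 0 \<le> v $ u} F"
    and "integrable lborel (\<lambda>z :: complex^'x.
           z $ x * cnj (z $ y) / 2 * F (half_square z) * exp (energy_form L m z / 2))"
    and "(\<integral>\<^sup>+z. bridge_nn_expectation P Z m x y
             (\<lambda>\<omega> t. ennreal (norm (F (local_time_field Z m \<omega> t + half_square z)))) *
           ennreal (norm (exp (energy_form L m z / 2))) \<partial>(lborel :: (complex^'x) measure)) < \<infinity>"
  shows "(\<integral>z. z $ x * cnj (z $ y) / 2 * F (half_square z) * exp (energy_form L m z / 2)
            \<partial>(lborel :: (complex^'x) measure)) =
         (\<integral>z. bridge_expectation P Z m x y (\<lambda>\<omega> t. F (local_time_field Z m \<omega> t + half_square z)) *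
            exp (energy_form L m z / 2) \<partial>(lborel :: (complex^'x) measure))"
proof -
  interpret killed_markov_process L P Z by fact
  \<comment> \<open>The process supplies the sign of the potential matrix that
    \<open>positive_potential\<close> assumes.\<close>
  interpret killed_potential_process L P Z \<mu> m
    by unfold_locales
      (use assms potential(2)[OF potential_matrix_inverse(1)[OF assms(1)]] in auto)
  show ?thesis by (rule dynkin_isomorphism) fact+
qed

end
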